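(* Let $\mathbb{K}$ be an algebraically closed field of characteristic $0$, let $n\ge 2$ and $0\le k\le n-1$, and let $f\in\mathbb{K}[x_0,\dots,x_n]$ be a homogeneous cubic polynomial such that $V(f)\subset\mathbb{P}^n$ is smooth. Then $f$ is of Thom-Sebastiani type of the form $$f=f_1(x_0,\dots,x_k)+f_2(x_{k+1},\dots,x_n)$$ up to a linear change of coordinates (i.e. there are linearly independent linear forms $l_0,\dots,l_n$ and cubic forms $f_1,f_2$ in $k+1$ and $n-k$ variables respectively with $f=f_1(l_0,\dots,l_k)+f_2(l_{k+1},\dots,l_n)$) if and only if the locus $\mathcal{D}_{k+1}(f)\subseteq\mathbb{P}^n$ contains a $k$-dimensional projective linear subspace $\mathbb{P}^k$.
   Context: $H_f(x)$ denotes the Hessian matrix $\left(\frac{\partial^2 f}{\partial x_i\partial x_j}\right)_{0\le i,j\le n}$ of $f$ evaluated at $x$, and $\mathcal{D}_m(f)=\{[x]\in\mathbb{P}^n \mid \operatorname{Rank}(H_f(x))\le m\}$. *)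

theory Defs
  imports "HOL-Library.Poly_Mapping" "Jordan_Normal_Form.DL_Rank"
begin

section \<open>Polynomials in the variables $x_0, x_1, \dots$\<close>

text \<open>
  A monomial is a finitely supported exponent vector, and a polynomial is a finitely supported
  coefficient function on monomials; ring operations are those of \<^theory>\<open>HOL-Library.Poly_Mapping\<close>.
  The constant polynomial \<open>c\<close> is \<open>Poly_Mapping.single 0 c\<close>.
\<close>

type_synonym 'a mpoly = "(nat \<Rightarrow>\<^sub>0 nat) \<Rightarrow>\<^sub>0 'a"

definition mdeg :: "(nat \<Rightarrow>\<^sub>0 nat) \<Rightarrow> nat" where
  "mdeg m = (\<Sum>i\<in>Poly_Mapping.keys m. Poly_Mapping.lookup m i)"

text \<open>Homogeneous polynomials of degree \<open>d\<close> (including 0) in the variables \<open>x\<^sub>i\<close> with \<open>i \<in> I\<close>.\<close>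

definition forms :: "nat set \<Rightarrow> nat \<Rightarrow> 'a::zero mpoly set" where
  "forms I d = {p. \<forall>m\<in>Poly_Mapping.keys p. Poly_Mapping.keys m \<subseteq> I \<and> mdeg m = d}"

definition eval_mpoly :: "(nat \<Rightarrow> 'a) \<Rightarrow> 'a::comm_ring_1 mpoly \<Rightarrow> 'a" where
  "eval_mpoly x p = (\<Sum>m\<in>Poly_Mapping.keys p.
     Poly_Mapping.lookup p m * (\<Prod>i\<in>Poly_Mapping.keys m. x i ^ Poly_Mapping.lookup m i))"

definition subst_mpoly :: "(nat \<Rightarrow> 'a mpoly) \<Rightarrow> 'a::comm_ring_1 mpoly \<Rightarrow> 'a mpoly" where
  "subst_mpoly l p = (\<Sum>m\<in>Poly_Mapping.keys p.
     Poly_Mapping.single 0 (Poly_Mapping.lookup p m)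
       * (\<Prod>i\<in>Poly_Mapping.keys m. l i ^ Poly_Mapping.lookup m i))"

text \<open>
  The exponent subtraction below is truncated, but it truncates only for monomials not
  containing \<open>x\<^sub>i\<close>, and those get coefficient 0.
\<close>

definition partial :: "nat \<Rightarrow> 'a::comm_ring_1 mpoly \<Rightarrow> 'a mpoly" where
  "partial i p = (\<Sum>m\<in>Poly_Mapping.keys p.
     Poly_Mapping.single (m - Poly_Mapping.single i 1)
       (of_nat (Poly_Mapping.lookup m i) * Poly_Mapping.lookup p m))"

definition hessian :: "nat \<Rightarrow> 'a::comm_ring_1 mpoly \<Rightarrow> 'a vec \<Rightarrow> 'a mat" where
  "hessian n f x = mat (n + 1) (n + 1)
     (\<lambda>(i, j). eval_mpoly (\<lambda>i. x $ i) (partial i (partial j f)))"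


section \<open>Projective space\<close>

text \<open>The point \<open>[x]\<close> of projective space is the set of nonzero multiples of the vector \<open>x\<close>.\<close>

definition proj_point :: "'a::field vec \<Rightarrow> 'a vec set" where
  "proj_point x = {c \<cdot>\<^sub>v x | c. c \<noteq> 0}"

definition proj_linear_subspace :: "nat \<Rightarrow> nat \<Rightarrow> 'a::field vec set set \<Rightarrow> bool" where
  "proj_linear_subspace n k L \<longleftrightarrow>
     (\<exists>W. VectorSpace.subspace class_ring W (module_vec TYPE('a) (n + 1)) \<and>
          vectorspace.dim class_ring ((module_vec TYPE('a) (n + 1))\<lparr>carrier := W\<rparr>) = k + 1 \<and>
          L = proj_point ` (W - {0\<^sub>v (n + 1)}))"

text \<open>The locus \<open>\<D>\<^sub>m(f)\<close> in projective \<open>n\<close>-space.\<close>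

definition hessian_locus :: "nat \<Rightarrow> nat \<Rightarrow> 'a::field mpoly \<Rightarrow> 'a vec set set" where
  "hessian_locus n m f =
     {proj_point x | x. x \<in> carrier_vec (n + 1) \<and> x \<noteq> 0\<^sub>v (n + 1) \<and>
        vec_space.rank (n + 1) (hessian n f x) \<le> m}"

text \<open>
  Smoothness of the hypersurface \<open>V(f)\<close> by the Jacobian criterion: at each of its points some
  partial derivative of \<open>f\<close> is nonzero.
\<close>

definition smooth_hypersurface :: "nat \<Rightarrow> 'a::field mpoly \<Rightarrow> bool" where
  "smooth_hypersurface n f \<longleftrightarrow>
     (\<forall>x\<in>carrier_vec (n + 1). x \<noteq> 0\<^sub>v (n + 1) \<longrightarrow> eval_mpoly (\<lambda>i. x $ i) f = 0 \<longrightarrow>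
        (\<exists>i\<le>n. eval_mpoly (\<lambda>i. x $ i) (partial i f) \<noteq> 0))"


section \<open>Cubics of Thom--Sebastiani type\<close>

definition lin_indep_forms :: "nat \<Rightarrow> (nat \<Rightarrow> 'a::field mpoly) \<Rightarrow> bool" where
  "lin_indep_forms n l \<longleftrightarrow>
     (\<forall>c. (\<Sum>i\<le>n. Poly_Mapping.single 0 (c i) * l i) = 0 \<longrightarrow> (\<forall>i\<le>n. c i = 0))"

definition thom_sebastiani_cubic :: "nat \<Rightarrow> nat \<Rightarrow> 'a::field mpoly \<Rightarrow> bool" where
  "thom_sebastiani_cubic n k f \<longleftrightarrow>
     (\<exists>l f1 f2. (\<forall>i\<le>n. l i \<in> forms {0..n} 1) \<and> lin_indep_forms n l \<and>
        f1 \<in> forms {0..k} 3 \<and> f2 \<in> forms {k+1..n} 3 \<and>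
        f = subst_mpoly l f1 + subst_mpoly l f2)"

end

(*
  Write f(x) = T(x, x, x) with T symmetric and trilinear, so that the Hessian of f at x is the form
  6 T(x, _, _), and smoothness says that T(x, x, _) is nonzero for x nonzero.  If f splits, the Hessian
  at a vector annihilated by l_(k+1), ..., l_n only involves l_0, ..., l_k and so has rank at most k + 1.

  Conversely, let W be a (k + 1)-dimensional space of vectors x for which T(x, _, _) has rank at most
  k + 1.  By smoothness the quadratic map z -> T(z, z, _) has no zero on W except 0, so by the projective
  Nullstellensatz and a count of dimensions its derivative 2 T(x, _, _) is injective on W for some x in W.
  For such x the kernel K of T(x, _, _) is a complement of W, T(x, _, _) is nondegenerate on W, and each
  T(e, _, _) is represented on W by an operator N_e that is self-adjoint with respect to T(x, _, _).
  The claim is that T(u, _, _) vanishes on W for all u in K; the cubic then splits along W + K.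

  Expanding the rank condition along the lines x + t z with z in W gives T(u, z, v) = 0 and
  T(v, z, N_z^i N_u z) = 0 for i < 3 and u, v in K.  Polarizing these in z yields algebraic identities on
  I = N_u W, in particular T(I, I, K) = 0.  If I were nonzero, the quadratic map argument applied to I
  would give a = N_u r such that N_a is injective on I; since it maps I into I, it is onto.  But
  s = N_r a is orthogonal to N_a I = I, which forces T(a, a, _) = -2 T(u, s, _) = 0 on W, and hence
  everywhere, contradicting smoothness.
*)
theory Submission
  imports Defs "HOL-Computational_Algebra.Polynomial" "HOL-Library.Function_Algebras"
    "Jordan_Normal_Form.Char_Poly"
begin

text \<open>The dimension count rests on finiteness. On the pairs (x, u) with A(x, x, _) = A(x, u,
  _), where A is the bilinear map behind a quadratic map without nontrivial zeros, one factor x of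
  A(x, x, _) may be traded for u. Every form in x therefore becomes a polynomial in u with
  coefficients of bounded degree in x, and such functions grow like degree^m. If every A(x, _, _)
  had a kernel, u could be moved along it, one coordinate of u would become independent of x, and
  the growth would be degree^(m+1).

  In the second half the obstacle is that the kernel of T(x + t z, _, _) varies with t through (1 +
  t N_z)^-1. Its expansion coefficients are reached as limits at t = 0, and each limit is a
  determinant that is nonzero at t = 0 and hence for almost all t. The coefficient i = 0 yields
  N_u^2 = 0 and T(I, I, K) = 0; i = 1 computes N_a a for a in I and makes I closed under N_a; i = 2
  makes s orthogonal to N_a I.

  Vectors are functions on the natural numbers. Coordinates beyond n are ignored by T, so they
  belong to every kernel and have to be cut off when a basis adapted to W and K is chosen.\<close>

definition fscale :: "'a::times \<Rightarrow> ('b \<Rightarrow> 'a) \<Rightarrow> 'b \<Rightarrow> 'a" where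
  "fscale c f = (\<lambda>x. c * f x)"

lemma fscale_apply: "fscale c f x = c * f x"
  by (simp add: fscale_def)

interpretation fun_space: vector_space "fscale :: 'a::field \<Rightarrow> ('b \<Rightarrow> 'a) \<Rightarrow> 'b \<Rightarrow> 'a"
  by unfold_locales (simp_all add: fscale_def fun_eq_iff algebra_simps)

lemma sum_fun_apply: "(\<Sum>i\<in>I. f i) x = (\<Sum>i\<in>I. f i x)"
  by (induction I rule: infinite_finite_induct) auto

section \<open>Linear relations forced by counting\<close>

context vector_space
begin

text \<open>Independence in the library concerns sets, while the counts below concern indexed
  families. A repeated vector gives a relation by itself and is treated as a separate case.\<close>

lemma nontrivial_relation:
  assumes "finite I" "finite B" "card B < card I" and v: "\<And>i. i \<in> I \<Longrightarrow> v i \<in> span B"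
  obtains c where "\<exists>i\<in>I. c i \<noteq> 0" "(\<Sum>i\<in>I. c i *s v i) = 0"
proof (cases "inj_on v I")
  case True
  have "\<not> independent (v ` I)"
    using independent_span_bound[OF \<open>finite B\<close>, of "v ` I"] v card_image[OF True] \<open>card B < card I\<close>
    by auto
  then obtain u where "\<exists>x\<in>v ` I. u x \<noteq> 0" "(\<Sum>x\<in>v ` I. u x *s x) = 0"
    using dependent_finite[of "v ` I"] \<open>finite I\<close> by auto
  then show ?thesis
    using that[of "u \<circ> v"] by (auto simp: sum.reindex[OF True])
next
  case False
  then obtain i j where ij: "i \<in> I" "j \<in> I" "i \<noteq> j" "v i = v j"
    by (auto simp: inj_on_def)
  define c where "c k = (if k = i then 1 else if k = j then -1 else 0 :: 'a)" for k
  have "(\<Sum>k\<in>I. c k *s v k) = (\<Sum>k\<in>{i, j}. c k *s v k)"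
    by (rule sum.mono_neutral_right) (use ij \<open>finite I\<close> in \<open>auto simp: c_def\<close>)
  also have "\<dots> = 0"
    using ij by (auto simp: c_def)
  finally show ?thesis
    using ij by (intro that[of c] bexI[of _ i]) (simp_all add: c_def)
qed

text \<open>This is linear dependence in the quotient by \<open>P\<close>: each vector splits into a
  part in \<open>P\<close> and a part in the span of \<open>B\<close>, and a relation among the
  latter parts leaves only an element of \<open>P\<close>.\<close>

lemma nontrivial_relation_mod_subspace:
  assumes "finite I" "finite B" "card B < card I" "subspace P"
    and v: "\<And>i. i \<in> I \<Longrightarrow> v i \<in> span (P \<union> B)"
  obtains c where "\<exists>i\<in>I. c i \<noteq> 0" "(\<Sum>i\<in>I. c i *s v i) \<in> P"
proof -
  have "\<exists>p b. v i = p + b \<and> p \<in> P \<and> b \<in> span B" if "i \<in> I" for i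
    using v[OF that] \<open>subspace P\<close>[folded span_eq_iff] unfolding span_Un by auto
  then obtain p b where pb: "\<And>i. i \<in> I \<Longrightarrow> v i = p i + b i \<and> p i \<in> P \<and> b i \<in> span B"
    by metis
  obtain c where c: "\<exists>i\<in>I. c i \<noteq> 0" "(\<Sum>i\<in>I. c i *s b i) = 0"
    using nontrivial_relation[of I B b] assms pb by blast
  have "(\<Sum>i\<in>I. c i *s v i) = (\<Sum>i\<in>I. c i *s p i) + (\<Sum>i\<in>I. c i *s b i)"
    by (simp add: pb scale_right_distrib sum.distrib cong: sum.cong)
  also have "\<dots> \<in> P"
    using pb c by (auto intro!: subspace_sum subspace_scale \<open>subspace P\<close>)
  finally show ?thesis
    using that c by blast
qed

end

section \<open>Homogeneous polynomial functions\<close>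

text \<open>Homogeneous polynomial functions of degree \<open>e\<close> in the coordinates below
  \<open>m\<close>. Over the infinite fields considered later they carry the same information as
  polynomials, evaluation is application, and the recursion on the degree provides the induction
  used throughout.\<close>

primrec hforms :: "nat \<Rightarrow> nat \<Rightarrow> ((nat \<Rightarrow> 'a::field) \<Rightarrow> 'a) set" where
  "hforms m 0 = {f. \<exists>c. f = (\<lambda>_. c)}"
| "hforms m (Suc e) =
     {f. \<exists>g. (\<forall>i<m. g i \<in> hforms m e) \<and> f = (\<lambda>x. \<Sum>i<m. x i * g i x)}"

lemma hforms_SucI: "(\<And>i. i < m \<Longrightarrow> g i \<in> hforms m e) \<Longrightarrow> (\<lambda>x. \<Sum>i<m. x i * g i x) \<in> hforms m (Suc e)"
  by auto

lemma hforms_SucE: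
  assumes "f \<in> hforms m (Suc e)"
  obtains g where "\<And>i. i < m \<Longrightarrow> g i \<in> hforms m e" "f = (\<lambda>x. \<Sum>i<m. x i * g i x)"
  using assms by auto

lemma hforms_const [simp]: "(\<lambda>x. c) \<in> hforms m 0"
  by auto

lemma hforms_0E:
  assumes "f \<in> hforms m 0"
  obtains c where "f = (\<lambda>_. c)"
  using assms by auto

declare hforms.simps [simp del]

lemma subspace_hforms: "fun_space.subspace (hforms m e :: ((nat \<Rightarrow> 'a::field) \<Rightarrow> 'a) set)"
proof (induction e)
  case 0
  show ?case
    by (rule fun_space.subspaceI)
      (auto simp: hforms.simps(1) fscale_def zero_fun_def plus_fun_def)
next
  case (Suc e)
  note [intro] = fun_space.subspace_0[OF Suc] fun_space.subspace_add[OF Suc] fun_space.subspace_scale[OF Suc]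
  show ?case
  proof (rule fun_space.subspaceI)
    show "(0 :: (nat \<Rightarrow> 'a) \<Rightarrow> 'a) \<in> hforms m (Suc e)"
      using hforms_SucI[of m "\<lambda>_. 0" e, OF fun_space.subspace_0[OF Suc]] by (simp add: zero_fun_def)
  next
    fix f g :: "(nat \<Rightarrow> 'a) \<Rightarrow> 'a" assume "f \<in> hforms m (Suc e)" "g \<in> hforms m (Suc e)"
    then obtain f' g' where *: "\<And>i. i < m \<Longrightarrow> f' i \<in> hforms m e" "f = (\<lambda>x. \<Sum>i<m. x i * f' i x)"
      "\<And>i. i < m \<Longrightarrow> g' i \<in> hforms m e" "g = (\<lambda>x. \<Sum>i<m. x i * g' i x)"
      by (auto elim!: hforms_SucE)
    have "f + g = (\<lambda>x. \<Sum>i<m. x i * (f' i + g' i) x)"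
      by (simp add: * fun_eq_iff distrib_left sum.distrib)
    then show "f + g \<in> hforms m (Suc e)"
      using hforms_SucI[of m "\<lambda>i. f' i + g' i" e] * by auto
  next
    fix c and f :: "(nat \<Rightarrow> 'a) \<Rightarrow> 'a" assume "f \<in> hforms m (Suc e)"
    then obtain f' where *: "\<And>i. i < m \<Longrightarrow> f' i \<in> hforms m e" "f = (\<lambda>x. \<Sum>i<m. x i * f' i x)"
      by (auto elim!: hforms_SucE)
    have "fscale c f = (\<lambda>x. \<Sum>i<m. x i * (fscale c (f' i)) x)"
      by (simp add: * fun_eq_iff sum_distrib_left mult_ac fscale_apply)
    then show "fscale c f \<in> hforms m (Suc e)"
      using hforms_SucI[of m "\<lambda>i. fscale c (f' i)" e] * by auto
  qed
qed

lemma hforms_zero [simp]: "(\<lambda>x. 0) \<in> hforms m e"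
  using fun_space.subspace_0[OF subspace_hforms[of m e]] by (simp add: zero_fun_def)

lemma hforms_add: "f \<in> hforms m e \<Longrightarrow> g \<in> hforms m e \<Longrightarrow> (\<lambda>x. f x + g x) \<in> hforms m e"
  using fun_space.subspace_add[OF subspace_hforms, of f m e g] by (simp add: plus_fun_def)

lemma hforms_scale: "f \<in> hforms m e \<Longrightarrow> (\<lambda>x. c * f x) \<in> hforms m e"
  using fun_space.subspace_scale[OF subspace_hforms, of f m e c] by (simp add: fscale_def)

lemma hforms_diff: "f \<in> hforms m e \<Longrightarrow> g \<in> hforms m e \<Longrightarrow> (\<lambda>x. f x - g x) \<in> hforms m e"
  using fun_space.subspace_diff[OF subspace_hforms, of f m e g] by (simp add: fun_diff_def)

lemma hforms_sum: "(\<And>i. i \<in> I \<Longrightarrow> f i \<in> hforms m e) \<Longrightarrow> (\<lambda>x. \<Sum>i\<in>I. f i x) \<in> hforms m e"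
  by (induction I rule: infinite_finite_induct) (auto intro: hforms_add)

lemma hforms_var_mult:
  assumes "f \<in> hforms m e" "i < m"
  shows "(\<lambda>x. x i * f x) \<in> hforms m (Suc e)"
proof -
  have "(\<lambda>x. x i * f x) = (\<lambda>x. \<Sum>j<m. x j * (if j = i then f else (\<lambda>x. 0)) x)"
  proof
    fix x :: "nat \<Rightarrow> 'a"
    have "(\<Sum>j<m. x j * (if j = i then f else (\<lambda>x. 0)) x) = (\<Sum>j<m. if j = i then x j * f x else 0)"
      by (intro sum.cong) auto
    then show "x i * f x = (\<Sum>j<m. x j * (if j = i then f else (\<lambda>x. 0)) x)"
      using assms by simp
  qed
  then show ?thesis
    using hforms_SucI[of m "\<lambda>j. if j = i then f else (\<lambda>x. 0)" e] assms by simp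
qed

lemma hforms_var: "i < m \<Longrightarrow> (\<lambda>x. x i) \<in> hforms m (Suc 0)"
  using hforms_var_mult[of "\<lambda>x. 1" m 0 i] by (simp del: hforms.simps)

lemma hforms_mult:
  assumes "f \<in> hforms m d" "g \<in> hforms m e"
  shows "(\<lambda>x. f x * g x) \<in> hforms m (d + e)"
  using assms(1)
proof (induction d arbitrary: f)
  case 0
  then show ?case
    using assms(2) by (auto intro: hforms_scale elim!: hforms_0E)
next
  case (Suc d)
  then obtain h where h: "\<And>i. i < m \<Longrightarrow> h i \<in> hforms m d" "f = (\<lambda>x. \<Sum>i<m. x i * h i x)"
    by (blast elim: hforms_SucE)
  have "(\<lambda>x. f x * g x) = (\<lambda>x. \<Sum>i<m. x i * (h i x * g x))"
    by (simp add: h fun_eq_iff sum_distrib_right mult.assoc)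
  then show ?case
    using hforms_SucI[of m "\<lambda>i x. h i x * g x" "d + e"] Suc.IH h by simp
qed

lemma hforms_mult':
  "f \<in> hforms m d \<Longrightarrow> g \<in> hforms m e \<Longrightarrow> d + e = k \<Longrightarrow> (\<lambda>x. f x * g x) \<in> hforms m k"
  using hforms_mult by blast

lemma hforms_power: "f \<in> hforms m (Suc 0) \<Longrightarrow> (\<lambda>x. f x ^ k) \<in> hforms m k"
  by (induction k) (auto intro: hforms_mult'[of _ m "Suc 0"])

lemma hforms_poly_on_line:
  assumes "f \<in> hforms m e"
  obtains p where "\<And>t. poly p t = f (\<lambda>i. a i + t * b i)"
proof -
  have "\<exists>p. \<forall>t. poly p t = f (\<lambda>i. a i + t * b i)"
    using assms
  proof (induction e arbitrary: f)
    case 0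
    then obtain c where "f = (\<lambda>_. c)"
      by (auto elim: hforms_0E)
    then have "\<forall>t. poly [:c:] t = f (\<lambda>i. a i + t * b i)"
      by simp
    then show ?case
      by blast
  next
    case (Suc e)
    then obtain h where h: "\<And>i. i < m \<Longrightarrow> h i \<in> hforms m e" "f = (\<lambda>x. \<Sum>i<m. x i * h i x)"
      by (blast elim: hforms_SucE)
    obtain p where p: "\<And>i t. i < m \<Longrightarrow> poly (p i) t = h i (\<lambda>i. a i + t * b i)"
      using Suc.IH[OF h(1)] by metis
    have "poly (\<Sum>i<m. [:a i, b i:] * p i) t = f (\<lambda>i. a i + t * b i)" for t
      unfolding h(2) poly_sum by (intro sum.cong) (auto simp: p algebra_simps)
    then show ?case
      by blast
  qed
  then show ?thesis
    using that by blast
qed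

text \<open>On the line through \<open>a\<close> and \<open>b\<close> both functions are nonzero
  polynomials in one variable. So is their product, which cannot vanish at every point of an
  infinite field.\<close>

lemma hforms_prod_nonzero:
  fixes f g :: "(nat \<Rightarrow> 'a::field_char_0) \<Rightarrow> 'a"
  assumes p: "\<And>a b. \<exists>p. \<forall>t. poly p t = f (\<lambda>i. a i + t * b i)"
    and q: "\<And>a b. \<exists>p. \<forall>t. poly p t = g (\<lambda>i. a i + t * b i)"
    and "f a \<noteq> 0" "g b \<noteq> 0"
  shows "\<exists>x. f x \<noteq> 0 \<and> g x \<noteq> 0"
proof -
  obtain p where p: "\<And>t. poly p t = f (\<lambda>i. a i + t * (b i - a i))"
    using p[of a "\<lambda>i. b i - a i"] by auto
  obtain q where q: "\<And>t. poly q t = g (\<lambda>i. a i + t * (b i - a i))"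
    using q[of a "\<lambda>i. b i - a i"] by auto
  have "p \<noteq> 0" "q \<noteq> 0"
    using p[of 0] q[of 1] assms(3,4) by auto
  then have "p * q \<noteq> 0"
    by simp
  then obtain t where "poly (p * q) t \<noteq> 0"
    using poly_all_0_iff_0[of "p * q"] by blast
  then show ?thesis
    using p q by auto
qed

section \<open>Monomials as a finite spanning set\<close>

definition mon :: "nat \<Rightarrow> (nat \<Rightarrow> nat) \<Rightarrow> (nat \<Rightarrow> 'a::field) \<Rightarrow> 'a" where
  "mon m \<gamma> = (\<lambda>x. \<Prod>i<m. x i ^ \<gamma> i)"

lemma mon_var_mult: "i < m \<Longrightarrow> x i * mon m \<gamma> x = mon m (\<gamma>(i := Suc (\<gamma> i))) x"
  unfolding mon_def
  by (subst (1 2) prod.remove[of "{..<m}" i]) (auto intro!: prod.cong simp: mult_ac)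

text \<open>Bounding each exponent separately, not the total degree, gives a finite product of
  finite sets, which is enough for a finite spanning set.\<close>

definition mons :: "nat \<Rightarrow> nat \<Rightarrow> ((nat \<Rightarrow> 'a::field) \<Rightarrow> 'a) set" where
  "mons m d = mon m ` ({..<m} \<rightarrow>\<^sub>E {..d})"

lemma finite_mons: "finite (mons m d)"
  by (auto simp: mons_def intro!: finite_PiE)

lemma monsI:
  assumes "\<And>i. i < m \<Longrightarrow> \<gamma> i \<le> d"
  shows "mon m \<gamma> \<in> mons m d"
proof -
  have "mon m \<gamma> = mon m (restrict \<gamma> {..<m})"
    by (auto simp: mon_def intro!: prod.cong)
  moreover have "restrict \<gamma> {..<m} \<in> {..<m} \<rightarrow>\<^sub>E {..d}"
    using assms by auto
  ultimately show ?thesis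
    unfolding mons_def by (metis imageI)
qed

lemma span_mult:
  assumes "f \<in> fun_space.span A" and "\<And>a. a \<in> A \<Longrightarrow> h * a \<in> fun_space.span B"
  shows "h * f \<in> fun_space.span B"
  using assms(1)
proof (induction rule: fun_space.span_induct_alt)
  case base
  show ?case
    using fun_space.span_zero[of B] by (simp add: zero_fun_def)
next
  case (step c x y)
  have "h * (fscale c x + y) = fscale c (h * x) + h * y"
    by (simp add: fun_eq_iff algebra_simps fscale_apply)
  moreover have "fscale c (h * x) + h * y \<in> fun_space.span B"
    by (intro fun_space.span_add fun_space.span_scale assms(2) step)
  ultimately show ?case
    by (simp only:)
qed

lemma hforms_subset_span_mons: "hforms m e \<subseteq> fun_space.span (mons m e)"
proof (induction e)
  case 0
  have "(\<lambda>x. c) \<in> fun_space.span (mons m 0)" for c :: 'a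
  proof -
    have "(\<lambda>x. c) = fscale c (mon m (\<lambda>_. 0))"
      by (simp add: mon_def fun_eq_iff fscale_apply)
    then show ?thesis
      using monsI[of m "\<lambda>_. 0" 0] by (auto intro: fun_space.span_scale fun_space.span_base)
  qed
  then show ?case by (auto elim!: hforms_0E)
next
  case (Suc e)
  show ?case
  proof
    fix f :: "(nat \<Rightarrow> 'a) \<Rightarrow> 'a" assume "f \<in> hforms m (Suc e)"
    then obtain h where h: "\<And>i. i < m \<Longrightarrow> h i \<in> hforms m e" "f = (\<lambda>x. \<Sum>i<m. x i * h i x)"
      by (blast elim: hforms_SucE)
    have "(\<lambda>x. x i) * h i \<in> fun_space.span (mons m (Suc e))" if i: "i < m" for i
    proof (rule span_mult)
      show "h i \<in> fun_space.span (mons m e)"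
        using h i Suc by blast
      fix a :: "(nat \<Rightarrow> 'a) \<Rightarrow> 'a" assume "a \<in> mons m e"
      then obtain \<gamma> where \<gamma>: "\<gamma> \<in> {..<m} \<rightarrow>\<^sub>E {..e}" "a = mon m \<gamma>"
        by (auto simp: mons_def)
      have "(\<lambda>x. x i) * a = mon m (\<gamma>(i := Suc (\<gamma> i)))"
        using mon_var_mult[OF i] \<gamma> by (auto simp: fun_eq_iff)
      moreover have "mon m (\<gamma>(i := Suc (\<gamma> i))) \<in> mons m (Suc e)"
        using \<gamma> by (intro monsI) (auto simp: PiE_iff le_SucI)
      ultimately show "(\<lambda>x. x i) * a \<in> fun_space.span (mons m (Suc e))"
        using fun_space.span_base by metis
    qed
    moreover have "f = (\<Sum>i<m. (\<lambda>x. x i) * h i)"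
      by (simp add: h fun_eq_iff sum_fun_apply)
    ultimately show "f \<in> fun_space.span (mons m (Suc e))"
      by (auto intro: fun_space.span_sum)
  qed
qed

type_synonym 'a pfun = "(nat \<Rightarrow> 'a) \<Rightarrow> 'a"

section \<open>The projective Nullstellensatz\<close>

definition graded_ideal :: "nat \<Rightarrow> (nat \<Rightarrow> ((nat \<Rightarrow> 'a::field) \<Rightarrow> 'a) set) \<Rightarrow> bool" where
  "graded_ideal m P \<longleftrightarrow> (\<forall>e. fun_space.subspace (P e) \<and> P e \<subseteq> hforms m e \<and>
     (\<forall>f\<in>P e. \<forall>i<m. (\<lambda>x. x i * f x) \<in> P (Suc e)))"

text \<open>Relevant in the sense of projective geometry: no power of the ideal generated by all the
  variables is contained in it.\<close>

definition relevant_ideal :: "nat \<Rightarrow> (nat \<Rightarrow> ((nat \<Rightarrow> 'a::field) \<Rightarrow> 'a) set) \<Rightarrow> bool" where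
  "relevant_ideal m P \<longleftrightarrow> graded_ideal m P \<and> (\<forall>d. \<not> hforms m d \<subseteq> P d)"

lemma graded_idealD:
  assumes "graded_ideal m P"
  shows graded_ideal_subspace: "fun_space.subspace (P e)"
    and graded_ideal_hforms: "f \<in> P e \<Longrightarrow> f \<in> hforms m e"
    and graded_ideal_var: "f \<in> P e \<Longrightarrow> i < m \<Longrightarrow> (\<lambda>x. x i * f x) \<in> P (Suc e)"
    and graded_ideal_zero: "(\<lambda>x. 0) \<in> P e"
    and graded_ideal_add: "f \<in> P e \<Longrightarrow> g \<in> P e \<Longrightarrow> (\<lambda>x. f x + g x) \<in> P e"
    and graded_ideal_scale: "f \<in> P e \<Longrightarrow> (\<lambda>x. c * f x) \<in> P e"
proof -
  show s: "fun_space.subspace (P e)" and "f \<in> P e \<Longrightarrow> f \<in> hforms m e"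
    and "f \<in> P e \<Longrightarrow> i < m \<Longrightarrow> (\<lambda>x. x i * f x) \<in> P (Suc e)"
    using assms by (auto simp: graded_ideal_def)
  show "(\<lambda>x. 0) \<in> P e"
    using fun_space.subspace_0[OF s] by (simp add: zero_fun_def)
  show "f \<in> P e \<Longrightarrow> g \<in> P e \<Longrightarrow> (\<lambda>x. f x + g x) \<in> P e"
    using fun_space.subspace_add[OF s, of f g] by (simp add: plus_fun_def)
  show "f \<in> P e \<Longrightarrow> (\<lambda>x. c * f x) \<in> P e"
    using fun_space.subspace_scale[OF s, of f c] by (simp add: fscale_def)
qed

lemma graded_idealI:
  assumes "\<And>e f. f \<in> P e \<Longrightarrow> f \<in> hforms m e"
    and "\<And>e f i. f \<in> P e \<Longrightarrow> i < m \<Longrightarrow> (\<lambda>x. x i * f x) \<in> P (Suc e)"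
    and "\<And>e. (\<lambda>x. 0) \<in> P e"
    and "\<And>e f g. f \<in> P e \<Longrightarrow> g \<in> P e \<Longrightarrow> (\<lambda>x. f x + g x) \<in> P e"
    and "\<And>e f c. f \<in> P e \<Longrightarrow> (\<lambda>x. c * f x) \<in> P e"
  shows "graded_ideal m P"
  using assms by (auto simp: graded_ideal_def fun_space.subspace_def zero_fun_def plus_fun_def fscale_def)

lemma graded_ideal_sum:
  assumes "graded_ideal m P" "\<And>i. i \<in> I \<Longrightarrow> f i \<in> P e"
  shows "(\<lambda>x. \<Sum>i\<in>I. f i x) \<in> P e"
  using assms(2)
  by (induction I rule: infinite_finite_induct)
    (auto intro: graded_ideal_add[OF assms(1)] graded_ideal_zero[OF assms(1)])

lemma graded_ideal_mult:
  assumes "graded_ideal m P" "f \<in> P e" "g \<in> hforms m d"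
  shows "(\<lambda>x. g x * f x) \<in> P (d + e)"
  using assms(3)
proof (induction d arbitrary: g)
  case 0
  then show ?case
    using assms(2) by (auto elim!: hforms_0E intro: graded_ideal_scale[OF assms(1)])
next
  case (Suc d)
  then obtain h where h: "\<And>i. i < m \<Longrightarrow> h i \<in> hforms m d" "g = (\<lambda>x. \<Sum>i<m. x i * h i x)"
    by (blast elim: hforms_SucE)
  have "(\<lambda>x. g x * f x) = (\<lambda>x. \<Sum>i<m. x i * (h i x * f x))"
    by (simp add: h fun_eq_iff sum_distrib_right mult.assoc)
  moreover have "(\<lambda>x. \<Sum>i<m. x i * (h i x * f x)) \<in> P (Suc (d + e))"
    using Suc.IH h by (intro graded_ideal_sum[OF assms(1)] graded_ideal_var[OF assms(1)]) auto
  ultimately show ?case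
    by simp
qed

lemma graded_ideal_superset_hforms:
  assumes "graded_ideal m P" "hforms m d \<subseteq> P d"
  shows "hforms m (d + e) \<subseteq> P (d + e)"
proof (induction e)
  case 0
  then show ?case using assms by simp
next
  case (Suc e)
  show ?case
  proof
    fix f :: "'a pfun" assume "f \<in> hforms m (d + Suc e)"
    then have "f \<in> hforms m (Suc (d + e))" by simp
    then obtain h where h: "\<And>i. i < m \<Longrightarrow> h i \<in> hforms m (d + e)" "f = (\<lambda>x. \<Sum>i<m. x i * h i x)"
      by (blast elim: hforms_SucE)
    have "f \<in> P (Suc (d + e))"
      unfolding h(2) using Suc h(1)
      by (intro graded_ideal_sum[OF assms(1)] graded_ideal_var[OF assms(1)]) auto
    then show "f \<in> P (d + Suc e)" by simp
  qed
qed

lemma hforms_finite_basis: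
  obtains B :: "'a::field pfun set" where "finite B" "B \<subseteq> hforms m d" "hforms m d \<subseteq> fun_space.span B"
proof -
  obtain B :: "'a pfun set" where B: "B \<subseteq> hforms m d" "fun_space.independent B" "hforms m d \<subseteq> fun_space.span B"
    using fun_space.maximal_independent_subset[of "hforms m d"] by blast
  then have "finite B"
    using fun_space.independent_span_bound[OF finite_mons[of m d], of B] hforms_subset_span_mons[of m d]
    by blast
  with B show ?thesis
    using that by blast
qed

text \<open>Zorn's lemma applies because the forms of a given degree are spanned by finitely many of
  them: if the union of a chain contained all of these, so would one member of the chain.\<close>

lemma relevant_ideal_maximal:
  assumes J: "relevant_ideal m J"
  obtains P where "relevant_ideal m P" "\<And>e. J e \<subseteq> P e"
    "\<And>Q. relevant_ideal m Q \<Longrightarrow> (\<And>e. P e \<subseteq> Q e) \<Longrightarrow> Q = P"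
proof -
  \<comment> \<open>A graded family is coded as a relation between degrees and functions, so that
    inclusion of ideals becomes inclusion of sets.\<close>
  define A where "A = {S. relevant_ideal m (\<lambda>e. S `` {e}) \<and> (\<forall>e. J e \<subseteq> S `` {e})}"
  have Sigma: "Sigma UNIV Q `` {e} = Q e" for Q :: "nat \<Rightarrow> ((nat \<Rightarrow> 'a) \<Rightarrow> 'a) set" and e
    by auto
  have "Sigma UNIV J \<in> A"
    using J by (simp add: A_def Sigma)
  then have "A \<noteq> {}" by blast
  moreover have "\<Union>C \<in> A" if C: "C \<noteq> {}" "subset.chain A C" for C
  proof -
    have CA: "graded_ideal m (\<lambda>e. S `` {e})" "\<not> hforms m d \<subseteq> S `` {d}" "J e \<subseteq> S `` {e}"
      if "S \<in> C" for S d e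
      using C that by (auto simp: A_def subset_chain_def relevant_ideal_def)
    have "graded_ideal m (\<lambda>e. \<Union>C `` {e})"
    proof (rule graded_idealI)
      fix e f assume "f \<in> \<Union>C `` {e}"
      then obtain S where S: "S \<in> C" "f \<in> S `` {e}" by auto
      show "f \<in> hforms m e"
        using graded_ideal_hforms[OF CA(1)[OF S(1)]] S(2) by blast
    next
      fix e f i assume "f \<in> \<Union>C `` {e}" "i < m"
      then obtain S where S: "S \<in> C" "f \<in> S `` {e}" by auto
      then have "(\<lambda>x. x i * f x) \<in> S `` {Suc e}"
        using graded_ideal_var[OF CA(1)[OF S(1)]] \<open>i < m\<close> by blast
      then show "(\<lambda>x. x i * f x) \<in> \<Union>C `` {Suc e}"
        using S(1) by blast
    next
      fix e
      obtain S where S: "S \<in> C" using C by blast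
      then show "(\<lambda>x. 0) \<in> \<Union>C `` {e}"
        using graded_ideal_zero[OF CA(1)[OF S], of e] by blast
    next
      fix e f g assume "f \<in> \<Union>C `` {e}" "g \<in> \<Union>C `` {e}"
      then obtain S T where "S \<in> C" "f \<in> S `` {e}" "T \<in> C" "g \<in> T `` {e}" by auto
      moreover have "S \<subseteq> T \<or> T \<subseteq> S"
        using C(2) \<open>S \<in> C\<close> \<open>T \<in> C\<close> by (auto simp: subset_chain_def)
      ultimately obtain U where U: "U \<in> C" "f \<in> U `` {e}" "g \<in> U `` {e}" by auto
      then show "(\<lambda>x. f x + g x) \<in> \<Union>C `` {e}"
        using graded_ideal_add[OF CA(1)[OF U(1)] U(2,3)] by blast
    next
      fix e f c assume "f \<in> \<Union>C `` {e}"
      then obtain S where S: "S \<in> C" "f \<in> S `` {e}" by auto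
      then show "(\<lambda>x. c * f x) \<in> \<Union>C `` {e}"
        using graded_ideal_scale[OF CA(1)[OF S(1)] S(2)] by blast
    qed
    moreover have "\<not> hforms m d \<subseteq> \<Union>C `` {d}" for d
    proof
      assume *: "hforms m d \<subseteq> \<Union>C `` {d}"
      obtain B :: "'a pfun set" where B: "finite B" "B \<subseteq> hforms m d" "hforms m d \<subseteq> fun_space.span B"
        by (rule hforms_finite_basis[of m d])
      have "Pair d ` B \<subseteq> \<Union>C"
        using B * by auto
      then obtain S where S: "S \<in> C" "Pair d ` B \<subseteq> S"
        using finite_subset_Union_chain[OF _ _ C, of "Pair d ` B"] B by auto
      then have "fun_space.span B \<subseteq> S `` {d}"
        using graded_ideal_subspace[OF CA(1)[OF S(1)], of d] by (intro fun_space.span_minimal) auto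
      then show False
        using B CA(2)[OF S(1), of d] by blast
    qed
    moreover have "J e \<subseteq> \<Union>C `` {e}" for e
      using C(1) CA(3) by blast
    ultimately show ?thesis
      by (simp add: A_def relevant_ideal_def)
  qed
  ultimately obtain S where S: "S \<in> A" "\<And>X. X \<in> A \<Longrightarrow> S \<subseteq> X \<Longrightarrow> X = S"
    using subset_Zorn_nonempty[of A] by blast
  show ?thesis
  proof (rule that[of "\<lambda>e. S `` {e}"])
    fix Q assume Q: "relevant_ideal m Q" "\<And>e. S `` {e} \<subseteq> Q e"
    have "Sigma UNIV Q \<in> A"
      using Q S(1) by (auto simp: A_def Sigma)
    moreover have "S \<subseteq> Sigma UNIV Q"
      using Q(2) by auto
    ultimately have "Sigma UNIV Q = S"
      by (rule S(2))
    then show "Q = (\<lambda>e. S `` {e})"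
      by auto
  qed (use S(1) in \<open>auto simp: A_def\<close>)
qed

section \<open>Ideals that are maximal among the relevant ones\<close>

locale maximal_relevant_ideal =
  fixes m :: nat and P :: "nat \<Rightarrow> 'a::alg_closed_field pfun set"
  assumes relevant: "relevant_ideal m P"
    and maximal: "\<And>Q. relevant_ideal m Q \<Longrightarrow> (\<And>e. P e \<subseteq> Q e) \<Longrightarrow> Q = P"
begin

lemma graded: "graded_ideal m P"
  using relevant by (simp add: relevant_ideal_def)

lemma not_hforms_subset: "\<not> hforms m d \<subseteq> P d"
  using relevant by (simp add: relevant_ideal_def)

lemma one_not_in: "c \<noteq> 0 \<Longrightarrow> (\<lambda>x. c) \<notin> P 0"
proof
  assume "c \<noteq> 0" and c: "(\<lambda>x. c) \<in> P 0"
  have "hforms m 0 \<subseteq> P 0"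
  proof
    fix f :: "'a pfun" assume "f \<in> hforms m 0"
    then obtain b where "f = (\<lambda>x. b)" by (rule hforms_0E)
    then show "f \<in> P 0"
      using graded_ideal_scale[OF graded c, of "b / c"] \<open>c \<noteq> 0\<close> by simp
  qed
  then show False
    using not_hforms_subset by blast
qed

text \<open>The ideal P + (l) is strictly larger than \<open>P\<close>, so by maximality it is not
  relevant and contains all forms from some degree on.\<close>

lemma linear_form_cofinite:
  assumes l: "l \<in> hforms m (Suc 0)" "l \<notin> P (Suc 0)"
  shows "\<exists>d. \<forall>e. \<forall>f\<in>hforms m (Suc (d + e)).
    \<exists>p\<in>P (Suc (d + e)). \<exists>g\<in>hforms m (d + e). f = (\<lambda>x. p x + l x * g x)"
proof -
  \<comment> \<open>In degree 0 there are no multiples of the linear form \<open>l\<close>, whence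
    the case distinction.\<close>
  define Q where "Q e = (case e of 0 \<Rightarrow> P 0 |
    Suc e' \<Rightarrow> {f. \<exists>p\<in>P e. \<exists>g\<in>hforms m e'. f = (\<lambda>x. p x + l x * g x)})" for e
  have QSuc: "Q (Suc e) = {f. \<exists>p\<in>P (Suc e). \<exists>g\<in>hforms m e. f = (\<lambda>x. p x + l x * g x)}" for e
    by (simp add: Q_def)
  have QI: "(\<lambda>x. p x + l x * g x) \<in> Q (Suc e)" if "p \<in> P (Suc e)" "g \<in> hforms m e" for p g e
    using that by (auto simp: QSuc)
  have Q0: "Q 0 = P 0"
    by (simp add: Q_def)
  have PQ: "P e \<subseteq> Q e" for e
  proof (cases e)
    case (Suc e')
    show ?thesis
    proof
      fix f assume "f \<in> P e"
      then show "f \<in> Q e"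
        unfolding Suc QSuc by (intro CollectI bexI[of _ f] bexI[of _ "\<lambda>x. 0"]) auto
    qed
  qed (simp add: Q0)
  have gQ: "graded_ideal m Q"
  proof (rule graded_idealI)
    fix e f assume "f \<in> Q e"
    then show "f \<in> hforms m e"
      using graded_ideal_hforms[OF graded] hforms_mult'[OF l(1)]
      by (cases e) (auto simp: Q0 QSuc intro!: hforms_add)
  next
    fix e f i assume f: "f \<in> Q e" and i: "i < m"
    show "(\<lambda>x. x i * f x) \<in> Q (Suc e)"
    proof (cases e)
      case 0
      then show ?thesis
        using f graded_ideal_var[OF graded _ i, of f 0] PQ[of "Suc 0"] by (auto simp: Q0)
    next
      case (Suc e')
      then obtain p g where pg: "p \<in> P e" "g \<in> hforms m e'" "f = (\<lambda>x. p x + l x * g x)"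
        using f by (auto simp: QSuc)
      have "(\<lambda>x. x i * f x) = (\<lambda>x. x i * p x + l x * (x i * g x))"
        by (simp add: pg fun_eq_iff algebra_simps)
      then show ?thesis
        using QI[OF graded_ideal_var[OF graded pg(1) i, unfolded Suc] hforms_var_mult[OF pg(2) i]] Suc by simp
    qed
  next
    fix e show "(\<lambda>x. 0) \<in> Q e"
      using PQ graded_ideal_zero[OF graded] by blast
  next
    fix e f f' assume f: "f \<in> Q e" "f' \<in> Q e"
    show "(\<lambda>x. f x + f' x) \<in> Q e"
    proof (cases e)
      case 0
      then show ?thesis using f graded_ideal_add[OF graded] by (simp add: Q0)
    next
      case (Suc e')
      then obtain p g p' g' where pg: "p \<in> P e" "g \<in> hforms m e'" "f = (\<lambda>x. p x + l x * g x)"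
        "p' \<in> P e" "g' \<in> hforms m e'" "f' = (\<lambda>x. p' x + l x * g' x)"
        using f by (auto simp: QSuc)
      have "(\<lambda>x. f x + f' x) = (\<lambda>x. (p x + p' x) + l x * (g x + g' x))"
        by (simp add: pg fun_eq_iff algebra_simps)
      then show ?thesis
        using QI[OF graded_ideal_add[OF graded pg(1,4), unfolded Suc] hforms_add[OF pg(2,5)]] Suc by simp
    qed
  next
    fix e f c assume f: "f \<in> Q e"
    show "(\<lambda>x. c * f x) \<in> Q e"
    proof (cases e)
      case 0
      then show ?thesis using f graded_ideal_scale[OF graded] by (simp add: Q0)
    next
      case (Suc e')
      then obtain p g where pg: "p \<in> P e" "g \<in> hforms m e'" "f = (\<lambda>x. p x + l x * g x)"
        using f by (auto simp: QSuc)
      have "(\<lambda>x. c * f x) = (\<lambda>x. c * p x + l x * (c * g x))"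
        by (simp add: pg fun_eq_iff algebra_simps)
      then show ?thesis
        using QI[OF graded_ideal_scale[OF graded pg(1), unfolded Suc] hforms_scale[OF pg(2)]] Suc by simp
    qed
  qed
  have "l \<in> Q (Suc 0)"
    unfolding QSuc using graded_ideal_zero[OF graded] hforms_const[of 1]
    by (intro CollectI bexI[of _ "\<lambda>x. 0"] bexI[of _ "\<lambda>x. 1"]) auto
  then have "Q \<noteq> P"
    using l by auto
  then obtain d where d: "hforms m d \<subseteq> Q d"
    using maximal[of Q] PQ gQ by (auto simp: relevant_ideal_def)
  then obtain d' where "d = Suc d'"
    using not_hforms_subset[of 0] Q0 by (cases d) auto
  then have "hforms m (Suc (d' + e)) \<subseteq> Q (Suc (d' + e))" for e
    using graded_ideal_superset_hforms[OF gQ d, of e] by simp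
  then show ?thesis
    unfolding QSuc by blast
qed

text \<open>The colon ideal P : l contains \<open>P\<close>. If it contained all forms of some
  degree, then \<open>linear_form_cofinite\<close> would put all forms of a higher degree into
  \<open>P\<close>. So it is relevant, and by maximality it equals \<open>P\<close>.\<close>

lemma linear_form_cancel:
  assumes l: "l \<in> hforms m (Suc 0)" "l \<notin> P (Suc 0)"
    and g: "g \<in> hforms m e" "(\<lambda>x. l x * g x) \<in> P (Suc e)"
  shows "g \<in> P e"
proof -
  define Q where "Q e = {g \<in> hforms m e. (\<lambda>x. l x * g x) \<in> P (Suc e)}" for e
  have gQ: "graded_ideal m Q"
  proof (rule graded_idealI)
    fix e f i assume f: "f \<in> Q e" and i: "i < m"
    have "(\<lambda>x. l x * (x i * f x)) = (\<lambda>x. x i * (l x * f x))"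
      by (simp add: fun_eq_iff)
    then show "(\<lambda>x. x i * f x) \<in> Q (Suc e)"
      using f graded_ideal_var[OF graded _ i] hforms_var_mult[OF _ i] unfolding Q_def by fastforce
  next
    fix e show "(\<lambda>x. 0) \<in> Q e"
      using graded_ideal_zero[OF graded] by (simp add: Q_def)
  next
    fix e f f' assume "f \<in> Q e" "f' \<in> Q e"
    moreover have "(\<lambda>x. l x * (f x + f' x)) = (\<lambda>x. l x * f x + l x * f' x)"
      by (simp add: fun_eq_iff distrib_left)
    ultimately show "(\<lambda>x. f x + f' x) \<in> Q e"
      using graded_ideal_add[OF graded] unfolding Q_def by (auto intro: hforms_add)
  next
    fix e f c assume f: "f \<in> Q e"
    moreover have "(\<lambda>x. l x * (c * f x)) = (\<lambda>x. c * (l x * f x))"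
      by (simp add: fun_eq_iff)
    ultimately show "(\<lambda>x. c * f x) \<in> Q e"
      using graded_ideal_scale[OF graded] unfolding Q_def by (auto intro: hforms_scale)
  qed (auto simp: Q_def)
  have PQ: "P e \<subseteq> Q e" for e
    using graded_ideal_hforms[OF graded] graded_ideal_mult[OF graded _ l(1)] by (auto simp: Q_def)
  have "\<not> hforms m d \<subseteq> Q d" for d
  proof
    assume d: "hforms m d \<subseteq> Q d"
    obtain d' where d': "\<And>e f. f \<in> hforms m (Suc (d' + e)) \<Longrightarrow>
        \<exists>p\<in>P (Suc (d' + e)). \<exists>g\<in>hforms m (d' + e). f = (\<lambda>x. p x + l x * g x)"
      using linear_form_cofinite[OF l] by blast
    have "hforms m (Suc (d' + d)) \<subseteq> P (Suc (d' + d))"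
    proof
      fix f :: "'a pfun" assume "f \<in> hforms m (Suc (d' + d))"
      then obtain p g where pg: "p \<in> P (Suc (d' + d))" "g \<in> hforms m (d' + d)" "f = (\<lambda>x. p x + l x * g x)"
        using d' by blast
      then have "(\<lambda>x. l x * g x) \<in> P (Suc (d' + d))"
        using graded_ideal_superset_hforms[OF gQ d, of d'] by (auto simp: Q_def add.commute)
      then show "f \<in> P (Suc (d' + d))"
        using pg graded_ideal_add[OF graded] by simp
    qed
    then show False
      using not_hforms_subset by blast
  qed
  then have "Q = P"
    using gQ PQ by (intro maximal) (auto simp: relevant_ideal_def)
  then have "P e = Q e"
    by simp
  then show ?thesis
    using g by (simp add: Q_def)
qed

lemma linear_form_power_not_in:
  assumes "l \<in> hforms m (Suc 0)" "l \<notin> P (Suc 0)" "c \<noteq> 0"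
  shows "(\<lambda>x. c * l x ^ e) \<notin> P e"
proof (induction e)
  case 0
  then show ?case using one_not_in assms by simp
next
  case (Suc e)
  have "(\<lambda>x. c * l x ^ Suc e) = (\<lambda>x. l x * (c * l x ^ e))"
    by (simp add: fun_eq_iff mult_ac)
  then show ?case
    using linear_form_cancel[OF assms(1,2), of "\<lambda>x. c * l x ^ e" e] Suc
      hforms_scale[OF hforms_power[OF assms(1)]] by fastforce
qed

text \<open>Factors \<open>l\<close> are split off until degree \<open>d\<close> is reached. Hence
  the graded pieces of the ring modulo \<open>P\<close> have bounded dimension: the quotient looks
  like the coordinate ring of a point.\<close>

lemma hforms_mod_linear_form:
  assumes l: "l \<in> hforms m (Suc 0)" "l \<notin> P (Suc 0)"
  shows "\<exists>d. \<forall>e. \<forall>f\<in>hforms m (d + e).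
    \<exists>p\<in>P (d + e). \<exists>g\<in>hforms m d. f = (\<lambda>x. p x + l x ^ e * g x)"
proof -
  obtain d where d: "\<And>e f. f \<in> hforms m (Suc (d + e)) \<Longrightarrow>
      \<exists>p\<in>P (Suc (d + e)). \<exists>g\<in>hforms m (d + e). f = (\<lambda>x. p x + l x * g x)"
    using linear_form_cofinite[OF l] by blast
  have "\<exists>p\<in>P (d + e). \<exists>g\<in>hforms m d. f = (\<lambda>x. p x + l x ^ e * g x)"
    if "f \<in> hforms m (d + e)" for e f
    using that
  proof (induction e arbitrary: f)
    case 0
    then show ?case
      using graded_ideal_zero[OF graded, of "d + 0"]
      by (intro bexI[of _ "\<lambda>x. 0"] bexI[of _ f]) auto
  next
    case (Suc e)
    obtain p g where pg: "p \<in> P (Suc (d + e))" "g \<in> hforms m (d + e)" "f = (\<lambda>x. p x + l x * g x)"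
      using d[of f e] Suc.prems by auto
    obtain p' g' where pg': "p' \<in> P (d + e)" "g' \<in> hforms m d" "g = (\<lambda>x. p' x + l x ^ e * g' x)"
      using Suc.IH[OF pg(2)] by auto
    have "(\<lambda>x. l x * p' x) \<in> P (Suc (d + e))"
      using graded_ideal_mult[OF graded pg'(1) l(1)] by simp
    then have "(\<lambda>x. p x + l x * p' x) \<in> P (d + Suc e)"
      using graded_ideal_add[OF graded pg(1)] by simp
    moreover have "f = (\<lambda>x. (p x + l x * p' x) + l x ^ Suc e * g' x)"
      by (simp add: pg pg' fun_eq_iff algebra_simps)
    ultimately show ?case
      using pg'(2) by (intro bexI[of _ "\<lambda>x. p x + l x * p' x"] bexI[of _ g'])
  qed
  then show ?thesis
    by blast
qed

text \<open>The sum is the binary form in \<open>l\<close> and \<open>l0\<close> obtained by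
  homogenizing \<open>p\<close> in degree \<open>N\<close>. Over an algebraically closed field it
  splits off factors of the form l - z l0. A factor outside \<open>P\<close> can be cancelled, and
  not all of them can, since a nonzero multiple of a power of \<open>l0\<close> would remain in
  \<open>P\<close>.\<close>

lemma linear_factor_in:
  fixes p :: "'a poly"
  assumes l0: "l0 \<in> hforms m (Suc 0)" "l0 \<notin> P (Suc 0)" and l: "l \<in> hforms m (Suc 0)"
    and "p \<noteq> 0" "degree p \<le> N"
    and "(\<lambda>x. \<Sum>j\<le>N. coeff p j * l x ^ j * l0 x ^ (N - j)) \<in> P N"
  shows "\<exists>c. (\<lambda>x. l x - c * l0 x) \<in> P (Suc 0)"
  using assms(4-6)
proof (induction "degree p" arbitrary: p N)
  case 0
  then obtain c where c: "p = [:c:]" "c \<noteq> 0"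
    by (metis degree_eq_zeroE pCons_eq_0_iff)
  have "(\<lambda>x. \<Sum>j\<le>N. coeff p j * l x ^ j * l0 x ^ (N - j)) = (\<lambda>x. c * l0 x ^ N)"
  proof
    fix x
    have "(\<Sum>j\<le>N. coeff p j * l x ^ j * l0 x ^ (N - j)) = (\<Sum>j\<in>{0}. coeff p j * l x ^ j * l0 x ^ (N - j))"
      by (rule sum.mono_neutral_right) (auto simp: c coeff_pCons split: nat.splits)
    then show "(\<Sum>j\<le>N. coeff p j * l x ^ j * l0 x ^ (N - j)) = c * l0 x ^ N"
      by (simp add: c)
  qed
  then show ?case
    using "0.prems" linear_form_power_not_in[OF l0 c(2), of N] by simp
next
  case (Suc k)
  obtain z where "poly p z = 0"
    using alg_closed_imp_poly_has_root[of p] Suc.hyps(2) by auto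
  then obtain q where q: "p = [:-z, 1:] * q"
    using poly_eq_0_iff_dvd[of p z] by (metis dvdE)
  have "q \<noteq> 0"
    using q Suc.prems by auto
  then have deg: "degree p = Suc (degree q)"
    unfolding q by (subst degree_mult_eq) auto
  then obtain M where M: "N = Suc M" "degree q \<le> M"
    using Suc.prems by (cases N) auto
  define H where "H = (\<lambda>x. \<Sum>j\<le>M. coeff q j * l x ^ j * l0 x ^ (M - j))"
  have H: "H \<in> hforms m M"
    unfolding H_def using hforms_mult'[OF hforms_scale[OF hforms_power[OF l]] hforms_power[OF l0(1)]]
    by (intro hforms_sum) auto
  have "(\<lambda>x. \<Sum>j\<le>N. coeff p j * l x ^ j * l0 x ^ (N - j)) = (\<lambda>x. (l x - z * l0 x) * H x)"
  proof
    fix x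
    have "coeff q (Suc M) = 0"
      using M by (simp add: coeff_eq_0)
    have "(\<Sum>j\<le>N. coeff p j * l x ^ j * l0 x ^ (N - j))
      = (\<Sum>j\<le>Suc M. coeff (pCons 0 q) j * l x ^ j * l0 x ^ (Suc M - j))
        - z * (\<Sum>j\<le>Suc M. coeff q j * l x ^ j * l0 x ^ (Suc M - j))"
      unfolding M(1) sum_distrib_left sum_subtractf[symmetric]
      by (intro sum.cong) (auto simp: q algebra_simps)
    also have "(\<Sum>j\<le>Suc M. coeff (pCons 0 q) j * l x ^ j * l0 x ^ (Suc M - j)) = l x * H x"
      unfolding H_def sum_distrib_left
      by (subst sum.atMost_Suc_shift) (auto intro!: sum.cong simp: ac_simps)
    also have "(\<Sum>j\<le>Suc M. coeff q j * l x ^ j * l0 x ^ (Suc M - j)) = l0 x * H x"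
      using \<open>coeff q (Suc M) = 0\<close>
      unfolding H_def sum_distrib_left
      by (auto intro!: sum.cong simp: Suc_diff_le ac_simps)
    finally show "(\<Sum>j\<le>N. coeff p j * l x ^ j * l0 x ^ (N - j)) = (l x - z * l0 x) * H x"
      by (simp add: algebra_simps)
  qed
  then have *: "(\<lambda>x. (l x - z * l0 x) * H x) \<in> P (Suc M)"
    using Suc.prems M by simp
  show ?case
  proof (cases "(\<lambda>x. l x - z * l0 x) \<in> P (Suc 0)")
    case False
    have "H \<in> P M"
      using linear_form_cancel[OF hforms_diff[OF l hforms_scale[OF l0(1)]] False H *] .
    then show ?thesis
      using Suc.hyps(1)[of q M] Suc.hyps(2) deg \<open>q \<noteq> 0\<close> M unfolding H_def by simp
  qed auto
qed

text \<open>Among the products l^j l0^(N-j) there are more elements than the dimension modulo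
  \<open>P\<close> allows. A relation between them is a binary form in \<open>l\<close> and
  \<open>l0\<close> that lies in \<open>P\<close>, and it has a linear factor in
  \<open>P\<close>.\<close>

lemma linear_form_proportional:
  assumes l0: "l0 \<in> hforms m (Suc 0)" "l0 \<notin> P (Suc 0)" and l: "l \<in> hforms m (Suc 0)"
  shows "\<exists>c. (\<lambda>x. l x - c * l0 x) \<in> P (Suc 0)"
proof -
  obtain d where d: "\<And>e f. f \<in> hforms m (d + e) \<Longrightarrow>
      \<exists>p\<in>P (d + e). \<exists>g\<in>hforms m d. f = (\<lambda>x. p x + l0 x ^ e * g x)"
    using hforms_mod_linear_form[OF l0] by blast
  obtain B :: "'a pfun set" where B: "finite B" "B \<subseteq> hforms m d" "hforms m d \<subseteq> fun_space.span B"
    by (rule hforms_finite_basis[of m d])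
  \<comment> \<open>Modulo \<open>P\<close>, degree \<open>N\<close> is spanned by the
    \<open>h\<close> products l0^h g with \<open>g\<close> in \<open>B\<close>; the exponents 0,
    ..., h are one more than that.\<close>
  define h where "h = card B"
  define N where "N = d + h"
  define B' where "B' = (\<lambda>g. (\<lambda>x. l0 x ^ h) * g) ` B"
  define v where "v j = (\<lambda>x. l x ^ j * l0 x ^ (N - j))" for j
  have v: "v j \<in> fun_space.span (P N \<union> B')" if "j \<in> {..h}" for j
  proof -
    have "v j \<in> hforms m N"
      unfolding v_def using that
      by (intro hforms_mult'[OF hforms_power[OF l] hforms_power[OF l0(1)]]) (auto simp: N_def)
    then obtain p g where pg: "p \<in> P N" "g \<in> hforms m d" "v j = (\<lambda>x. p x + l0 x ^ h * g x)"
      using d[of "v j" h] unfolding N_def by blast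
    have "(\<lambda>x. l0 x ^ h) * g \<in> fun_space.span (P N \<union> B')"
      by (rule span_mult[of g B]) (use pg B in \<open>auto simp: B'_def intro: fun_space.span_base\<close>)
    moreover have "p \<in> fun_space.span (P N \<union> B')"
      using pg by (auto intro: fun_space.span_base)
    ultimately have "p + (\<lambda>x. l0 x ^ h) * g \<in> fun_space.span (P N \<union> B')"
      by (rule fun_space.span_add[rotated])
    moreover have "v j = p + (\<lambda>x. l0 x ^ h) * g"
      by (simp add: pg fun_eq_iff)
    ultimately show ?thesis
      by (simp only:)
  qed
  have "finite B'" "card B' \<le> h"
    using B by (auto simp: B'_def h_def card_image_le)
  then obtain c where c: "\<exists>j\<in>{..h}. c j \<noteq> 0" "(\<Sum>j\<in>{..h}. fscale (c j) (v j)) \<in> P N"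
    using fun_space.nontrivial_relation_mod_subspace[of "{..h}" B' "P N" v] v
      graded_ideal_subspace[OF graded, of N] by auto
  define p where "p = (\<Sum>j\<le>h. Polynomial.monom (c j) j)"
  have coeff: "coeff p j = (if j \<le> h then c j else 0)" for j
    by (simp add: p_def coeff_sum)
  have "p \<noteq> 0"
    using c(1) coeff by (metis atMost_iff coeff_0)
  moreover have "degree p \<le> N"
    by (intro degree_le) (auto simp: coeff N_def)
  moreover have "(\<lambda>x. \<Sum>j\<le>N. coeff p j * l x ^ j * l0 x ^ (N - j)) = (\<Sum>j\<in>{..h}. fscale (c j) (v j))"
  proof
    fix x
    have "(\<Sum>j\<le>N. coeff p j * l x ^ j * l0 x ^ (N - j)) = (\<Sum>j\<le>h. coeff p j * l x ^ j * l0 x ^ (N - j))"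
      by (rule sum.mono_neutral_right) (auto simp: coeff N_def)
    then show "(\<Sum>j\<le>N. coeff p j * l x ^ j * l0 x ^ (N - j)) = (\<Sum>j\<in>{..h}. fscale (c j) (v j)) x"
      by (simp add: coeff sum_fun_apply fscale_apply v_def mult.assoc)
  qed
  ultimately show ?thesis
    using linear_factor_in[OF l0 l, of p N] c(2) by simp
qed

text \<open>Modulo \<open>P\<close> each variable x_i is a multiple a_i l0, so each form f of degree
  e is congruent to f(a) l0^e. As no nonzero multiple of a power of \<open>l0\<close> lies in
  \<open>P\<close>, a form in \<open>P\<close> must vanish at \<open>a\<close>.\<close>

lemma common_zero: "\<exists>a. (\<exists>i<m. a i \<noteq> 0) \<and> (\<forall>e. \<forall>f\<in>P e. f a = 0)"
proof -
  obtain l0 where l0: "l0 \<in> hforms m (Suc 0)" "l0 \<notin> P (Suc 0)"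
    using not_hforms_subset[of "Suc 0"] by blast
  have "\<forall>i. \<exists>c. i < m \<longrightarrow> (\<lambda>x. x i - c * l0 x) \<in> P (Suc 0)"
    using linear_form_proportional[OF l0 hforms_var] by blast
  then obtain a where a: "\<And>i. i < m \<Longrightarrow> (\<lambda>x. x i - a i * l0 x) \<in> P (Suc 0)"
    by metis
  have ev: "(\<lambda>x. f x - f a * l0 x ^ e) \<in> P e" if "f \<in> hforms m e" for f e
    using that
  proof (induction e arbitrary: f)
    case 0
    then show ?case
      using graded_ideal_zero[OF graded] by (auto elim!: hforms_0E)
  next
    case (Suc e)
    then obtain h where h: "\<And>i. i < m \<Longrightarrow> h i \<in> hforms m e" "f = (\<lambda>x. \<Sum>i<m. x i * h i x)"
      by (blast elim: hforms_SucE)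
    have "(\<lambda>x. \<Sum>i<m. h i x * (x i - a i * l0 x) + (a i * l0 x) * (h i x - h i a * l0 x ^ e)) \<in> P (Suc e)"
    proof (intro graded_ideal_sum[OF graded] graded_ideal_add[OF graded])
      fix i assume "i \<in> {..<m}"
      then have i: "i < m" by simp
      show "(\<lambda>x. h i x * (x i - a i * l0 x)) \<in> P (Suc e)"
        using graded_ideal_mult[OF graded a[OF i] h(1)[OF i]] by simp
      show "(\<lambda>x. (a i * l0 x) * (h i x - h i a * l0 x ^ e)) \<in> P (Suc e)"
        using graded_ideal_mult[OF graded Suc.IH[OF h(1)[OF i]] hforms_scale[OF l0(1)], of "a i"] by simp
    qed
    moreover have "(\<lambda>x. \<Sum>i<m. h i x * (x i - a i * l0 x) + (a i * l0 x) * (h i x - h i a * l0 x ^ e))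
        = (\<lambda>x. f x - f a * l0 x ^ Suc e)"
    proof
      fix x
      have "(\<Sum>i<m. h i x * (x i - a i * l0 x) + (a i * l0 x) * (h i x - h i a * l0 x ^ e))
        = (\<Sum>i<m. x i * h i x - a i * h i a * l0 x ^ Suc e)"
        by (intro sum.cong) (auto simp: algebra_simps)
      then show "(\<Sum>i<m. h i x * (x i - a i * l0 x) + (a i * l0 x) * (h i x - h i a * l0 x ^ e))
        = f x - f a * l0 x ^ Suc e"
        by (simp add: h(2) sum_subtractf sum_distrib_right)
    qed
    ultimately show ?case
      by simp
  qed
  have scaled: "c = 0" if "(\<lambda>x. c * l0 x ^ e) \<in> P e" for c e
    using that linear_form_power_not_in[OF l0, of c e] by blast
  have "f a = 0" if f: "f \<in> P e" for e f
  proof (rule scaled[of _ e])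
    have "(\<lambda>x. f x + (-1) * (f x - f a * l0 x ^ e)) \<in> P e"
      using f ev[OF graded_ideal_hforms[OF graded f]]
      by (intro graded_ideal_add[OF graded] graded_ideal_scale[OF graded])
    then show "(\<lambda>x. f a * l0 x ^ e) \<in> P e"
      by simp
  qed
  moreover have "\<exists>i<m. a i \<noteq> 0"
  proof (rule ccontr)
    \<comment> \<open>Here l0 is congruent to l0(a) l0; if \<open>a\<close> were zero, this would
      put \<open>l0\<close> into \<open>P\<close>.\<close>
    assume 0: "\<not> (\<exists>i<m. a i \<noteq> 0)"
    obtain h where "l0 = (\<lambda>x. \<Sum>i<m. x i * h i x)"
      using l0(1) by (blast elim: hforms_SucE)
    then have "l0 a = 0"
      using 0 by (auto intro!: sum.neutral)
    then show False
      using ev[OF l0(1)] l0(2) by simp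
  qed
  ultimately show ?thesis
    by blast
qed

end

theorem projective_nullstellensatz:
  fixes J :: "nat \<Rightarrow> 'a::alg_closed_field pfun set"
  assumes "relevant_ideal m J"
  shows "\<exists>a. (\<exists>i<m. a i \<noteq> 0) \<and> (\<forall>e. \<forall>f\<in>J e. f a = 0)"
proof -
  obtain P where P: "relevant_ideal m P" "\<And>e. J e \<subseteq> P e"
    "\<And>Q. relevant_ideal m Q \<Longrightarrow> (\<And>e. P e \<subseteq> Q e) \<Longrightarrow> Q = P"
    using relevant_ideal_maximal[OF assms] by blast
  interpret maximal_relevant_ideal m P
    by standard (fact P(1), fact P(3))
  obtain a where "\<exists>i<m. a i \<noteq> 0" "\<And>e f. f \<in> P e \<Longrightarrow> f a = 0"
    using common_zero by blast
  with P(2) show ?thesis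
    by (intro exI[of _ a]) auto
qed

section \<open>Quadratic maps without zeros are generically immersive\<close>

lemma digits_sum:
  fixes N b :: nat
  shows "(\<Sum>l<m. (N div b ^ l mod b) * b ^ l) = N mod b ^ m"
proof (induction m)
  case (Suc m)
  have "N mod b ^ Suc m = b ^ m * (N div b ^ m mod b) + N mod b ^ m"
    using mod_mult2_eq[of N "b ^ m" b] by (simp add: mult.commute)
  then show ?case
    using Suc by (simp add: mult.commute)
qed simp

lemma mon_hforms: "(mon m \<gamma> :: 'a::field pfun) \<in> hforms m (\<Sum>i<m. \<gamma> i)"
proof -
  have "(\<lambda>x :: nat \<Rightarrow> 'a. \<Prod>i<k. x i ^ \<gamma> i) \<in> hforms m (\<Sum>i<k. \<gamma> i)" if "k \<le> m" for k
    using that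
  proof (induction k)
    case (Suc k)
    have "(\<lambda>x :: nat \<Rightarrow> 'a. (\<Prod>i<k. x i ^ \<gamma> i) * x k ^ \<gamma> k) \<in> hforms m ((\<Sum>i<k. \<gamma> i) + \<gamma> k)"
      using Suc by (intro hforms_mult hforms_power hforms_var) auto
    then show ?case
      by simp
  qed simp
  then show ?thesis
    by (simp add: mon_def)
qed

text \<open>A notion of polynomial function closed under sums and products regardless of degrees; it
  retains what is needed to see that a product of nonzero functions is nonzero.\<close>

definition polynomial_on_lines :: "'a::field pfun \<Rightarrow> bool" where
  "polynomial_on_lines f \<longleftrightarrow> (\<forall>a b. \<exists>p. \<forall>t. poly p t = f (\<lambda>i. a i + t * b i))"

lemma polynomial_on_lines_hforms: "f \<in> hforms m e \<Longrightarrow> polynomial_on_lines f"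
  unfolding polynomial_on_lines_def using hforms_poly_on_line by metis

lemma polynomial_on_lines_const: "polynomial_on_lines (\<lambda>x. c)"
  unfolding polynomial_on_lines_def by (intro allI exI[of _ "[:c:]"]) simp

lemma polynomial_on_lines_mult:
  assumes "polynomial_on_lines f" "polynomial_on_lines g"
  shows "polynomial_on_lines (\<lambda>x. f x * g x)"
  unfolding polynomial_on_lines_def
proof (intro allI)
  fix a b
  obtain p q where "\<forall>t. poly p t = f (\<lambda>i. a i + t * b i)" "\<forall>t. poly q t = g (\<lambda>i. a i + t * b i)"
    using assms unfolding polynomial_on_lines_def by blast
  then show "\<exists>p. \<forall>t. poly p t = f (\<lambda>i. a i + t * b i) * g (\<lambda>i. a i + t * b i)"
    by (intro exI[of _ "p * q"]) simp
qed

lemma polynomial_on_lines_add: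
  assumes "polynomial_on_lines f" "polynomial_on_lines g"
  shows "polynomial_on_lines (\<lambda>x. f x + g x)"
  unfolding polynomial_on_lines_def
proof (intro allI)
  fix a b
  obtain p q where "\<forall>t. poly p t = f (\<lambda>i. a i + t * b i)" "\<forall>t. poly q t = g (\<lambda>i. a i + t * b i)"
    using assms unfolding polynomial_on_lines_def by blast
  then show "\<exists>p. \<forall>t. poly p t = f (\<lambda>i. a i + t * b i) + g (\<lambda>i. a i + t * b i)"
    by (intro exI[of _ "p + q"]) simp
qed

lemma polynomial_on_lines_sum:
  "(\<And>i. i \<in> I \<Longrightarrow> polynomial_on_lines (f i)) \<Longrightarrow> polynomial_on_lines (\<lambda>x. \<Sum>i\<in>I. f i x)"
  by (induction I rule: infinite_finite_induct)
    (auto intro: polynomial_on_lines_const polynomial_on_lines_add)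

lemma polynomial_on_lines_common_nonzero:
  fixes f :: "nat \<Rightarrow> 'a::field_char_0 pfun"
  assumes "\<And>i. i < k \<Longrightarrow> polynomial_on_lines (f i)" "\<And>i. i < k \<Longrightarrow> \<exists>x. f i x \<noteq> 0"
  shows "polynomial_on_lines (\<lambda>x. \<Prod>i<k. f i x) \<and> (\<exists>x. (\<Prod>i<k. f i x) \<noteq> 0)"
  using assms
proof (induction k)
  case 0
  then show ?case
    by (simp add: polynomial_on_lines_const)
next
  case (Suc k)
  then have IH: "polynomial_on_lines (\<lambda>x. \<Prod>i<k. f i x)" "\<exists>x. (\<Prod>i<k. f i x) \<noteq> 0"
    by auto
  obtain x y where "(\<Prod>i<k. f i x) \<noteq> 0" "f k y \<noteq> 0"
    using IH(2) Suc.prems(2)[of k] by auto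
  then have "\<exists>x. (\<Prod>i<k. f i x) \<noteq> 0 \<and> f k x \<noteq> 0"
    using IH(1) Suc.prems(1)[of k] unfolding polynomial_on_lines_def
    by (intro hforms_prod_nonzero[of "\<lambda>x. \<Prod>i<k. f i x" "f k" x y]) auto
  then show ?case
    using polynomial_on_lines_mult[OF IH(1) Suc.prems(1)[of k]] by auto
qed

lemma poly_sum_monom_zeroD:
  fixes c :: "nat \<Rightarrow> 'a::field_char_0"
  assumes "\<And>t. (\<Sum>j<n. c j * t ^ j) = 0" "j < n"
  shows "c j = 0"
proof -
  define p where "p = (\<Sum>j<n. Polynomial.monom (c j) j)"
  have "poly p t = 0" for t
    using assms(1)[of t] by (simp add: p_def poly_sum poly_monom)
  then have "p = 0"
    using poly_all_0_iff_0 by blast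
  moreover have "coeff p j = c j"
    using assms(2) by (simp add: p_def coeff_sum)
  ultimately show ?thesis
    by simp
qed

locale quadratic_map_without_zeros =
  fixes m :: nat and a :: "nat \<Rightarrow> nat \<Rightarrow> 'v \<Rightarrow> 'a::{alg_closed_field, field_char_0}"
  fixes A :: "(nat \<Rightarrow> 'a) \<Rightarrow> (nat \<Rightarrow> 'a) \<Rightarrow> 'v \<Rightarrow> 'a"
  defines "A x y v \<equiv> \<Sum>i<m. \<Sum>j<m. x i * y j * a i j v"
  assumes no_zero: "\<And>x. \<exists>i<m. x i \<noteq> 0 \<Longrightarrow> \<exists>v. A x x v \<noteq> 0"
begin

definition quadric_ideal :: "nat \<Rightarrow> 'a pfun set" where
  "quadric_ideal e = (if e < 2 then {0}
     else fun_space.span {f. \<exists>h\<in>hforms m (e - 2). \<exists>v. f = (\<lambda>x. h x * A x x v)})"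

lemma A_row_hforms: "(\<lambda>x. \<Sum>i<m. x i * a i j v) \<in> hforms m (Suc 0)"
  by (rule hforms_SucI) simp

lemma A_alt: "A x y v = (\<Sum>j<m. y j * (\<Sum>i<m. x i * a i j v))"
  unfolding A_def by (subst sum.swap) (simp add: sum_distrib_left ac_simps)

lemma A_diag_hforms: "(\<lambda>x. A x x v) \<in> hforms m 2"
  unfolding A_alt numeral_2_eq_2 by (intro hforms_SucI A_row_hforms)

lemma quadric_ideal_graded: "graded_ideal m quadric_ideal"
  unfolding graded_ideal_def
proof (intro allI conjI ballI impI)
  fix e
  show sub: "fun_space.subspace (quadric_ideal e)"
    by (simp add: quadric_ideal_def fun_space.subspace_0 fun_space.subspace_single_0)
  show "quadric_ideal e \<subseteq> hforms m e"
  proof (cases "e < 2")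
    case True
    then show ?thesis
      using fun_space.subspace_0[OF subspace_hforms] by (auto simp: quadric_ideal_def)
  next
    case False
    have "(\<lambda>x. h x * A x x v) \<in> hforms m e" if "h \<in> hforms m (e - 2)" for h v
      using hforms_mult'[OF that A_diag_hforms] False by simp
    then have "fun_space.span {f. \<exists>h\<in>hforms m (e - 2). \<exists>v. f = (\<lambda>x. h x * A x x v)} \<subseteq> hforms m e"
      by (intro fun_space.span_minimal subspace_hforms) blast
    then show ?thesis
      using False by (simp add: quadric_ideal_def)
  qed
  fix f i assume f: "f \<in> quadric_ideal e" and i: "i < m"
  show "(\<lambda>x. x i * f x) \<in> quadric_ideal (Suc e)"
  proof (cases "e < 2")
    case True
    then have "f = (\<lambda>x. 0)"
      using f by (simp add: quadric_ideal_def zero_fun_def)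
    then have "(\<lambda>x. x i * f x) = 0"
      by (simp add: zero_fun_def)
    moreover have "0 \<in> quadric_ideal (Suc e)"
      by (auto simp: quadric_ideal_def intro: fun_space.span_zero)
    ultimately show ?thesis
      by (simp only:)
  next
    case False
    have Suc_eq: "quadric_ideal (Suc e) = fun_space.span {f. \<exists>h\<in>hforms m (Suc (e - 2)). \<exists>v. f = (\<lambda>x. h x * A x x v)}"
      using False Suc_diff_le[of 2 e] by (simp add: quadric_ideal_def del: diff_Suc_Suc)
    have "f \<in> fun_space.span {f. \<exists>h\<in>hforms m (e - 2). \<exists>v. f = (\<lambda>x. h x * A x x v)}"
      using f False by (simp add: quadric_ideal_def)
    then have "(\<lambda>x. x i) * f \<in> quadric_ideal (Suc e)"
      unfolding Suc_eq
    proof (rule span_mult)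
      fix g assume "g \<in> {f. \<exists>h\<in>hforms m (e - 2). \<exists>v. f = (\<lambda>x. h x * A x x v)}"
      then obtain h v where h: "h \<in> hforms m (e - 2)" "g = (\<lambda>x. h x * A x x v)"
        by blast
      have "(\<lambda>x. x i) * g = (\<lambda>x. (x i * h x) * A x x v)"
        by (simp add: h fun_eq_iff)
      then show "(\<lambda>x. x i) * g \<in> fun_space.span {f. \<exists>h\<in>hforms m (Suc (e - 2)). \<exists>v. f = (\<lambda>x. h x * A x x v)}"
        using hforms_var_mult[OF h(1) i]
        by (intro fun_space.span_base CollectI bexI[of _ "\<lambda>x. x i * h x"] exI[of _ v])
    qed
    then show ?thesis
      by (simp add: times_fun_def)
  qed
qed

text \<open>A common zero of this ideal would be a nontrivial zero of the quadratic map, so by the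
  Nullstellensatz the ideal is not relevant.\<close>

lemma quadric_ideal_cofinite: "\<exists>d. \<forall>e. hforms m (d + e) \<subseteq> quadric_ideal (d + e)"
proof -
  have "\<not> relevant_ideal m quadric_ideal"
  proof
    assume "relevant_ideal m quadric_ideal"
    from projective_nullstellensatz[OF this] obtain z
      where z: "(\<exists>i<m. z i \<noteq> 0) \<and> (\<forall>e. \<forall>f\<in>quadric_ideal e. f z = 0)" ..
    have "(\<lambda>x. A x x v) \<in> quadric_ideal 2" for v
      unfolding quadric_ideal_def
      by (auto intro!: fun_space.span_base bexI[of _ "\<lambda>x. 1"] exI[of _ v])
    then have "A z z v = 0" for v
      by (rule z[THEN conjunct2, THEN spec, THEN bspec])
    then show False
      using z no_zero[of z] by blast
  qed
  then show ?thesis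
    using quadric_ideal_graded graded_ideal_superset_hforms unfolding relevant_ideal_def by blast
qed

text \<open>In the first \<open>m\<close> coordinates the fibre over \<open>x\<close> is
  \<open>x\<close> plus the kernel of \<open>A x\<close>. It is larger than the diagonal exactly
  where the derivative degenerates.\<close>

definition graph :: "((nat \<Rightarrow> 'a) \<times> (nat \<Rightarrow> 'a)) set" where
  "graph = {(x, u). \<forall>v. A x x v = A x u v}"

text \<open>On the graph A(x, x, v) = A(x, u, v), so in every generator one factor x is traded for a
  factor u and the degree in x drops by one.\<close>

lemma quadric_ideal_on_graph:
  assumes "f \<in> quadric_ideal (Suc e)"
  shows "\<exists>p. (\<forall>j<m. p j \<in> hforms m e) \<and> (\<forall>x u. (x, u) \<in> graph \<longrightarrow> f x = (\<Sum>j<m. u j * p j x))"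
    (is "?Q f")
proof (cases e)
  case 0
  then have "f = (\<lambda>x. 0)"
    using assms by (simp add: quadric_ideal_def zero_fun_def)
  then show ?thesis
    by (intro exI[of _ "\<lambda>j x. 0"]) auto
next
  case (Suc e')
  have "fun_space.subspace {f. ?Q f}"
  proof (rule fun_space.subspaceI)
    show "0 \<in> {f. ?Q f}"
      by (intro CollectI exI[of _ "\<lambda>j x. 0"]) auto
  next
    fix f g assume "f \<in> {f. ?Q f}" "g \<in> {f. ?Q f}"
    then obtain p q where "\<forall>j<m. p j \<in> hforms m e" "\<forall>x u. (x, u) \<in> graph \<longrightarrow> f x = (\<Sum>j<m. u j * p j x)"
      "\<forall>j<m. q j \<in> hforms m e" "\<forall>x u. (x, u) \<in> graph \<longrightarrow> g x = (\<Sum>j<m. u j * q j x)"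
      by blast
    then show "f + g \<in> {f. ?Q f}"
      by (intro CollectI exI[of _ "\<lambda>j x. p j x + q j x"])
        (auto intro: hforms_add simp: distrib_left sum.distrib)
  next
    fix c f assume "f \<in> {f. ?Q f}"
    then obtain p where "\<forall>j<m. p j \<in> hforms m e" "\<forall>x u. (x, u) \<in> graph \<longrightarrow> f x = (\<Sum>j<m. u j * p j x)"
      by blast
    then show "fscale c f \<in> {f. ?Q f}"
      by (intro CollectI exI[of _ "\<lambda>j x. c * p j x"])
        (auto intro: hforms_scale simp: fscale_apply sum_distrib_left ac_simps)
  qed
  moreover have "?Q (\<lambda>x. h x * A x x v)" if "h \<in> hforms m e'" for h v
  proof (intro exI[of _ "\<lambda>j x. h x * (\<Sum>i<m. x i * a i j v)"] conjI)
    show "\<forall>j<m. (\<lambda>x. h x * (\<Sum>i<m. x i * a i j v)) \<in> hforms m e"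
      using Suc that by (auto intro: hforms_mult'[OF _ A_row_hforms])
    show "\<forall>x u. (x, u) \<in> graph \<longrightarrow> h x * A x x v = (\<Sum>j<m. u j * (h x * (\<Sum>i<m. x i * a i j v)))"
      by (auto simp: graph_def A_alt[of _ u for u] sum_distrib_left ac_simps)
  qed
  ultimately have "quadric_ideal (Suc e) \<subseteq> {f. ?Q f}"
    unfolding quadric_ideal_def Suc by simp (rule fun_space.span_minimal, blast, simp)
  then show ?thesis
    using assms by blast
qed

text \<open>Extension by zero places all functions on the graph in one function space, where spans
  and cardinalities can be compared.\<close>

definition on_graph :: "((nat \<Rightarrow> 'a) \<Rightarrow> (nat \<Rightarrow> 'a) \<Rightarrow> 'a) \<Rightarrow> (nat \<Rightarrow> 'a) \<times> (nat \<Rightarrow> 'a) \<Rightarrow> 'a" where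
  "on_graph g = (\<lambda>(x, u). if (x, u) \<in> graph then g x u else 0)"

definition gens :: "nat \<Rightarrow> nat \<Rightarrow> ((nat \<Rightarrow> 'a) \<times> (nat \<Rightarrow> 'a) \<Rightarrow> 'a) set" where
  "gens d b = (\<lambda>(\<alpha>, \<beta>). on_graph (\<lambda>x u. mon m \<alpha> x * mon m \<beta> u)) `
     (({..<m} \<rightarrow>\<^sub>E {..d}) \<times> ({..<m} \<rightarrow>\<^sub>E {..b}))"

lemma finite_gens: "finite (gens d b)"
  by (auto simp: gens_def intro!: finite_PiE)

lemma card_gens: "card (gens d b) \<le> Suc d ^ m * Suc b ^ m"
proof -
  have "card (gens d b) \<le> card (({..<m} \<rightarrow>\<^sub>E {..d}) \<times> ({..<m} \<rightarrow>\<^sub>E {..b}))"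
    unfolding gens_def by (intro card_image_le) (auto intro!: finite_PiE)
  also have "\<dots> = Suc d ^ m * Suc b ^ m"
    by (simp add: card_cartesian_product card_PiE)
  finally show ?thesis .
qed

lemma gensI:
  assumes "\<And>i. i < m \<Longrightarrow> \<alpha> i \<le> d" "\<And>i. i < m \<Longrightarrow> \<beta> i \<le> b"
  shows "on_graph (\<lambda>x u. mon m \<alpha> x * mon m \<beta> u) \<in> gens d b"
proof -
  have mon: "(mon m (restrict \<gamma> {..<m}) :: 'a pfun) = mon m \<gamma>" for \<gamma>
    by (auto simp: mon_def intro!: prod.cong)
  have "on_graph (\<lambda>x u. mon m \<alpha> x * mon m \<beta> u)
      = (\<lambda>(\<alpha>, \<beta>). on_graph (\<lambda>x u. mon m \<alpha> x * mon m \<beta> u)) (restrict \<alpha> {..<m}, restrict \<beta> {..<m})"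
    by (simp add: mon)
  then show ?thesis
    unfolding gens_def by (rule image_eqI) (use assms in \<open>auto split: if_splits\<close>)
qed

lemma span_gens_mono: "b \<le> b' \<Longrightarrow> fun_space.span (gens d b) \<subseteq> fun_space.span (gens d b')"
  by (intro fun_space.span_mono) (force simp: gens_def PiE_iff)

lemma span_gens_mult:
  assumes "f \<in> fun_space.span (gens d b)" "i < m"
  shows "(\<lambda>(x, u). u i) * f \<in> fun_space.span (gens d (Suc b))"
  using assms(1)
proof (rule span_mult)
  fix g assume "g \<in> gens d b"
  then obtain \<alpha> \<beta> where *: "\<alpha> \<in> {..<m} \<rightarrow>\<^sub>E {..d}" "\<beta> \<in> {..<m} \<rightarrow>\<^sub>E {..b}"
    "g = on_graph (\<lambda>x u. mon m \<alpha> x * mon m \<beta> u)"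
    by (auto simp: gens_def)
  have "(\<lambda>(x, u). u i) * g = on_graph (\<lambda>x u. mon m \<alpha> x * mon m (\<beta>(i := Suc (\<beta> i))) u)"
    by (auto simp: *(3) on_graph_def fun_eq_iff mon_var_mult[OF assms(2), symmetric])
  moreover have "\<dots> \<in> gens d (Suc b)"
    using * by (intro gensI) (auto simp: PiE_iff le_SucI)
  ultimately show "(\<lambda>(x, u). u i) * g \<in> fun_space.span (gens d (Suc b))"
    by (metis fun_space.span_base)
qed

lemma span_gens_mult_power:
  assumes "f \<in> fun_space.span (gens d b)" "i < m"
  shows "(\<lambda>(x, u). u i ^ j) * f \<in> fun_space.span (gens d (b + j))"
proof (induction j)
  case 0
  have "(\<lambda>(x, u). u i ^ 0) * f = f"
    by (auto simp: fun_eq_iff)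
  then show ?case
    using assms by simp
next
  case (Suc j)
  have *: "(\<lambda>(x, u). u i ^ Suc j) * f = (\<lambda>(x, u). u i) * ((\<lambda>(x, u). u i ^ j) * f)"
    by (auto simp: fun_eq_iff)
  show ?case
    unfolding * add_Suc_right by (rule span_gens_mult[OF Suc assms(2)])
qed

text \<open>Forms of degree above \<open>d\<close> lie in the quadric ideal, so factors u can be
  split off until the degree in x is at most \<open>d\<close>. With \<open>card_gens\<close> this
  bounds the forms of degree e on the graph by a constant times (e+1)^m.\<close>

lemma hforms_in_span_gens:
  assumes d: "\<And>e. hforms m (d + e) \<subseteq> quadric_ideal (d + e)" and "f \<in> hforms m e"
  shows "on_graph (\<lambda>x u. f x) \<in> fun_space.span (gens d e)"
  using assms(2)
proof (induction e arbitrary: f rule: less_induct)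
  case (less e)
  show ?case
  proof (cases "e \<le> d")
    case True
    have "fun_space.subspace {f. on_graph (\<lambda>x u. f x) \<in> fun_space.span (gens d e)}"
    proof (rule fun_space.subspaceI)
      have *: "on_graph (\<lambda>x u. 0 x) = 0"
        by (auto simp: on_graph_def fun_eq_iff)
      show "0 \<in> {f. on_graph (\<lambda>x u. f x) \<in> fun_space.span (gens d e)}"
        by (simp only: mem_Collect_eq * fun_space.span_zero)
    next
      fix f g assume "f \<in> {f. on_graph (\<lambda>x u. f x) \<in> fun_space.span (gens d e)}"
        "g \<in> {f. on_graph (\<lambda>x u. f x) \<in> fun_space.span (gens d e)}"
      then have "on_graph (\<lambda>x u. f x) + on_graph (\<lambda>x u. g x) \<in> fun_space.span (gens d e)"
        by (intro fun_space.span_add) auto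
      moreover have "on_graph (\<lambda>x u. (f + g) x) = on_graph (\<lambda>x u. f x) + on_graph (\<lambda>x u. g x)"
        by (auto simp: on_graph_def fun_eq_iff)
      ultimately show "f + g \<in> {f. on_graph (\<lambda>x u. f x) \<in> fun_space.span (gens d e)}"
        by (simp only: mem_Collect_eq)
    next
      fix c f assume "f \<in> {f. on_graph (\<lambda>x u. f x) \<in> fun_space.span (gens d e)}"
      then have "fscale c (on_graph (\<lambda>x u. f x)) \<in> fun_space.span (gens d e)"
        by (intro fun_space.span_scale) auto
      moreover have "on_graph (\<lambda>x u. fscale c f x) = fscale c (on_graph (\<lambda>x u. f x))"
        by (auto simp: on_graph_def fun_eq_iff fscale_apply)
      ultimately show "fscale c f \<in> {f. on_graph (\<lambda>x u. f x) \<in> fun_space.span (gens d e)}"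
        by (simp only: mem_Collect_eq)
    qed
    moreover have "on_graph (\<lambda>x u. mon m \<gamma> x) \<in> fun_space.span (gens d e)"
      if "\<gamma> \<in> {..<m} \<rightarrow>\<^sub>E {..e}" for \<gamma>
    proof -
      have "on_graph (\<lambda>x u. mon m \<gamma> x * mon m (\<lambda>_. 0) u) \<in> gens d e"
        using that True by (intro gensI) (auto simp: PiE_iff dest!: bspec)
      moreover have "on_graph (\<lambda>x u. mon m \<gamma> x * mon m (\<lambda>_. 0) u) = on_graph (\<lambda>x u. mon m \<gamma> x)"
        by (simp add: mon_def)
      ultimately show ?thesis
        by (metis fun_space.span_base)
    qed
    ultimately have "fun_space.span (mons m e) \<subseteq> {f. on_graph (\<lambda>x u. f x) \<in> fun_space.span (gens d e)}"
      by (intro fun_space.span_minimal) (auto simp: mons_def)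
    then show ?thesis
      using less.prems hforms_subset_span_mons by blast
  next
    case False
    then obtain e' where e': "e = Suc e'"
      by (cases e) auto
    have "f \<in> quadric_ideal (Suc e')"
      using d[of "e - d"] False less.prems e' by auto
    then obtain p where p: "\<And>j. j < m \<Longrightarrow> p j \<in> hforms m e'"
      "\<And>x u. (x, u) \<in> graph \<Longrightarrow> f x = (\<Sum>j<m. u j * p j x)"
      using quadric_ideal_on_graph by blast
    have "on_graph (\<lambda>x u. f x) = (\<Sum>j<m. (\<lambda>(x, u). u j) * on_graph (\<lambda>x u. p j x))"
      by (auto simp: on_graph_def fun_eq_iff sum_fun_apply p(2))
    moreover have "\<dots> \<in> fun_space.span (gens d (Suc e'))"
      using less.IH[of e'] p(1) e' by (intro fun_space.span_sum span_gens_mult) auto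
    ultimately show ?thesis
      using e' by simp
  qed
qed

text \<open>The sets of those \<open>x\<close> that have a kernel vector with nonzero coordinate i,
  for i < m, cover the whole space. One of them is Zariski dense, for otherwise the product of
  nonzero polynomials vanishing on each of them would be nonzero somewhere.\<close>

lemma dense_kernel_coordinate:
  assumes "\<And>x. \<exists>y. (\<exists>i<m. y i \<noteq> 0) \<and> (\<forall>v. A x y v = 0)"
  shows "\<exists>i<m. \<forall>f. polynomial_on_lines f \<longrightarrow>
    (\<forall>x y. (\<forall>v. A x y v = 0) \<longrightarrow> y i \<noteq> 0 \<longrightarrow> f x = 0) \<longrightarrow> (\<forall>x. f x = 0)"
proof (rule ccontr)
  assume neg: "\<not> ?thesis"
  have "\<exists>f. polynomial_on_lines f \<and> (\<forall>x y. (\<forall>v. A x y v = 0) \<longrightarrow> y i \<noteq> 0 \<longrightarrow> f x = 0) \<and> (\<exists>x. f x \<noteq> 0)"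
    if "i < m" for i
    using neg that by blast
  then obtain f where f: "\<And>i. i < m \<Longrightarrow> polynomial_on_lines (f i)"
    "\<And>i x y. i < m \<Longrightarrow> (\<forall>v. A x y v = 0) \<Longrightarrow> y i \<noteq> 0 \<Longrightarrow> f i x = 0"
    "\<And>i. i < m \<Longrightarrow> \<exists>x. f i x \<noteq> 0"
    by metis
  obtain x where x: "(\<Prod>i<m. f i x) \<noteq> 0"
    using polynomial_on_lines_common_nonzero[of m f] f(1,3) by blast
  obtain y i where "i < m" "y i \<noteq> 0" "\<forall>v. A x y v = 0"
    using assms by blast
  then have "f i x = 0"
    using f(2) by blast
  then show False
    using x \<open>i < m\<close> by auto
qed

text \<open>Monomials in x times powers of u_i are b^(m+1) functions, yet on the graph they lie in a
  span of fewer generators. The resulting relation is trivial after all: over a dense set of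
  \<open>x\<close>, moving u along a kernel vector makes u_i a free variable.\<close>

lemma not_everywhere_degenerate:
  assumes deg: "\<And>x. \<exists>y. (\<exists>i<m. y i \<noteq> 0) \<and> (\<forall>v. A x y v = 0)"
  shows False
proof -
  obtain i where i: "i < m" "\<forall>f. polynomial_on_lines f \<longrightarrow>
    (\<forall>x y. (\<forall>v. A x y v = 0) \<longrightarrow> y i \<noteq> 0 \<longrightarrow> f x = 0) \<longrightarrow> (\<forall>x. f x = 0)"
    using dense_kernel_coordinate[OF deg] by blast
  obtain d where d: "\<And>e. hforms m (d + e) \<subseteq> quadric_ideal (d + e)"
    using quadric_ideal_cofinite by blast
  \<comment> \<open>\<open>E\<close> is the constant (d+1)^m (m+1)^m of the estimate below, and
    \<open>b\<close> is just larger: the generators number at most E b^m, which is less than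
    b^(m+1).\<close>
  define E where "E = Suc d ^ m * Suc m ^ m"
  define b where "b = Suc E"
  \<comment> \<open>The base \<open>b\<close> digits of a number below b^m run through all exponent
    vectors with entries below \<open>b\<close>, so one number indexes a monomial.\<close>
  define dig where "dig N l = N div b ^ l mod b" for N l
  define w where "w = (\<lambda>(N, j). (\<lambda>(x, u). u i ^ j) * on_graph (\<lambda>x u. mon m (dig N) x))"
  define I where "I = {..<b ^ m} \<times> {..<b}"
  have "w k \<in> fun_space.span (gens d (m * E + E))" if "k \<in> I" for k
  proof -
    obtain N j where k: "k = (N, j)"
      by (cases k)
    have "j \<le> E"
      using that by (auto simp: k I_def b_def)
    have "(\<Sum>l<m. dig N l) \<le> (\<Sum>l<m. E)"
      by (intro sum_mono) (simp add: dig_def b_def less_Suc_eq_le[symmetric])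
    then have le: "(\<Sum>l<m. dig N l) + j \<le> m * E + E"
      using \<open>j \<le> E\<close> by simp
    have "w k \<in> fun_space.span (gens d ((\<Sum>l<m. dig N l) + j))"
      unfolding w_def k by simp (intro span_gens_mult_power hforms_in_span_gens d mon_hforms i)
    then show ?thesis
      using span_gens_mono[OF le] by blast
  qed
  moreover have "card (gens d (m * E + E)) < card I"
  proof -
    have "card (gens d (m * E + E)) \<le> Suc d ^ m * Suc (m * E + E) ^ m"
      by (rule card_gens)
    also have "\<dots> \<le> Suc d ^ m * (Suc m * Suc E) ^ m"
      by (intro mult_left_mono power_mono) auto
    also have "\<dots> = E * Suc E ^ m"
      by (simp only: power_mult_distrib E_def mult.assoc)
    also have "\<dots> < card I"
      by (simp add: I_def b_def)
    finally show ?thesis .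
  qed
  moreover have "finite I"
    by (simp add: I_def)
  ultimately obtain c where c: "\<exists>k\<in>I. c k \<noteq> 0" "(\<Sum>k\<in>I. fscale (c k) (w k)) = 0"
    using fun_space.nontrivial_relation[of I "gens d (m * E + E)" w] finite_gens by blast
  define p where "p j x = (\<Sum>N<b ^ m. c (N, j) * mon m (dig N) x)" for j x
  \<comment> \<open>By the choice of \<open>i\<close> it is enough to check the points
    \<open>x\<close> with a kernel vector whose coordinate \<open>i\<close> is nonzero.\<close>
  have p0: "p j x = 0" if "j < b" for j x
  proof (rule i(2)[THEN spec[of _ "p j"], THEN mp, THEN mp, THEN spec]; (intro allI impI)?)
    show "polynomial_on_lines (p j)"
      unfolding p_def
      by (intro polynomial_on_lines_sum polynomial_on_lines_mult polynomial_on_lines_const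
          polynomial_on_lines_hforms[OF mon_hforms])
  next
    fix x y assume y: "\<forall>v. A x y v = 0" "y i \<noteq> 0"
    have "(\<Sum>j<b. p j x * T ^ j) = 0" for T
    proof -
      \<comment> \<open>The multiple of \<open>y\<close> is chosen so that (x, u) stays on the graph
        while coordinate \<open>i\<close> of \<open>u\<close> takes the prescribed value
        \<open>T\<close>.\<close>
      define u where "u = (\<lambda>k. x k + ((T - x i) / y i) * y k)"
      have "A x u v = A x x v + (T - x i) / y i * A x y v" for v
        unfolding A_def u_def by (simp add: algebra_simps sum.distrib sum_distrib_left)
      then have graph: "(x, u) \<in> graph"
        using y by (simp add: graph_def)
      have "u i = T"
        using y by (simp add: u_def)
      have "0 = (\<Sum>k\<in>I. fscale (c k) (w k)) (x, u)"
        unfolding c(2) by simp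
      also have "\<dots> = (\<Sum>k\<in>I. c k * w k (x, u))"
        by (simp add: sum_fun_apply fscale_apply)
      also have "\<dots> = (\<Sum>(N, j)\<in>I. c (N, j) * (T ^ j * mon m (dig N) x))"
        using graph \<open>u i = T\<close> by (intro sum.cong) (auto simp: w_def on_graph_def)
      also have "\<dots> = (\<Sum>N<b ^ m. \<Sum>j<b. c (N, j) * (T ^ j * mon m (dig N) x))"
        by (simp add: I_def sum.cartesian_product)
      also have "\<dots> = (\<Sum>j<b. p j x * T ^ j)"
        by (subst sum.swap) (simp add: p_def sum_distrib_right sum_distrib_left ac_simps)
      finally show ?thesis
        by simp
    qed
    then show "p j x = 0"
      using that by (rule poly_sum_monom_zeroD)
  qed
  have "c (N, j) = 0" if "j < b" "N < b ^ m" for N j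
  proof (rule poly_sum_monom_zeroD[OF _ that(2)])
    fix t :: 'a
    \<comment> \<open>Kronecker substitution: at x_l = t^(b^l) the monomial of index
      \<open>N\<close> becomes t^N, which separates all monomials in play.\<close>
    have "mon m (dig N) (\<lambda>l. t ^ (b ^ l)) = t ^ N" if "N < b ^ m" for N
    proof -
      have "mon m (dig N) (\<lambda>l. t ^ (b ^ l)) = t ^ (\<Sum>l<m. dig N l * b ^ l)"
        by (simp add: mon_def power_sum power_mult[symmetric] mult.commute)
      then show ?thesis
        using that by (simp add: dig_def digits_sum)
    qed
    then show "(\<Sum>N<b ^ m. c (N, j) * t ^ N) = 0"
      using p0[OF \<open>j < b\<close>, of "\<lambda>l. t ^ (b ^ l)"] by (simp add: p_def)
  qed
  then show False
    using c(1) by (auto simp: I_def)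
qed

end

theorem quadratic_map_injective_derivative:
  fixes a :: "nat \<Rightarrow> nat \<Rightarrow> 'v \<Rightarrow> 'a::{alg_closed_field, field_char_0}"
  assumes "\<And>x. \<exists>i<m. x i \<noteq> 0 \<Longrightarrow> \<exists>v. (\<Sum>i<m. \<Sum>j<m. x i * x j * a i j v) \<noteq> 0"
  shows "\<exists>x. \<forall>y. (\<exists>i<m. y i \<noteq> 0) \<longrightarrow> (\<exists>v. (\<Sum>i<m. \<Sum>j<m. x i * y j * a i j v) \<noteq> 0)"
proof -
  interpret quadratic_map_without_zeros m a "\<lambda>x y v. \<Sum>i<m. \<Sum>j<m. x i * y j * a i j v"
    by unfold_locales (use assms in auto)
  show ?thesis
  proof (rule ccontr)
    assume "\<not> ?thesis"
    then have "\<And>x. \<exists>y. (\<exists>i<m. y i \<noteq> 0) \<and> (\<forall>v. (\<Sum>i<m. \<Sum>j<m. x i * y j * a i j v) = 0)"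
      by blast
    then show False
      by (rule not_everywhere_degenerate)
  qed
qed

section \<open>Pencils of matrices\<close>

lemma det_zero_iff_kernel:
  fixes a :: "nat \<Rightarrow> nat \<Rightarrow> 'a::field"
  shows "det (mat n n (\<lambda>(i, j). a i j)) = 0 \<longleftrightarrow>
    (\<exists>x. (\<exists>j<n. x j \<noteq> 0) \<and> (\<forall>i<n. (\<Sum>j<n. a i j * x j) = 0))"
proof -
  let ?A = "mat n n (\<lambda>(i, j). a i j)"
  have prod: "(?A *\<^sub>v vec n x) $ i = (\<Sum>j<n. a i j * x j)" if "i < n" for x i
    using that by (simp add: scalar_prod_def atLeast0LessThan)
  have "det ?A = 0 \<longleftrightarrow> (\<exists>v. v \<in> carrier_vec n \<and> v \<noteq> 0\<^sub>v n \<and> ?A *\<^sub>v v = 0\<^sub>v n)"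
    by (rule det_0_iff_vec_prod_zero_field) simp
  also have "\<dots> \<longleftrightarrow> (\<exists>x. vec n x \<noteq> 0\<^sub>v n \<and> ?A *\<^sub>v vec n x = 0\<^sub>v n)"
  proof safe
    fix v assume *: "v \<in> carrier_vec n" "v \<noteq> 0\<^sub>v n" "?A *\<^sub>v v = 0\<^sub>v n"
    have "vec n (\<lambda>i. v $ i) = v"
      using *(1) by auto
    with * show "\<exists>x. vec n x \<noteq> 0\<^sub>v n \<and> ?A *\<^sub>v vec n x = 0\<^sub>v n"
      by (intro exI[of _ "\<lambda>i. v $ i"]) simp
  qed (auto intro: vec_carrier)
  also have "\<dots> \<longleftrightarrow> (\<exists>x. (\<exists>j<n. x j \<noteq> 0) \<and> (\<forall>i<n. (\<Sum>j<n. a i j * x j) = 0))"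
  proof -
    have "vec n x \<noteq> 0\<^sub>v n \<longleftrightarrow> (\<exists>j<n. x j \<noteq> 0)" for x :: "nat \<Rightarrow> 'a"
      by (auto simp: vec_eq_iff)
    moreover have "?A *\<^sub>v vec n x = 0\<^sub>v n \<longleftrightarrow> (\<forall>i<n. (\<Sum>j<n. a i j * x j) = 0)" for x
      by (subst vec_eq_iff) (simp add: prod del: index_mult_mat_vec)
    ultimately show ?thesis
      by simp
  qed
  finally show ?thesis .
qed

text \<open>The determinant of a + t b is a polynomial in t that is nonzero at t = 0, so it has
  finitely many roots.\<close>

lemma finite_singular_pencil:
  fixes a b :: "nat \<Rightarrow> nat \<Rightarrow> 'a::field"
  assumes "\<And>x. \<forall>i<n. (\<Sum>j<n. a i j * x j) = 0 \<Longrightarrow> \<forall>j<n. x j = 0"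
  shows "finite {t. \<exists>x. (\<exists>j<n. x j \<noteq> 0) \<and> (\<forall>i<n. (\<Sum>j<n. (a i j + t * b i j) * x j) = 0)}"
proof -
  define p where "p = det (mat n n (\<lambda>(i, j). [:a i j, b i j:]))"
  have p: "poly p t = det (mat n n (\<lambda>(i, j). a i j + t * b i j))" for t
    unfolding p_def by (rule poly_det_cong[of _ n]) auto
  have "det (mat n n (\<lambda>(i, j). a i j)) \<noteq> 0"
    unfolding det_zero_iff_kernel using assms by blast
  then have "poly p 0 \<noteq> 0"
    by (simp add: p)
  then have "p \<noteq> 0"
    by auto
  then have "finite {t. poly p t = 0}"
    by (rule poly_roots_finite)
  moreover have "{t. \<exists>x. (\<exists>j<n. x j \<noteq> 0) \<and> (\<forall>i<n. (\<Sum>j<n. (a i j + t * b i j) * x j) = 0)} = {t. poly p t = 0}"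
    unfolding p det_zero_iff_kernel ..
  ultimately show ?thesis
    by simp
qed

text \<open>The columns and the right-hand side are n + 1 vectors in an n-dimensional space.
  Injectivity forces the coefficient of the right-hand side in a relation to be nonzero, and
  dividing by it gives the solution.\<close>

lemma nonsingular_system_solvable:
  fixes a :: "nat \<Rightarrow> nat \<Rightarrow> 'a::field"
  assumes inj: "\<And>x. \<forall>i<n. (\<Sum>j<n. a i j * x j) = 0 \<Longrightarrow> \<forall>j<n. x j = 0"
  shows "\<exists>x. \<forall>i<n. (\<Sum>j<n. a i j * x j) = \<theta> i"
proof -
  define v where "v k = (\<lambda>i. if i < n then if k < n then a i k else \<theta> i else 0)" for k
  define B where "B = (\<lambda>k i. if i = k then 1 else 0 :: 'a) ` {..<n}"
  have "v k \<in> fun_space.span B" if "k \<in> {..n}" for k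
  proof -
    have "v k = (\<Sum>l<n. fscale (v k l) (\<lambda>i. if i = l then 1 else 0))"
    proof
      fix i
      have "(\<Sum>l<n. v k l * (if i = l then 1 else 0)) = (\<Sum>l<n. if l = i then v k l else 0)"
        by (intro sum.cong) auto
      then show "v k i = (\<Sum>l<n. fscale (v k l) (\<lambda>i. if i = l then 1 else 0)) i"
        by (simp add: sum_fun_apply fscale_apply v_def)
    qed
    moreover have "(\<Sum>l<n. fscale (v k l) (\<lambda>i. if i = l then 1 else 0)) \<in> fun_space.span B"
      by (intro fun_space.span_sum fun_space.span_scale fun_space.span_base) (auto simp: B_def)
    ultimately show ?thesis
      by metis
  qed
  moreover have "finite B" "card B \<le> n"
    using card_image_le[of "{..<n}" "\<lambda>k i. if i = k then 1 else 0 :: 'a"] by (auto simp: B_def)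
  ultimately obtain c where c: "\<exists>k\<in>{..n}. c k \<noteq> 0" "(\<Sum>k\<in>{..n}. fscale (c k) (v k)) = 0"
    using fun_space.nontrivial_relation[of "{..n}" B v] by auto
  have rel: "(\<Sum>j<n. a i j * c j) + c n * \<theta> i = 0" if "i < n" for i
  proof -
    have "(\<Sum>k\<in>{..n}. c k * v k i) = 0"
      using fun_cong[OF c(2), of i] by (simp add: sum_fun_apply fscale_apply)
    moreover have "(\<Sum>k\<in>{..n}. c k * v k i) = (\<Sum>k<n. c k * v k i) + c n * v n i"
      by (simp add: lessThan_Suc_atMost[symmetric])
    ultimately show ?thesis
      using that by (simp add: v_def mult.commute)
  qed
  have "c n \<noteq> 0"
  proof
    assume "c n = 0"
    then have "\<forall>i<n. (\<Sum>j<n. a i j * c j) = 0"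
      using rel by auto
    then have "\<forall>j<n. c j = 0"
      by (rule inj)
    then have "\<forall>k\<in>{..n}. c k = 0"
      using \<open>c n = 0\<close> by (auto simp: le_less)
    then show False
      using c(1) by blast
  qed
  have "(\<Sum>j<n. a i j * (- c j / c n)) = \<theta> i" if "i < n" for i
  proof -
    have "(\<Sum>j<n. a i j * (- c j / c n)) = - (\<Sum>j<n. a i j * c j) / c n"
      by (simp add: sum_divide_distrib sum_negf)
    also have "(\<Sum>j<n. a i j * c j) = - (c n * \<theta> i)"
      using rel[OF that] by (simp only: eq_neg_iff_add_eq_0)
    also have "- (- (c n * \<theta> i)) / c n = \<theta> i"
      using \<open>c n \<noteq> 0\<close> by simp
    finally show ?thesis .
  qed
  then show ?thesis
    by (intro exI[of _ "\<lambda>j. - c j / c n"]) simp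
qed

section \<open>Cubic forms with a space of degenerate polars\<close>

locale symmetric_trilinear_form = vector_space scale
  for scale :: "'a::{alg_closed_field, field_char_0} \<Rightarrow> 'v::ab_group_add \<Rightarrow> 'v" (infixr "*s" 75) +
  fixes T :: "'v \<Rightarrow> 'v \<Rightarrow> 'v \<Rightarrow> 'a"
  assumes T_add: "T (x + y) z u = T x z u + T y z u"
    and T_scale: "T (c *s x) z u = c * T x z u"
    and T_sym12: "T x z u = T z x u"
    and T_sym23: "T x z u = T x u z"
begin

lemma T_add2: "T z (x + y) u = T z x u + T z y u"
  by (metis T_add T_sym12)

lemma T_add3: "T z u (x + y) = T z u x + T z u y"
  by (metis T_add2 T_sym23)

lemma T_scale2: "T z (c *s x) u = c * T z x u"
  by (metis T_scale T_sym12)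

lemma T_scale3: "T z u (c *s x) = c * T z u x"
  by (metis T_scale2 T_sym23)

lemma T_zero [simp]: "T 0 x y = 0" "T x 0 y = 0" "T x y 0 = 0"
  using T_scale[of 0 0] T_scale2[of _ 0 0] T_scale3[of _ _ 0 0] by auto

lemma T_minus: "T (- x) y z = - T x y z" "T y (- x) z = - T y x z" "T y z (- x) = - T y z x"
  using T_scale[of "-1" x] T_scale2[of _ "-1" x] T_scale3[of _ _ "-1" x] by auto

lemma T_diff: "T (x - w) y z = T x y z - T w y z" "T y (x - w) z = T y x z - T y w z"
  "T y z (x - w) = T y z x - T y z w"
  using T_add[of x "- w"] T_add2[of _ x "- w"] T_add3[of _ _ x "- w"] by (auto simp: T_minus)

lemma T_sum: "T (\<Sum>i\<in>I. f i) y z = (\<Sum>i\<in>I. T (f i) y z)"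
  "T y (\<Sum>i\<in>I. f i) z = (\<Sum>i\<in>I. T y (f i) z)" "T y z (\<Sum>i\<in>I. f i) = (\<Sum>i\<in>I. T y z (f i))"
  by (induction I rule: infinite_finite_induct) (auto simp: T_add T_add2 T_add3)

lemmas T_linear = T_add T_add2 T_add3 T_scale T_scale2 T_scale3 T_minus T_diff

lemma nondegenerate_square:
  fixes m :: nat and b :: "nat \<Rightarrow> 'v"
  assumes indep: "\<And>c. (\<Sum>i<m. c i *s b i) = 0 \<Longrightarrow> \<forall>i<m. c i = 0"
    and nz: "\<And>y. y \<in> range (\<lambda>c. \<Sum>i<m. c i *s b i) \<Longrightarrow> y \<noteq> 0 \<Longrightarrow> \<exists>v. T y y v \<noteq> 0"
  shows "\<exists>x\<in>range (\<lambda>c. \<Sum>i<m. c i *s b i). \<forall>y\<in>range (\<lambda>c. \<Sum>i<m. c i *s b i). y \<noteq> 0 \<longrightarrow> (\<exists>v. T x y v \<noteq> 0)"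
proof -
  define comb where "comb c = (\<Sum>i<m. c i *s b i)" for c
  have T_comb: "(\<Sum>i<m. \<Sum>j<m. x i * y j * T (b i) (b j) v) = T (comb x) (comb y) v" for x y v
    unfolding comb_def T_sum(1) by (simp add: T_sum(2) T_scale T_scale2 ac_simps)
  have "\<exists>v. (\<Sum>i<m. \<Sum>j<m. x i * x j * T (b i) (b j) v) \<noteq> 0" if "\<exists>i<m. x i \<noteq> 0" for x
  proof -
    have "comb x \<noteq> 0"
      using indep[of x] that unfolding comb_def by blast
    moreover have "comb x \<in> range (\<lambda>c. \<Sum>i<m. c i *s b i)"
      by (simp add: comb_def)
    ultimately have "\<exists>v. T (comb x) (comb x) v \<noteq> 0"
      using nz by blast
    then show ?thesis
      by (simp only: T_comb)
  qed
  then obtain x where x: "\<forall>y. (\<exists>i<m. y i \<noteq> 0) \<longrightarrow> (\<exists>v. T (comb x) (comb y) v \<noteq> 0)"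
    using quadratic_map_injective_derivative[of m "\<lambda>i j. T (b i) (b j)"] unfolding T_comb by blast
  show ?thesis
  proof (intro bexI ballI impI)
    show "comb x \<in> range (\<lambda>c. \<Sum>i<m. c i *s b i)"
      by (simp add: comb_def)
    fix y assume "y \<in> range (\<lambda>c. \<Sum>i<m. c i *s b i)" "y \<noteq> 0"
    then obtain c where c: "y = comb c"
      by (auto simp: comb_def)
    then have "\<exists>i<m. c i \<noteq> 0"
      using \<open>y \<noteq> 0\<close> by (auto simp: comb_def intro!: sum.neutral)
    then show "\<exists>v. T (comb x) y v \<noteq> 0"
      using x c by blast
  qed
qed

end

text \<open>The assumption \<open>rank\<close> expresses rank at most \<open>m\<close> without
  mentioning the dimension of the ambient space: if T(y, _, _) is injective on the
  \<open>m\<close>-dimensional \<open>W\<close>, then the image of \<open>W\<close> is everything,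
  so each vector lies in \<open>W\<close> up to the kernel.\<close>

locale degenerate_polars = symmetric_trilinear_form scale T
  for scale :: "'a::{alg_closed_field, field_char_0} \<Rightarrow> 'v::ab_group_add \<Rightarrow> 'v" (infixr "*s" 75) and T +
  fixes m :: nat and b :: "nat \<Rightarrow> 'v" and W :: "'v set" and x :: 'v
  defines "W \<equiv> range (\<lambda>c. \<Sum>i<m. c i *s b i)"
  assumes indep: "\<And>c. (\<Sum>i<m. c i *s b i) = 0 \<Longrightarrow> \<forall>i<m. c i = 0"
    and nonzero: "\<And>y. y \<in> W \<Longrightarrow> y \<noteq> 0 \<Longrightarrow> \<exists>v. T y y v \<noteq> 0"
    and rank: "\<And>y v. y \<in> W \<Longrightarrow> (\<And>p. p \<in> W \<Longrightarrow> (\<And>v. T y p v = 0) \<Longrightarrow> p = 0) \<Longrightarrow>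
      \<exists>p\<in>W. \<forall>u. T y (v - p) u = 0"
    and x: "x \<in> W" "\<And>y. y \<in> W \<Longrightarrow> (\<And>v. T x y v = 0) \<Longrightarrow> y = 0"
begin

definition K :: "'v set" where "K = {u. \<forall>v. T x u v = 0}"

lemma K_iff: "u \<in> K \<longleftrightarrow> (\<forall>v. T x u v = 0)"
  by (simp add: K_def)

lemma combI: "(\<Sum>i<m. c i *s b i) \<in> W"
  by (simp add: W_def)

lemma subspace_W: "subspace W"
proof (rule subspaceI)
  show "0 \<in> W"
    using combI[of "\<lambda>_. 0"] by simp
next
  fix y z assume "y \<in> W" "z \<in> W"
  then obtain c d where "y = (\<Sum>i<m. c i *s b i)" "z = (\<Sum>i<m. d i *s b i)"
    by (auto simp: W_def)
  then have "y + z = (\<Sum>i<m. (c i + d i) *s b i)"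
    by (simp add: scale_left_distrib sum.distrib)
  then show "y + z \<in> W"
    by (simp only: combI)
next
  fix e y assume "y \<in> W"
  then obtain c where "y = (\<Sum>i<m. c i *s b i)"
    by (auto simp: W_def)
  then have "e *s y = (\<Sum>i<m. (e * c i) *s b i)"
    by (simp add: scale_sum_right)
  then show "e *s y \<in> W"
    by (simp only: combI)
qed

lemmas W_closed = subspace_0[OF subspace_W] subspace_add[OF subspace_W] subspace_scale[OF subspace_W]
  subspace_neg[OF subspace_W] subspace_diff[OF subspace_W]

lemma b_in_W: "i < m \<Longrightarrow> b i \<in> W"
proof -
  assume "i < m"
  have "b i = (\<Sum>j<m. (if j = i then 1 else 0) *s b j)"
    using \<open>i < m\<close> by (simp add: if_distrib[of "\<lambda>c. c *s b _"] cong: if_cong)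
  then show ?thesis
    by (simp only: combI)
qed

lemma T_W_cong:
  assumes "\<And>i. i < m \<Longrightarrow> T y p (b i) = T z q (b i)" "w \<in> W"
  shows "T y p w = T z q w"
  using assms(2) unfolding W_def by (auto simp: T_sum T_scale3 assms(1))

lemma complement:
  obtains p where "p \<in> W" "v - p \<in> K"
  using rank[OF x(1), of v] x(2) by (auto simp: K_iff)

text \<open>Since \<open>W\<close> and \<open>K\<close> together fill the space and T(x, _, _) pairs
  trivially with \<open>K\<close>, testing against \<open>W\<close> is as good as testing against
  all vectors.\<close>

lemma nondegenerate: "p \<in> W \<Longrightarrow> (\<And>w. w \<in> W \<Longrightarrow> T x p w = 0) \<Longrightarrow> p = 0"
proof (rule x(2))
  fix v
  assume *: "\<And>w. w \<in> W \<Longrightarrow> T x p w = 0"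
  obtain q where q: "q \<in> W" "v - q \<in> K"
    by (rule complement)
  have "T x p v = T x p q + T x p (v - q)"
    by (simp add: T_diff)
  also have "T x p (v - q) = 0"
    using q(2) T_sym23[of x p] by (simp add: K_iff)
  finally show "T x p v = 0"
    using * q by simp
qed

lemma nondegenerate_coordinates:
  assumes "\<forall>i<m. (\<Sum>j<m. T x (b j) (b i) * c j) = 0"
  shows "\<forall>j<m. c j = 0"
proof (rule indep, rule nondegenerate)
  let ?p = "\<Sum>j<m. c j *s b j"
  show "?p \<in> W"
    by (simp add: W_def)
  fix w assume "w \<in> W"
  have "T x ?p (b i) = T x 0 (b i)" if "i < m" for i
    using assms that by (simp add: T_sum T_scale2 mult.commute)
  then have "T x ?p w = T x 0 w"
    using \<open>w \<in> W\<close> by (rule T_W_cong)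
  then show "T x ?p w = 0"
    by simp
qed

lemma representable: "\<exists>p\<in>W. \<forall>w\<in>W. T x p w = T e f w"
proof -
  obtain c where c: "\<And>i. i < m \<Longrightarrow> (\<Sum>j<m. T x (b j) (b i) * c j) = T e f (b i)"
    using nonsingular_system_solvable[of m "\<lambda>i j. T x (b j) (b i)" "\<lambda>i. T e f (b i)"]
      nondegenerate_coordinates by blast
  let ?p = "\<Sum>j<m. c j *s b j"
  have "T x ?p (b i) = T e f (b i)" if "i < m" for i
    using c[OF that] by (simp add: T_sum T_scale2 mult.commute)
  then have "\<forall>w\<in>W. T x ?p w = T e f w"
    using T_W_cong by blast
  moreover have "?p \<in> W"
    by (simp add: W_def)
  ultimately show ?thesis
    by blast
qed

text \<open>\<open>rep e f\<close> is N_e f. Both arguments range over the whole space, and by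
  symmetry of \<open>T\<close> they may be exchanged, so N_z u = N_u z.\<close>

definition rep :: "'v \<Rightarrow> 'v \<Rightarrow> 'v" where
  "rep e f = (SOME p. p \<in> W \<and> (\<forall>w\<in>W. T x p w = T e f w))"

lemma rep: "rep e f \<in> W" "w \<in> W \<Longrightarrow> T x (rep e f) w = T e f w"
  using someI_ex[OF representable[of e f, unfolded Bex_def]] by (auto simp: rep_def)

lemma rep_unique: "p \<in> W \<Longrightarrow> (\<And>w. w \<in> W \<Longrightarrow> T x p w = T e f w) \<Longrightarrow> rep e f = p"
  using nondegenerate[of "rep e f - p"] rep(1)[of e f] rep(2)[of _ e f] by (auto simp: W_closed T_diff)

lemma rep_sym: "rep e f = rep f e"
  by (rule rep_unique) (simp_all add: rep T_sym12[of f e])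

lemma rep_add2: "rep e (f + g) = rep e f + rep e g"
  by (rule rep_unique) (simp_all add: rep W_closed T_linear)

lemma rep_scale2: "rep e (c *s f) = c *s rep e f"
  by (rule rep_unique) (simp_all add: rep W_closed T_linear)

lemma rep_add1: "rep (e + g) f = rep e f + rep g f"
  by (metis rep_add2 rep_sym)

lemma rep_scale1: "rep (c *s e) f = c *s rep e f"
  by (metis rep_scale2 rep_sym)

lemma finite_degenerate:
  "finite {t. \<exists>p\<in>W. p \<noteq> 0 \<and> (\<forall>w\<in>W. T (x + t *s z) p w = 0)}"
proof -
  define S where "S = {t. \<exists>c. (\<exists>j<m. c j \<noteq> 0) \<and>
      (\<forall>i<m. (\<Sum>j<m. (T x (b j) (b i) + t * T z (b j) (b i)) * c j) = 0)}"
  have *: "\<forall>j<m. c j = 0" if "\<forall>i<m. (\<Sum>j<m. T x (b j) (b i) * c j) = 0" for c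
    using that by (rule nondegenerate_coordinates)
  have "finite S"
    unfolding S_def by (rule finite_singular_pencil[of m "\<lambda>i j. T x (b j) (b i)" "\<lambda>i j. T z (b j) (b i)", OF *])
  moreover have "{t. \<exists>p\<in>W. p \<noteq> 0 \<and> (\<forall>w\<in>W. T (x + t *s z) p w = 0)} \<subseteq> S"
    unfolding S_def
  proof clarify
    fix t p assume p: "p \<in> W" "p \<noteq> 0" "\<forall>w\<in>W. T (x + t *s z) p w = 0"
    obtain c where c: "p = (\<Sum>j<m. c j *s b j)"
      using p(1) by (auto simp: W_def)
    have "\<exists>j<m. c j \<noteq> 0"
    proof (rule ccontr)
      assume "\<not> ?thesis"
      then have "p = 0"
        unfolding c by (intro sum.neutral) auto
      then show False
        using p(2) by simp
    qed
    moreover have "(\<Sum>j<m. (T x (b j) (b i) + t * T z (b j) (b i)) * c j) = 0" if "i < m" for i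
      using p(3) b_in_W[OF that] by (simp add: c T_sum T_linear mult.commute)
    ultimately show "\<exists>c. (\<exists>j<m. c j \<noteq> 0) \<and>
      (\<forall>i<m. (\<Sum>j<m. (T x (b j) (b i) + t * T z (b j) (b i)) * c j) = 0)"
      by blast
  qed
  ultimately show ?thesis
    by (rule finite_subset[rotated])
qed

text \<open>The vector \<open>p\<close> depends rationally on t and is regular at t = 0, so t T(z,
  v, p) tends to 0; being constant, it is 0. In algebraic form: for \<open>d\<close> nonzero a
  bordered matrix is invertible at t = 0, hence for almost all t, although t p supplies a kernel
  vector.\<close>

lemma pencil_limit:
  assumes "finite E"
    and p: "\<And>t. t \<notin> E \<Longrightarrow> \<exists>p\<in>W. (\<forall>w\<in>W. T x p w + t * T z p w = T e f w) \<and> t * T z v p = d"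
  shows "d = 0"
proof (rule ccontr)
  assume "d \<noteq> 0"
  \<comment> \<open>At t = 0 the bordered matrix is block triangular; its diagonal blocks are the
    Gram matrix of T(x, _, _) on \<open>W\<close> and the entry -d.\<close>
  define a where "a i j = (if i < m then if j < m then T x (b j) (b i) else 0
    else if j < m then T z v (b j) else - d)" for i j
  define a' where "a' i j = (if i < m then if j < m then T z (b j) (b i) else - T e f (b i) else 0)" for i j
  have sum: "(\<Sum>j<Suc m. (a i j + t * a' i j) * c j) =
      (if i < m then T x (\<Sum>j<m. c j *s b j) (b i) + t * (T z (\<Sum>j<m. c j *s b j) (b i) - c m * T e f (b i))
       else T z v (\<Sum>j<m. c j *s b j) - d * c m)" for i t c
  proof (cases "i < m")
    case True
    then have "(\<Sum>j<m. (a i j + t * a' i j) * c j) = T x (\<Sum>j<m. c j *s b j) (b i) + t * T z (\<Sum>j<m. c j *s b j) (b i)"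
      unfolding T_sum(2) T_scale2 sum_distrib_left sum.distrib[symmetric]
      by (intro sum.cong) (auto simp: a_def a'_def algebra_simps)
    with True show ?thesis
      by (simp add: a_def a'_def algebra_simps)
  next
    case False
    then show ?thesis
      by (simp add: a_def a'_def T_sum(3) T_scale3 ac_simps)
  qed
  have "finite {t. \<exists>c. (\<exists>j<Suc m. c j \<noteq> 0) \<and> (\<forall>i<Suc m. (\<Sum>j<Suc m. (a i j + t * a' i j) * c j) = 0)}"
  proof (rule finite_singular_pencil)
    fix c assume c: "\<forall>i<Suc m. (\<Sum>j<Suc m. a i j * c j) = 0"
    let ?p = "\<Sum>j<m. c j *s b j"
    have "(\<Sum>j<m. T x (b j) (b i) * c j) = 0" if "i < m" for i
      using c[rule_format, of i] sum[where t = 0] that by (simp add: T_sum T_linear mult.commute)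
    then have 0: "\<forall>j<m. c j = 0"
      using nondegenerate_coordinates by blast
    have "c m = 0"
      using c[rule_format, of m] 0 \<open>d \<noteq> 0\<close> by (simp add: a_def)
    with 0 show "\<forall>j<Suc m. c j = 0"
      by (auto simp: less_Suc_eq)
  qed
  with \<open>finite E\<close> obtain t where t: "t \<notin> E"
    "\<not> (\<exists>c. (\<exists>j<Suc m. c j \<noteq> 0) \<and> (\<forall>i<Suc m. (\<Sum>j<Suc m. (a i j + t * a' i j) * c j) = 0))"
    using ex_new_if_finite[OF infinite_UNIV_char_0, of "E \<union> {t. \<exists>c. (\<exists>j<Suc m. c j \<noteq> 0) \<and>
      (\<forall>i<Suc m. (\<Sum>j<Suc m. (a i j + t * a' i j) * c j) = 0)}"] by auto
  obtain q where q: "q \<in> W" "\<And>w. w \<in> W \<Longrightarrow> T x q w + t * T z q w = T e f w" "t * T z v q = d"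
    using p[OF t(1)] by blast
  obtain c where c: "q = (\<Sum>j<m. c j *s b j)"
    using q(1) by (auto simp: W_def)
  \<comment> \<open>The kernel vector consists of the coordinates of t q followed by 1, so it is
    nonzero whatever \<open>q\<close> is.\<close>
  define c' where "c' j = (if j < m then t * c j else 1)" for j
  have c': "(\<Sum>j<m. c' j *s b j) = t *s q"
    by (simp add: c'_def c scale_sum_right)
  have "(\<Sum>j<Suc m. (a i j + t * a' i j) * c' j) = 0" if "i < Suc m" for i
  proof (cases "i < m")
    case True
    have "t * T x q (b i) + t * (t * T z q (b i) - T e f (b i)) = 0"
      by (simp add: q(2)[OF b_in_W[OF True], symmetric] algebra_simps)
    then show ?thesis
      unfolding sum c' using True by (simp add: T_linear c'_def)
  next
    case False
    then show ?thesis
      unfolding sum c' using q(3) by (simp add: T_linear c'_def)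
  qed
  moreover have "c' m \<noteq> 0"
    by (simp add: c'_def)
  ultimately show False
    using t(2) by blast
qed

end

section \<open>Indexed bases of finite-dimensional subspaces\<close>

lemma (in vector_space) sum_in_span_image: "(\<Sum>i<(l::nat). c i *s g i) \<in> span (g ` {..<l})"
  by (intro span_sum span_scale span_base) auto

lemma (in vector_space) subspace_finite_basis:
  assumes "subspace S" "S \<subseteq> span F" "finite F"
  shows "\<exists>l g. (\<forall>c. (\<Sum>i<l. c i *s g i) = 0 \<longrightarrow> (\<forall>i<l. c i = 0)) \<and>
    S = range (\<lambda>c. \<Sum>i<(l::nat). c i *s g i)"
proof -
  obtain B where B: "B \<subseteq> S" "independent B" "S \<subseteq> span B"
    using maximal_independent_subset[of S] by blast
  have "finite B"
    using independent_span_bound[OF \<open>finite F\<close> B(2)] B(1) assms(2) by blast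
  then obtain h where h: "bij_betw h {..<card B} B"
    using ex_bij_betw_nat_finite[of B] by (auto simp: atLeast0LessThan)
  define h' where "h' = inv_into {..<card B} h"
  have h': "h' (h i) = i" if "i < card B" for i
    using h that by (simp add: h'_def bij_betw_def inv_into_f_f)
  have sum: "(\<Sum>i<card B. c (h i) *s h i) = (\<Sum>v\<in>B. c v *s v)" for c
    by (rule sum.reindex_bij_betw[OF h])
  show ?thesis
  proof (intro exI conjI allI impI)
    fix c i assume c: "(\<Sum>i<card B. c i *s h i) = 0" and i: "i < card B"
    have "(\<Sum>v\<in>B. c (h' v) *s v) = (\<Sum>i<card B. c i *s h i)"
      unfolding sum[symmetric] by (intro sum.cong) (auto simp: h')
    then have "c (h' (h i)) = 0"
      using c i h by (intro independentD[OF B(2) \<open>finite B\<close> order_refl, of "\<lambda>v. c (h' v)"])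
        (auto simp: bij_betw_def)
    then show "c i = 0"
      using h' i by simp
  next
    show "S = range (\<lambda>c. \<Sum>i<card B. c i *s h i)"
    proof (intro equalityI subsetI)
      fix y assume "y \<in> S"
      then obtain c where "y = (\<Sum>v\<in>B. c v *s v)"
        using B(3) span_finite[OF \<open>finite B\<close>] by auto
      then have "y = (\<Sum>i<card B. c (h i) *s h i)"
        by (simp only: sum)
      then show "y \<in> range (\<lambda>c. \<Sum>i<card B. c i *s h i)"
        by (intro image_eqI[of _ _ "\<lambda>i. c (h i)"]) auto
    next
      fix y assume "y \<in> range (\<lambda>c. \<Sum>i<card B. c i *s h i)"
      then show "y \<in> S"
        using h B(1) by (auto intro!: subspace_sum subspace_scale assms(1) simp: bij_betw_def)
    qed
  qed
qed

section \<open>Expansion of the rank condition along lines in W\<close>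

context degenerate_polars
begin

text \<open>This says that t -> T(z, v, (1 + t N_z)^-1 N_e f) vanishes for almost all t. Its
  expansion coefficients at t = 0 are T(z, v, N_z^i N_e f) up to sign, and they are extracted one at
  a time by \<open>flat_rep\<close>.\<close>

definition flat :: "'v \<Rightarrow> 'v \<Rightarrow> 'v \<Rightarrow> 'v \<Rightarrow> bool" where
  "flat z v e f \<longleftrightarrow> (\<exists>E. finite E \<and> (\<forall>t. t \<notin> E \<longrightarrow>
     (\<exists>p\<in>W. (\<forall>w\<in>W. T x p w + t * T z p w = T e f w) \<and> T z v p = 0)))"

text \<open>Here \<open>p t\<close> is \<open>(1 + t M)\<inverse> (rep e f)\<close> with \<open>M = rep z\<close>, and \<open>M (p t) = (rep e f - p t) / t\<close>.\<close>

lemma flat_rep: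
  assumes "flat z v e f"
  shows "T z v (rep e f) = 0" "flat z v z (rep e f)"
proof -
  obtain E where E: "finite E" "\<And>t. t \<notin> E \<Longrightarrow>
      \<exists>p\<in>W. (\<forall>w\<in>W. T x p w + t * T z p w = T e f w) \<and> T z v p = 0"
    using assms unfolding flat_def by blast
  let ?E = "insert 0 E"
  have *: "\<exists>q\<in>W. (\<forall>w\<in>W. T x q w + t * T z q w = T z (rep e f) w) \<and> t * T z v q = T z v (rep e f)"
    if t: "t \<notin> ?E" for t
  proof -
    obtain p where p: "p \<in> W" "\<And>w. w \<in> W \<Longrightarrow> T x p w + t * T z p w = T e f w" "T z v p = 0"
      using E(2)[of t] t by auto
    define q where "q = inverse t *s (rep e f - p)"
    have "t \<noteq> 0"
      using t by simp
    have q: "T x q w = T z p w" if "w \<in> W" for w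
      using p(2)[OF that] rep(2)[OF that, of e f] \<open>t \<noteq> 0\<close> by (simp add: q_def T_linear field_simps)
    show ?thesis
    proof (intro bexI conjI ballI)
      show "q \<in> W"
        by (simp add: q_def W_closed rep p)
      show "T x q w + t * T z q w = T z (rep e f) w" if "w \<in> W" for w
        unfolding q[OF that] using \<open>t \<noteq> 0\<close> by (simp add: q_def T_linear mult.assoc[symmetric])
      show "t * T z v q = T z v (rep e f)"
        using \<open>t \<noteq> 0\<close> by (simp add: q_def T_linear p(3))
    qed
  qed
  show 0: "T z v (rep e f) = 0"
  proof (rule pencil_limit)
    show "finite ?E"
      using E(1) by simp
  qed (rule *)
  show "flat z v z (rep e f)"
    unfolding flat_def
  proof (intro exI[of _ ?E] conjI allI impI)
    fix t assume "t \<notin> ?E"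
    then show "\<exists>p\<in>W. (\<forall>w\<in>W. T x p w + t * T z p w = T z (rep e f) w) \<and> T z v p = 0"
      using *[of t] unfolding 0 by auto
  qed (use E(1) in simp)
qed

text \<open>For almost all t the polar of x + t z is nondegenerate on \<open>W\<close>, so
  \<open>u\<close> can be moved into its kernel by some q in \<open>W\<close>. Then p = q / t solves
  (1 + t N_z) p = N_z u, and pairing with \<open>v\<close> in \<open>K\<close> gives t T(z, v, p) =
  T(z, u, v). The limit kills the right-hand side, and what remains is \<open>flat\<close>.\<close>

lemma polar_on_K:
  assumes z: "z \<in> W" and u: "u \<in> K" and v: "v \<in> K"
  shows "T z u v = 0" "flat z v z u"
proof -
  define E where "E = insert 0 {t. \<exists>p\<in>W. p \<noteq> 0 \<and> (\<forall>w\<in>W. T (x + t *s z) p w = 0)}"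
  have "finite E"
    by (simp add: E_def finite_degenerate)
  have *: "\<exists>p\<in>W. (\<forall>w\<in>W. T x p w + t * T z p w = T z u w) \<and> t * T z v p = T z u v"
    if t: "t \<notin> E" for t
  proof -
    have "t \<noteq> 0"
      using t by (simp add: E_def)
    have "x + t *s z \<in> W"
      using x z by (simp add: W_closed)
    moreover have "p = 0" if "p \<in> W" "\<And>v. T (x + t *s z) p v = 0" for p
      using t that by (auto simp: E_def)
    ultimately obtain q where q: "q \<in> W" "\<And>w. T (x + t *s z) (u - q) w = 0"
      using rank[of "x + t *s z" u] by blast
    have qw: "T x q w + t * T z q w = t * T z u w" for w
      using q(2)[of w] u by (simp add: T_linear K_iff algebra_simps)
    show ?thesis
    proof (intro bexI conjI ballI)
      show "inverse t *s q \<in> W"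
        by (simp add: W_closed q)
      show "T x (inverse t *s q) w + t * T z (inverse t *s q) w = T z u w" if "w \<in> W" for w
        using qw[of w] \<open>t \<noteq> 0\<close> by (simp add: T_linear field_simps)
      have "T x q v = 0"
        using v T_sym23[of x q] by (simp add: K_iff)
      then have "t * T z q v = t * T z u v"
        using qw[of v] by simp
      then show "t * T z v (inverse t *s q) = T z u v"
        using \<open>t \<noteq> 0\<close> T_sym23[of z v q] by (simp add: T_linear)
    qed
  qed
  show 0: "T z u v = 0"
    by (rule pencil_limit[OF \<open>finite E\<close> *])
  show "flat z v z u"
    unfolding flat_def
  proof (intro exI[of _ E] conjI allI impI)
    fix t assume "t \<notin> E"
    then show "\<exists>p\<in>W. (\<forall>w\<in>W. T x p w + t * T z p w = T z u w) \<and> T z v p = 0"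
      using *[of t] unfolding 0 by (auto simp: E_def)
  qed (fact \<open>finite E\<close>)
qed

section \<open>Polarized identities on the image of N_u\<close>

lemma quartic_linear_coeff:
  fixes c1 :: 'a
  assumes "\<And>e. c1 * e + c2 * e^2 + c3 * e^3 + c4 * e^4 = 0"
  shows "c1 = 0"
proof -
  define F where "F e = c1 * e + c2 * e^2 + c3 * e^3 + c4 * e^4" for e
  \<comment> \<open>The five-point formula for the derivative at 0, exact for quartics: the
    differences remove the even terms and the weights 8 and -1 remove the cubic one.\<close>
  have "12 * c1 = 8 * (F 1 - F (-1)) - (F 2 - F (-2))"
    by (simp add: F_def)
  also have "\<dots> = 0"
    using assms by (simp add: F_def[symmetric])
  finally have "12 * c1 = 0" .
  then show ?thesis
    by simp
qed

text \<open>Three successive coefficients of the expansion, with N_z u rewritten as N_u z. The first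
  leads to \<open>image_K\<close>, the second to \<open>image_square\<close> and the third to
  \<open>image_cube\<close>.\<close>

lemma rep_K:
  assumes z: "z \<in> W" and u: "u \<in> K" and v: "v \<in> K"
  shows "T v z (rep u z) = 0"
    "T v z (rep z (rep u z)) = 0"
    "T v z (rep z (rep z (rep u z))) = 0"
proof -
  note f0 = polar_on_K(2)[OF assms]
  note f1 = flat_rep(2)[OF f0]
  note f2 = flat_rep(2)[OF f1]
  show "T v z (rep u z) = 0"
    "T v z (rep z (rep u z)) = 0"
    "T v z (rep z (rep z (rep u z))) = 0"
    using flat_rep(1)[OF f0] flat_rep(1)[OF f1] flat_rep(1)[OF f2]
    by (simp_all add: T_sym12[of v] rep_sym[of u])
qed

text \<open>Polarization in z of T(v, z, N_u z) = 0. The second cross term T(v, y, N_u z) is the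
  inner product under T(x, _, _) of N_v y and N_u z, and so equals T(u, z, N_v y).\<close>

lemma rep_K_anticommute:
  assumes "z \<in> W" "y \<in> W" "u \<in> K" "v \<in> K"
  shows "T v z (rep u y) = - T u z (rep v y)"
proof -
  have "T v (z + y) (rep u (z + y)) = 0" "T v z (rep u z) = 0" "T v y (rep u y) = 0"
    using assms by (auto intro: rep_K W_closed)
  then have "T v z (rep u y) + T v y (rep u z) = 0"
    by (simp add: rep_add2 T_linear add.commute)
  moreover have "T v y (rep u z) = T u z (rep v y)"
    using rep(2)[OF rep(1), of v y u z] rep(2)[OF rep(1), of u z v y] T_sym23[of x "rep v y"] by simp
  ultimately show ?thesis
    by (simp add: eq_neg_iff_add_eq_0)
qed

text \<open>The case v = u of anticommutation, where 2 is invertible. In operator form, N_u squares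
  to zero on \<open>W\<close>.\<close>

lemma rep_K_square: "z \<in> W \<Longrightarrow> y \<in> W \<Longrightarrow> u \<in> K \<Longrightarrow> T u z (rep u y) = 0"
  using rep_K_anticommute[of z y u u] by simp

text \<open>Anticommutation exchanges the roles of \<open>u\<close> and \<open>v\<close> and leaves
  T(u, N_v y, N_u z), which vanishes because N_u squares to zero.\<close>

lemma image_K:
  assumes "z \<in> W" "y \<in> W" "u \<in> K" "v \<in> K"
  shows "T (rep u z) (rep u y) v = 0"
proof -
  have "T v (rep u z) (rep u y) = - T u (rep u z) (rep v y)"
    using assms rep(1) by (intro rep_K_anticommute) auto
  also have "T u (rep u z) (rep v y) = T u (rep v y) (rep u z)"
    by (rule T_sym23)
  also have "\<dots> = 0"
    using assms rep(1) by (intro rep_K_square) auto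
  finally show ?thesis
    using T_sym12[of v] T_sym23[of _ v] by simp
qed

text \<open>In operator form N_a a = -2 N_u N_z a. The second identity of \<open>rep_K\<close>
  amounts to T(y, N_u y, N_u y) = 0, and the claim is its linear coefficient at y = z in the
  direction \<open>r\<close>.\<close>

lemma image_square:
  assumes z: "z \<in> W" and u: "u \<in> K" and r: "r \<in> W"
  defines "a \<equiv> rep u z"
  shows "T a a r = - 2 * T u (rep z a) r"
proof -
  have cubic: "T y (rep u y) (rep u y) = 0" if "y \<in> W" for y
  proof -
    have "T y (rep u y) (rep u y) = T x (rep y (rep u y)) (rep u y)"
      by (simp add: rep(2)[OF rep(1)])
    also have "\<dots> = T u y (rep y (rep u y))"
      using rep(2)[OF rep(1), of u y y "rep u y"] T_sym23[of x "rep u y"] by simp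
    also have "\<dots> = 0"
      using rep_K(2)[OF that u u] .
    finally show ?thesis .
  qed
  define a' where "a' = rep u r"
  have "T r a a + 2 * T z a a' = 0"
  proof (rule quartic_linear_coeff[where ?c4.0 = 0])
    fix e
    have "T (z + e *s r) (a + e *s a') (a + e *s a') = 0"
      using cubic[of "z + e *s r"] z r by (simp add: W_closed a_def a'_def rep_add2 rep_scale2)
    moreover have "T z a a = 0"
      using cubic[OF z] by (simp add: a_def)
    ultimately show "(T r a a + 2 * T z a a') * e + (2 * T r a a' + T z a' a') * e^2
        + T r a' a' * e^3 + 0 * e^4 = 0"
      using T_sym23[of z a' a] T_sym23[of r a' a]
      by (simp add: T_linear algebra_simps power2_eq_square power3_eq_cube)
  qed
  moreover have "T z a a' = T u (rep z a) r"
  proof -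
    have "T z a a' = T x (rep z a) a'"
      by (simp add: rep(2) rep(1) a'_def)
    also have "\<dots> = T u r (rep z a)"
      using rep(2)[OF rep(1), of u r z a] T_sym23[of x "rep z a"] by (simp add: a'_def)
    finally show ?thesis
      by (simp add: T_sym23)
  qed
  moreover have "T r a a = T a a r"
    by (metis T_sym12 T_sym23)
  ultimately show ?thesis
    by (simp add: eq_neg_iff_add_eq_0)
qed

text \<open>The third identity of \<open>rep_K\<close> says that N_y N_u y is isotropic for T(x, _,
  _). Its linear coefficient at y = z gives N_a s = -N_u N_z s for s = N_z a, and the pairing with
  N_u r vanishes because N_u squares to zero.\<close>

lemma image_cube:
  assumes z: "z \<in> W" and u: "u \<in> K" and r: "r \<in> W"
  defines "a \<equiv> rep u z"
  shows "T a (rep z a) (rep u r) = 0"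
proof -
  have quartic: "T x (rep y (rep u y)) (rep y (rep u y)) = 0" if "y \<in> W" for y
  proof -
    have "T x (rep y (rep u y)) (rep y (rep u y)) = T y (rep u y) (rep y (rep u y))"
      by (simp add: rep(2)[OF rep(1)])
    also have "\<dots> = T y (rep y (rep u y)) (rep u y)"
      by (rule T_sym23)
    also have "\<dots> = T x (rep y (rep y (rep u y))) (rep u y)"
      by (simp add: rep(2)[OF rep(1)])
    also have "\<dots> = T u y (rep y (rep y (rep u y)))"
      using rep(2)[OF rep(1), of u y y "rep y (rep u y)"] T_sym23[of x "rep u y"] by simp
    also have "\<dots> = 0"
      using rep_K(3)[OF that u u] .
    finally show ?thesis .
  qed
  define s where "s = rep z a"
  have linear: "T a s y + T u (rep z s) y = 0" if y: "y \<in> W" for y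
  proof -
    define a' where "a' = rep u y"
    define s1 where "s1 = rep y a + rep z a'"
    define s2 where "s2 = rep y a'"
    have "2 * T x s s1 = 0"
    proof (rule quartic_linear_coeff)
      fix e
      have "rep (z + e *s y) (a + e *s a') = s + e *s s1 + e^2 *s s2"
        by (simp add: s_def s1_def s2_def rep_add1 rep_add2 rep_scale1 rep_scale2 scale_right_distrib power2_eq_square)
      moreover have "rep u (z + e *s y) = a + e *s a'"
        by (simp add: a_def a'_def rep_add2 rep_scale2)
      ultimately have "T x (s + e *s s1 + e^2 *s s2) (s + e *s s1 + e^2 *s s2) = 0"
        using quartic[of "z + e *s y"] z y by (simp add: W_closed)
      moreover have "T x s s = 0"
        using quartic[OF z] by (simp add: s_def a_def)
      ultimately show "2 * T x s s1 * e + (2 * T x s s2 + T x s1 s1) * e^2 + 2 * T x s1 s2 * e^3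
          + T x s2 s2 * e^4 = 0"
        using T_sym23[of x s1 s] T_sym23[of x s2 s] T_sym23[of x s2 s1]
        by (simp add: T_linear algebra_simps power2_eq_square power3_eq_cube power4_eq_xxxx)
    qed
    moreover have "T x s (rep y a) = T a s y"
    proof -
      have "T x s (rep y a) = T x (rep y a) s"
        by (rule T_sym23)
      also have "\<dots> = T y a s"
        by (simp add: rep(2) rep(1) s_def)
      finally show ?thesis
        by (metis T_sym12 T_sym23)
    qed
    moreover have "T x s (rep z a') = T u (rep z s) y"
    proof -
      have "T x s (rep z a') = T x (rep z a') s"
        by (rule T_sym23)
      also have "\<dots> = T z a' s"
        by (simp add: rep(2) rep(1) s_def)
      also have "\<dots> = T z s a'"
        by (rule T_sym23)
      also have "\<dots> = T x (rep z s) a'"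
        by (simp add: rep(2) rep(1) a'_def)
      also have "\<dots> = T x a' (rep z s)"
        by (rule T_sym23)
      also have "\<dots> = T u y (rep z s)"
        by (simp add: rep(2) rep(1) a'_def)
      finally show ?thesis
        by (simp add: T_sym23)
    qed
    ultimately have "2 * (T a s y + T u (rep z s) y) = 0"
      by (simp add: s1_def T_add3)
    then show ?thesis
      by (metis mult_eq_0_iff zero_neq_numeral)
  qed
  have "rep u (- rep z s) = rep a s"
  proof (rule rep_unique)
    fix w assume "w \<in> W"
    then show "T x (rep a s) w = T u (- rep z s) w"
      using linear[of w] by (simp add: rep(2) T_minus eq_neg_iff_add_eq_0)
  qed (rule rep(1))
  then have "T u r (rep a s) = 0"
    using rep_K_square[of r "- rep z s" u] r u rep(1) by (metis W_closed(4))
  moreover have "T u r (rep a s) = T a s (rep u r)"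
    using rep(2)[OF rep(1), of u r a s] rep(2)[OF rep(1), of a s u r] T_sym23[of x "rep a s"] by simp
  ultimately show ?thesis
    by (simp add: s_def)
qed

lemma rep_sum2: "rep e (\<Sum>i\<in>I. c i *s f i) = (\<Sum>i\<in>I. c i *s rep e (f i))"
proof (induction I rule: infinite_finite_induct)
  case (insert i I)
  then show ?case
    by (simp add: rep_add2 rep_scale2)
qed (use rep_scale2[of e 0 0] in simp_all)

text \<open>Polarizing \<open>image_square\<close> shows that the image of N_u is closed under the
  product sending (a, y) to N_a y.\<close>

lemma image_mult:
  assumes "z \<in> W" "r \<in> W" "u \<in> K"
  shows "rep (rep u z) (rep u r) = rep u (- (rep z (rep u r) + rep r (rep u z)))"
proof (rule rep_unique[OF rep(1)])
  fix w assume w: "w \<in> W"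
  define a y where "a = rep u z" and "y = rep u r"
  have "T (a + y) (a + y) w = - 2 * T u (rep (z + r) (a + y)) w"
    using image_square[of "z + r" u w] assms w by (simp add: a_def y_def rep_add2 W_closed)
  moreover have "T a a w = - 2 * T u (rep z a) w" "T y y w = - 2 * T u (rep r y) w"
    using image_square assms w by (auto simp: a_def y_def)
  ultimately have "2 * T a y w = 2 * T u (- (rep z y + rep r a)) w"
    using T_sym12[of y a w] by (simp add: T_linear rep_add1 rep_add2 algebra_simps)
  then have "T a y w = T u (- (rep z y + rep r a)) w"
    by simp
  then show "T x (rep u (- (rep z (rep u r) + rep r (rep u z)))) w = T (rep u z) (rep u r) w"
    using w by (simp add: rep(2) a_def y_def)
qed

lemma K_vanishes_on_W:
  assumes u: "u \<in> K" and z: "z \<in> W"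
  shows "T u z v = 0"
proof -
  define I where "I = rep u ` W"
  have subspace_I: "subspace I"
    unfolding subspace_def I_def
  proof (intro conjI ballI allI)
    show "0 \<in> rep u ` W"
      using rep_scale2[of u 0 0] W_closed(1) by (auto intro!: image_eqI[of _ _ 0])
  next
    fix y y' assume "y \<in> rep u ` W" "y' \<in> rep u ` W"
    then show "y + y' \<in> rep u ` W"
      by (auto simp: rep_add2[symmetric] W_closed)
  next
    fix c y assume "y \<in> rep u ` W"
    then show "c *s y \<in> rep u ` W"
      by (auto simp: rep_scale2[symmetric] W_closed)
  qed
  have "I \<subseteq> W"
    by (auto simp: I_def rep(1))
  moreover have "W \<subseteq> span (b ` {..<m})"
    unfolding W_def by (auto simp: sum_in_span_image)
  ultimately have "I \<subseteq> span (b ` {..<m})"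
    by blast
  then have "\<exists>l g. (\<forall>c. (\<Sum>i<l. c i *s g i) = 0 \<longrightarrow> (\<forall>i<l. c i = 0)) \<and>
      I = range (\<lambda>c. \<Sum>i<(l::nat). c i *s g i)"
    by (rule subspace_finite_basis[OF subspace_I]) simp
  then obtain l :: nat and g where
    "(\<forall>c. (\<Sum>i<l. c i *s g i) = 0 \<longrightarrow> (\<forall>i<l. c i = 0)) \<and> I = range (\<lambda>c. \<Sum>i<l. c i *s g i)"
    by (elim exE) (rule that)
  note g = this[THEN conjunct1, THEN spec, THEN mp] this[THEN conjunct2]
  have "y = 0" if "y \<in> I" for y
  proof (rule ccontr)
    assume "y \<noteq> 0"
    obtain a where a: "a \<in> I" "\<And>y. y \<in> I \<Longrightarrow> y \<noteq> 0 \<Longrightarrow> \<exists>v. T a y v \<noteq> 0"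
      using nondegenerate_square[where m = l and b = g, OF g(1), folded g(2)] nonzero \<open>I \<subseteq> W\<close> by blast
    obtain r where r: "r \<in> W" "a = rep u r"
      using a(1) by (auto simp: I_def)
    \<comment> \<open>By \<open>image_K\<close> the functional T(a, y, _) vanishes on
      \<open>K\<close> in any case, so N_a y = 0 makes it vanish everywhere, against the choice of
      \<open>a\<close>.\<close>
    have inj: "y = 0" if y: "y \<in> I" "rep a y = 0" for y
    proof (rule ccontr)
      assume "y \<noteq> 0"
      then obtain v where v: "T a y v \<noteq> 0"
        using a(2) y(1) by blast
      obtain p where p: "p \<in> W" "v - p \<in> K"
        by (rule complement)
      have "T a y (v - p) = 0"
        using y(1) image_K[OF r(1) _ u p(2)] by (auto simp: I_def r(2))
      moreover have "T a y p = 0"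
        using rep(2)[OF p(1), of a y] y(2) by simp
      ultimately show False
        using v by (simp add: T_diff)
    qed
    \<comment> \<open>As a = N_u r, \<open>image_cube\<close> taken at z = r states that
      \<open>s\<close> is orthogonal to N_a I.\<close>
    define s where "s = rep r a"
    have "s \<in> W"
      by (simp add: s_def rep)
    have s: "T x (rep a y) s = 0" if "y \<in> I" for y
    proof -
      have "T x (rep a y) s = T a s y"
        using rep(2)[OF \<open>s \<in> W\<close>, of a y] T_sym23[of a y s] by simp
      also have "\<dots> = 0"
        using that image_cube[OF r(1) u] by (auto simp: I_def s_def r(2))
      finally show ?thesis .
    qed
    have "T x c s = 0" if c: "c \<in> I" for c
    proof -
      \<comment> \<open>Surjectivity of N_a on \<open>I\<close> by counting: these l + 1 vectors lie
        in a space spanned by l, and a relation must involve \<open>c\<close> because N_a is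
        injective on \<open>I\<close>.\<close>
      define h where "h k = (if k < l then rep a (g k) else c)" for k
      have gI: "g k \<in> I" if "k < l" for k
      proof -
        have "g k = (\<Sum>i<l. (if i = k then 1 else 0) *s g i)"
          using that by (simp add: if_distrib[of "\<lambda>c. c *s g _"] cong: if_cong)
        then show ?thesis
          unfolding g(2) by (intro image_eqI[of _ _ "\<lambda>i. if i = k then 1 else 0"]) auto
      qed
      have "h k \<in> span (g ` {..<l})" for k
      proof -
        have "rep a y \<in> I" if "y \<in> I" for y
          using that image_mult[OF r(1) _ u] rep(1) r(2) by (auto simp: I_def W_closed)
        then have "h k \<in> I"
          using gI c by (auto simp: h_def)
        then show ?thesis
          unfolding g(2) by (auto simp: sum_in_span_image)
      qed
      moreover have "card (g ` {..<l}) < card {..l}"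
        using card_image_le[of "{..<l}" g] by simp
      ultimately obtain e where e: "\<exists>k\<in>{..l}. e k \<noteq> 0" "(\<Sum>k\<in>{..l}. e k *s h k) = 0"
        using nontrivial_relation[of "{..l}" "g ` {..<l}" h] by auto
      define y where "y = (\<Sum>k<l. e k *s g k)"
      have "y \<in> I"
        unfolding g(2) y_def by (intro image_eqI[of _ _ e]) auto
      have rel: "rep a y + e l *s c = 0"
        using e(2) by (simp add: lessThan_Suc_atMost[symmetric] h_def y_def rep_sum2)
      have "e l \<noteq> 0"
      proof
        assume "e l = 0"
        then have "y = 0"
          using rel inj \<open>y \<in> I\<close> by simp
        then have "\<forall>k<l. e k = 0"
          unfolding y_def by (rule g(1))
        then show False
          using e(1) \<open>e l = 0\<close> by (auto simp: le_less)
      qed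
      moreover have "T x (rep a y) s + e l * T x c s = 0"
        using arg_cong[OF rel, of "\<lambda>y. T x y s"] by (simp add: T_linear)
      ultimately show ?thesis
        using s[OF \<open>y \<in> I\<close>] by simp
    qed
    then have "T u w s = 0" if "w \<in> W" for w
      using that rep(2)[OF \<open>s \<in> W\<close>, of u w] by (auto simp: I_def)
    then have "T a a w = 0" if "w \<in> W" for w
      using image_square[OF r(1) u that] that T_sym23[of u s w] by (simp add: s_def r(2))
    moreover have "T a a k = 0" if "k \<in> K" for k
      using image_K[OF r(1) r(1) u that] by (simp add: r(2))
    ultimately have "T a a v = 0" for v
      using complement[of v] T_add3[of a a] by (metis add.right_neutral diff_add_cancel)
    then have "a = 0"
      using nonzero[of a] a(1) \<open>I \<subseteq> W\<close> by blast
    then show False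
      using a(2)[OF that \<open>y \<noteq> 0\<close>] by simp
  qed
  then have "rep u z = 0"
    using z by (auto simp: I_def)
  obtain p where p: "p \<in> W" "v - p \<in> K"
    by (rule complement)
  have "T u z p = 0"
    using rep(2)[OF p(1), of u z] \<open>rep u z = 0\<close> by simp
  moreover have "T u z (v - p) = 0"
    using polar_on_K(1)[OF z u p(2)] T_sym12[of u z] by simp
  ultimately show ?thesis
    by (simp add: T_diff)
qed

end

section \<open>Cubic forms as trilinear forms\<close>

abbreviation Const :: "'a::comm_ring_1 \<Rightarrow> 'a mpoly" where
  "Const c \<equiv> Poly_Mapping.single 0 c"

abbreviation expo :: "nat \<Rightarrow> nat \<Rightarrow>\<^sub>0 nat" where
  "expo i \<equiv> Poly_Mapping.single i (Suc 0)"

abbreviation X :: "nat \<Rightarrow> 'a::comm_ring_1 mpoly" where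
  "X i \<equiv> Poly_Mapping.single (expo i) 1"

lemma keys_sum_add:
  fixes p q :: "'b \<Rightarrow>\<^sub>0 'a::comm_monoid_add"
  assumes "\<And>m. g m 0 = 0" "\<And>m a b. g m (a + b) = g m a + g m b"
  shows "(\<Sum>m\<in>Poly_Mapping.keys (p + q). g m (Poly_Mapping.lookup (p + q) m)) =
    (\<Sum>m\<in>Poly_Mapping.keys p. g m (Poly_Mapping.lookup p m)) +
    (\<Sum>m\<in>Poly_Mapping.keys q. g m (Poly_Mapping.lookup q m))"
  using assms by (intro setsum_keys_plus_distrib) auto

lemma eval_mpoly_add: "eval_mpoly x (p + q) = eval_mpoly x p + eval_mpoly x q"
  unfolding eval_mpoly_def by (rule keys_sum_add) (auto simp: distrib_right)

lemma subst_mpoly_add: "subst_mpoly l (p + q) = subst_mpoly l p + subst_mpoly l q"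
  unfolding subst_mpoly_def by (rule keys_sum_add) (auto simp: distrib_right single_add)

lemma partial_add: "partial i (p + q) = partial i p + partial i q"
  unfolding partial_def by (rule keys_sum_add) (auto simp: distrib_left single_add)

lemma mpoly_zero [simp]: "eval_mpoly x 0 = 0" "subst_mpoly l 0 = 0" "partial i 0 = 0"
  by (simp_all add: eval_mpoly_def subst_mpoly_def partial_def)

lemma eval_mpoly_sum: "eval_mpoly x (\<Sum>i\<in>I. p i) = (\<Sum>i\<in>I. eval_mpoly x (p i))"
  by (induction I rule: infinite_finite_induct) (auto simp: eval_mpoly_add)

lemma subst_mpoly_sum: "subst_mpoly l (\<Sum>i\<in>I. p i) = (\<Sum>i\<in>I. subst_mpoly l (p i))"
  by (induction I rule: infinite_finite_induct) (auto simp: subst_mpoly_add)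

lemma partial_sum: "partial j (\<Sum>i\<in>I. p i) = (\<Sum>i\<in>I. partial j (p i))"
  by (induction I rule: infinite_finite_induct) (auto simp: partial_add)

definition mpow :: "(nat \<Rightarrow> 'b) \<Rightarrow> (nat \<Rightarrow>\<^sub>0 nat) \<Rightarrow> 'b::comm_monoid_mult" where
  "mpow x m = (\<Prod>i\<in>Poly_Mapping.keys m. x i ^ Poly_Mapping.lookup m i)"

lemma mpow_superset:
  assumes "finite I" "Poly_Mapping.keys m \<subseteq> I"
  shows "mpow x m = (\<Prod>i\<in>I. x i ^ Poly_Mapping.lookup m i)"
  unfolding mpow_def using assms by (intro prod.mono_neutral_left) (auto simp: in_keys_iff)

lemma mpow_add: "mpow x (m + m') = mpow x m * mpow x m'"
proof -
  let ?I = "Poly_Mapping.keys m \<union> Poly_Mapping.keys m'"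
  have "mpow x (m + m') = (\<Prod>i\<in>?I. x i ^ Poly_Mapping.lookup (m + m') i)"
    using Poly_Mapping.keys_add[of m m'] by (intro mpow_superset) auto
  also have "\<dots> = (\<Prod>i\<in>?I. x i ^ Poly_Mapping.lookup m i) * (\<Prod>i\<in>?I. x i ^ Poly_Mapping.lookup m' i)"
    by (simp add: lookup_add power_add prod.distrib)
  also have "\<dots> = mpow x m * mpow x m'"
    by (simp add: mpow_superset[of ?I])
  finally show ?thesis .
qed

lemma mpow_single [simp]: "mpow x (expo i) = x i" "mpow x 0 = 1"
  by (simp_all add: mpow_def)

lemma eval_mpoly_single: "eval_mpoly x (Poly_Mapping.single m c) = c * mpow x m"
  by (simp add: eval_mpoly_def mpow_def)

lemma subst_mpoly_single: "subst_mpoly l (Poly_Mapping.single m c) = Const c * mpow l m"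
  by (simp add: subst_mpoly_def mpow_def)

lemma partial_single:
  "partial i (Poly_Mapping.single m c) =
    Poly_Mapping.single (m - expo i) (of_nat (Poly_Mapping.lookup m i) * c)"
  by (simp add: partial_def)

text \<open>The Leibniz rule for multiplication by a variable. Truncated subtraction of exponents is
  settled here by cases, and the derivatives of cubics follow by peeling off variables.\<close>

lemma partial_expo_add:
  "partial i (Poly_Mapping.single (expo a + m) c) =
    (if a = i then Poly_Mapping.single m c else 0) + X a * partial i (Poly_Mapping.single m c)"
proof (cases "a = i")
  case True
  show ?thesis
  proof (cases "Poly_Mapping.lookup m i = 0")
    case True
    with \<open>a = i\<close> show ?thesis
      by (simp add: mult_single partial_single lookup_add)
  next
    case False
    then have "expo i + (m - expo i) = m"
      by (intro poly_mapping_eqI) (auto simp: lookup_add lookup_minus lookup_single when_def)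
    with \<open>a = i\<close> show ?thesis
      by (simp add: mult_single partial_single lookup_add distrib_right single_add)
  qed
next
  case False
  then have "expo a + m - expo i = expo a + (m - expo i)"
    by (intro poly_mapping_eqI) (auto simp: lookup_add lookup_minus lookup_single when_def)
  with False show ?thesis
    by (simp add: mult_single partial_single lookup_add lookup_single when_def)
qed

lemma partial_expo:
  "partial i (Poly_Mapping.single (expo a) c) = (if a = i then Const c else 0)"
  using partial_expo_add[of i a 0 c] by (simp add: partial_single)

text \<open>The tensor \<open>t\<close> may be asymmetric. With \<open>X\<close> for
  \<open>l\<close> this is a polynomial in the variables, and any other \<open>l\<close> gives its
  substitution, so changes of coordinates act on \<open>t\<close> alone.\<close>

definition cubic :: "nat set \<Rightarrow> (nat \<Rightarrow> nat \<Rightarrow> nat \<Rightarrow> 'a::comm_ring_1) \<Rightarrow> (nat \<Rightarrow> 'a mpoly) \<Rightarrow> 'a mpoly" where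
  "cubic I t l = (\<Sum>i\<in>I. \<Sum>j\<in>I. \<Sum>k\<in>I. Const (t i j k) * (l i * (l j * l k)))"

lemma X3: "Const c * (X i * (X j * X k)) =
  Poly_Mapping.single (expo i + (expo j + expo k)) c"
  by (simp add: mult_single)

lemma subst_cubic: "subst_mpoly l (cubic I t X) = cubic I t l"
  unfolding cubic_def subst_mpoly_sum X3 subst_mpoly_single by (simp add: mpow_add)

lemma eval_cubic: "eval_mpoly x (cubic I t X) = (\<Sum>i\<in>I. \<Sum>j\<in>I. \<Sum>k\<in>I. t i j k * (x i * (x j * x k)))"
  unfolding cubic_def eval_mpoly_sum X3 eval_mpoly_single by (simp add: mpow_add)

lemma partial_X2:
  "partial i (Poly_Mapping.single (expo b + expo c) t) =
    (if b = i then Poly_Mapping.single (expo c) t else 0) +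
    (if c = i then Poly_Mapping.single (expo b) t else 0)"
  by (simp add: partial_expo_add partial_expo mult_single)

lemma partial_X3:
  "partial i (Const t * (X a * (X b * X c))) =
    (if a = i then Poly_Mapping.single (expo b + expo c) t else 0) +
    (if b = i then Poly_Mapping.single (expo a + expo c) t else 0) +
    (if c = i then Poly_Mapping.single (expo a + expo b) t else 0)"
  unfolding X3 partial_expo_add[of _ a] partial_X2 by (simp add: distrib_left mult_single)

lemma eval_partial_cubic:
  assumes "finite I" "i \<in> I"
  shows "eval_mpoly x (partial i (cubic I t X)) =
    (\<Sum>j\<in>I. \<Sum>k\<in>I. (t i j k + t j i k + t j k i) * (x j * x k))"
proof -
  have "eval_mpoly x (partial i (cubic I t X)) =
    (\<Sum>a\<in>I. \<Sum>b\<in>I. \<Sum>c\<in>I. (if a = i then t a b c * (x b * x c) else 0) +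
      (if b = i then t a b c * (x a * x c) else 0) + (if c = i then t a b c * (x a * x b) else 0))"
    unfolding cubic_def partial_sum eval_mpoly_sum partial_X3 eval_mpoly_add
    by (intro sum.cong) (auto simp: eval_mpoly_single mpow_add)
  also have "\<dots> = (\<Sum>j\<in>I. \<Sum>k\<in>I. t i j k * (x j * x k)) + (\<Sum>j\<in>I. \<Sum>k\<in>I. t j i k * (x j * x k)) +
      (\<Sum>j\<in>I. \<Sum>k\<in>I. t j k i * (x j * x k))"
  proof -
    have "(\<Sum>a\<in>I. \<Sum>b\<in>I. \<Sum>c\<in>I. if a = i then t a b c * (x b * x c) else 0) =
        (\<Sum>a\<in>I. if a = i then \<Sum>b\<in>I. \<Sum>c\<in>I. t a b c * (x b * x c) else 0)"
      by (intro sum.cong) auto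
    moreover have "(\<Sum>a\<in>I. \<Sum>b\<in>I. \<Sum>c\<in>I. if b = i then t a b c * (x a * x c) else 0) =
        (\<Sum>a\<in>I. \<Sum>b\<in>I. if b = i then \<Sum>c\<in>I. t a b c * (x a * x c) else 0)"
      by (intro sum.cong) auto
    ultimately show ?thesis
      using assms by (simp add: sum.distrib)
  qed
  also have "\<dots> = (\<Sum>j\<in>I. \<Sum>k\<in>I. (t i j k + t j i k + t j k i) * (x j * x k))"
    by (simp add: sum.distrib distrib_right)
  finally show ?thesis .
qed

lemma eval_mpoly_double: "eval_mpoly x (2 * p) = 2 * eval_mpoly x p"
  by (simp only: mult_2 eval_mpoly_add)

text \<open>Six terms arise from choosing, in order, which two of the three factors are
  differentiated. In each of them the conditions on the indices are moved outwards until they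
  collapse two of the three sums.\<close>

lemma eval_partial2_cubic:
  assumes "finite I" "i \<in> I" "j \<in> I"
  shows "eval_mpoly x (partial i (partial j (cubic I t X))) =
    (\<Sum>k\<in>I. (t i j k + t j i k + t i k j + t j k i + t k i j + t k j i) * x k)"
proof -
  define s where "s i j k = t i j k + t j i k + t i k j + t j k i + t k i j + t k j i" for i j k
  have "eval_mpoly x (partial i (partial j (cubic I t X))) =
    (\<Sum>a\<in>I. \<Sum>b\<in>I. \<Sum>c\<in>I. t a b c * (
      (if a = j then (if b = i then x c else 0) + (if c = i then x b else 0) else 0) +
      (if b = j then (if a = i then x c else 0) + (if c = i then x a else 0) else 0) +
      (if c = j then (if a = i then x b else 0) + (if b = i then x a else 0) else 0)))"
    unfolding cubic_def partial_sum eval_mpoly_sum partial_X3 partial_add eval_mpoly_add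
    by (intro sum.cong refl) (auto simp: partial_X2 eval_mpoly_single eval_mpoly_add eval_mpoly_double mpow_add distrib_left)
  also have "\<dots> = (\<Sum>a\<in>I. \<Sum>b\<in>I. \<Sum>c\<in>I.
      (if a = j then if b = i then t a b c * x c else 0 else 0) +
      (if a = j then if c = i then t a b c * x b else 0 else 0) +
      (if b = j then if a = i then t a b c * x c else 0 else 0) +
      (if b = j then if c = i then t a b c * x a else 0 else 0) +
      (if c = j then if a = i then t a b c * x b else 0 else 0) +
      (if c = j then if b = i then t a b c * x a else 0 else 0))"
    by (intro sum.cong refl) (simp add: distrib_left)
  also have "\<dots> =
      (\<Sum>a\<in>I. \<Sum>b\<in>I. \<Sum>c\<in>I. if a = j then if b = i then t a b c * x c else 0 else 0) +
      (\<Sum>a\<in>I. \<Sum>b\<in>I. \<Sum>c\<in>I. if a = j then if c = i then t a b c * x b else 0 else 0) +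
      (\<Sum>a\<in>I. \<Sum>b\<in>I. \<Sum>c\<in>I. if b = j then if a = i then t a b c * x c else 0 else 0) +
      (\<Sum>a\<in>I. \<Sum>b\<in>I. \<Sum>c\<in>I. if b = j then if c = i then t a b c * x a else 0 else 0) +
      (\<Sum>a\<in>I. \<Sum>b\<in>I. \<Sum>c\<in>I. if c = j then if a = i then t a b c * x b else 0 else 0) +
      (\<Sum>a\<in>I. \<Sum>b\<in>I. \<Sum>c\<in>I. if c = j then if b = i then t a b c * x a else 0 else 0)"
    by (simp only: sum.distrib)
  also have "(\<Sum>a\<in>I. \<Sum>b\<in>I. \<Sum>c\<in>I. if a = j then if b = i then t a b c * x c else 0 else 0) =
      (\<Sum>a\<in>I. if a = j then \<Sum>b\<in>I. if b = i then \<Sum>c\<in>I. t a b c * x c else 0 else 0)"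
    by (intro sum.cong) (auto intro!: sum.cong)
  also have "\<dots> = (\<Sum>k\<in>I. t j i k * x k)"
    using assms by simp
  also have "(\<Sum>a\<in>I. \<Sum>b\<in>I. \<Sum>c\<in>I. if a = j then if c = i then t a b c * x b else 0 else 0) =
      (\<Sum>a\<in>I. if a = j then \<Sum>b\<in>I. \<Sum>c\<in>I. if c = i then t a b c * x b else 0 else 0)"
    by (intro sum.cong) auto
  also have "\<dots> = (\<Sum>k\<in>I. t j k i * x k)"
    using assms by simp
  also have "(\<Sum>a\<in>I. \<Sum>b\<in>I. \<Sum>c\<in>I. if b = j then if a = i then t a b c * x c else 0 else 0) =
      (\<Sum>a\<in>I. if a = i then \<Sum>b\<in>I. if b = j then \<Sum>c\<in>I. t a b c * x c else 0 else 0)"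
    by (intro sum.cong) (auto intro!: sum.cong)
  also have "\<dots> = (\<Sum>k\<in>I. t i j k * x k)"
    using assms by simp
  also have "(\<Sum>a\<in>I. \<Sum>b\<in>I. \<Sum>c\<in>I. if b = j then if c = i then t a b c * x a else 0 else 0) =
      (\<Sum>a\<in>I. \<Sum>b\<in>I. if b = j then \<Sum>c\<in>I. if c = i then t a b c * x a else 0 else 0)"
    by (intro sum.cong) auto
  also have "\<dots> = (\<Sum>k\<in>I. t k j i * x k)"
    using assms by simp
  also have "(\<Sum>a\<in>I. \<Sum>b\<in>I. \<Sum>c\<in>I. if c = j then if a = i then t a b c * x b else 0 else 0) =
      (\<Sum>a\<in>I. if a = i then \<Sum>b\<in>I. \<Sum>c\<in>I. if c = j then t a b c * x b else 0 else 0)"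
    by (intro sum.cong) (auto intro!: sum.cong)
  also have "\<dots> = (\<Sum>k\<in>I. t i k j * x k)"
    using assms by simp
  also have "(\<Sum>a\<in>I. \<Sum>b\<in>I. \<Sum>c\<in>I. if c = j then if b = i then t a b c * x a else 0 else 0) =
      (\<Sum>a\<in>I. \<Sum>b\<in>I. if b = i then \<Sum>c\<in>I. if c = j then t a b c * x a else 0 else 0)"
    by (intro sum.cong) (auto intro!: sum.cong)
  also have "\<dots> = (\<Sum>k\<in>I. t k i j * x k)"
    using assms by simp
  finally show ?thesis
    by (simp add: distrib_right sum.distrib add_ac)
qed

lemma cubic_swap12: "cubic I t l = cubic I (\<lambda>i j k. t j i k) l"
  unfolding cubic_def by (subst sum.swap) (simp add: mult.left_commute)

lemma cubic_swap23: "cubic I t l = cubic I (\<lambda>i j k. t i k j) l"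
  unfolding cubic_def by (rule sum.cong[OF refl], subst sum.swap) (simp add: mult.commute)

lemma cubic_add: "cubic I (\<lambda>i j k. s i j k + t i j k) l = cubic I s l + cubic I t l"
  by (simp add: cubic_def single_add distrib_right sum.distrib)

lemma cubic_scale: "cubic I (\<lambda>i j k. c * t i j k) l = Const c * cubic I t l"
  by (simp add: cubic_def sum_distrib_left mult.assoc[symmetric] mult_single)

text \<open>Averaging the tensor over the six permutations of its indices leaves the cubic
  unchanged; this requires 6 to be invertible.\<close>

lemma cubic_symmetric:
  fixes t :: "nat \<Rightarrow> nat \<Rightarrow> nat \<Rightarrow> 'a::field_char_0"
  shows "\<exists>s. cubic I s l = cubic I t l \<and>
    (\<forall>i j k. s i j k = s j i k) \<and> (\<forall>i j k. s i j k = s i k j)"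
proof -
  define r where "r i j k = t i j k + (t j i k + (t i k j + (t j k i + (t k i j + t k j i))))" for i j k
  have perms: "cubic I (\<lambda>i j k. t j i k) l = cubic I t l" "cubic I (\<lambda>i j k. t i k j) l = cubic I t l"
    "cubic I (\<lambda>i j k. t j k i) l = cubic I t l" "cubic I (\<lambda>i j k. t k i j) l = cubic I t l"
    "cubic I (\<lambda>i j k. t k j i) l = cubic I t l"
  proof -
    show 1: "cubic I (\<lambda>i j k. t j i k) l = cubic I t l"
      by (rule cubic_swap12[symmetric])
    show 2: "cubic I (\<lambda>i j k. t i k j) l = cubic I t l"
      by (rule cubic_swap23[symmetric])
    show 3: "cubic I (\<lambda>i j k. t j k i) l = cubic I t l"
      using cubic_swap12[of I "\<lambda>i j k. t i k j"] 2 by simp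
    show 4: "cubic I (\<lambda>i j k. t k i j) l = cubic I t l"
      using cubic_swap23[of I "\<lambda>i j k. t j i k"] 1 by simp
    show "cubic I (\<lambda>i j k. t k j i) l = cubic I t l"
      using cubic_swap12[of I "\<lambda>i j k. t k i j"] 4 by simp
  qed
  have "cubic I (\<lambda>i j k. inverse 6 * r i j k) l = Const (inverse 6) * (6 * cubic I t l)"
    unfolding cubic_scale r_def cubic_add perms by simp
  also have "\<dots> = Const (inverse 6) * Const 6 * cubic I t l"
    by (simp add: mult.assoc single_numeral)
  also have "Const (inverse 6) * Const 6 = Const (inverse 6 * 6 :: 'a)"
    by (simp only: mult_single add_0_left)
  also have "\<dots> = 1"
    by simp
  finally have "cubic I (\<lambda>i j k. inverse 6 * r i j k) l = cubic I t l"
    by simp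
  then show ?thesis
    by (intro exI[of _ "\<lambda>i j k. inverse 6 * r i j k"]) (simp add: r_def add_ac)
qed

section \<open>Homogeneous polynomials of degree one and three as coefficient tensors\<close>

lemma mdeg_superset:
  assumes "finite I" "Poly_Mapping.keys m \<subseteq> I"
  shows "mdeg m = (\<Sum>i\<in>I. Poly_Mapping.lookup m i)"
  unfolding mdeg_def using assms by (intro sum.mono_neutral_left) (auto simp: in_keys_iff)

lemma mdeg_add: "mdeg (m + m') = mdeg m + mdeg m'"
proof -
  let ?I = "Poly_Mapping.keys m \<union> Poly_Mapping.keys m'"
  have "mdeg (m + m') = (\<Sum>i\<in>?I. Poly_Mapping.lookup (m + m') i)"
    using Poly_Mapping.keys_add[of m m'] by (intro mdeg_superset) auto
  then show ?thesis
    by (simp add: lookup_add sum.distrib mdeg_superset[of ?I])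
qed

lemma mdeg_simps [simp]: "mdeg (expo i) = Suc 0" "mdeg 0 = 0"
  by (simp_all add: mdeg_def)

lemma mdeg_SucE:
  assumes "mdeg m = Suc d"
  obtains i m' where "i \<in> Poly_Mapping.keys m" "m = expo i + m'" "mdeg m' = d"
    "Poly_Mapping.keys m' \<subseteq> Poly_Mapping.keys m"
proof -
  have "Poly_Mapping.keys m \<noteq> {}"
    using assms by (auto simp: mdeg_def)
  then obtain i where i: "i \<in> Poly_Mapping.keys m"
    by blast
  then have m: "m = expo i + (m - expo i)"
    by (intro poly_mapping_eqI) (auto simp: lookup_add lookup_minus lookup_single when_def in_keys_iff)
  moreover have "mdeg (m - expo i) = d"
    using assms mdeg_add[of "expo i" "m - expo i"] m by simp
  moreover have "Poly_Mapping.keys (m - expo i) \<subseteq> Poly_Mapping.keys m"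
    by (auto simp: in_keys_iff lookup_minus)
  ultimately show ?thesis
    using i that by blast
qed

lemma mdeg_0D: "mdeg m = 0 \<Longrightarrow> m = 0"
  by (intro poly_mapping_eqI) (auto simp: mdeg_def in_keys_iff)

lemma zero_in_forms: "0 \<in> forms I d"
  by (simp add: forms_def)

lemma add_in_forms: "p \<in> forms I d \<Longrightarrow> q \<in> forms I d \<Longrightarrow> p + q \<in> forms I d"
  using Poly_Mapping.keys_add[of p q] unfolding forms_def by blast

lemma sum_in_forms: "(\<And>i. i \<in> A \<Longrightarrow> p i \<in> forms I d) \<Longrightarrow> (\<Sum>i\<in>A. p i) \<in> forms I d"
  by (induction A rule: infinite_finite_induct) (auto intro: add_in_forms zero_in_forms)

lemma single_in_forms:
  "Poly_Mapping.keys m \<subseteq> I \<Longrightarrow> mdeg m = d \<Longrightarrow> Poly_Mapping.single m c \<in> forms I d"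
  by (auto simp: forms_def)

lemma cubic_in_forms: "cubic I t X \<in> forms I 3"
  unfolding cubic_def X3
proof (intro sum_in_forms single_in_forms)
  fix i j k assume "i \<in> I" "j \<in> I" "k \<in> I"
  then show "Poly_Mapping.keys (expo i + (expo j + expo k)) \<subseteq> I"
    by (auto simp: in_keys_iff lookup_add lookup_single when_def split: if_splits)
  show "mdeg (expo i + (expo j + expo k)) = 3"
    by (simp add: mdeg_add)
qed

lemma linear_in_forms: "(\<Sum>i\<in>I. Const (c i) * X i) \<in> forms I 1"
  by (intro sum_in_forms) (auto simp: mult_single intro!: single_in_forms)

lemma sum_monomials: "p = (\<Sum>m\<in>Poly_Mapping.keys p. Poly_Mapping.single m (Poly_Mapping.lookup p m))"
proof (rule poly_mapping_eqI)
  fix m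
  have "(\<Sum>k\<in>Poly_Mapping.keys p. Poly_Mapping.lookup (Poly_Mapping.single k (Poly_Mapping.lookup p k)) m) =
      (\<Sum>k\<in>Poly_Mapping.keys p. if k = m then Poly_Mapping.lookup p k else 0)"
    by (intro sum.cong) (auto simp: lookup_single when_def)
  then show "Poly_Mapping.lookup p m =
      Poly_Mapping.lookup (\<Sum>m\<in>Poly_Mapping.keys p. Poly_Mapping.single m (Poly_Mapping.lookup p m)) m"
    by (simp add: lookup_sum in_keys_iff)
qed

text \<open>Each monomial is written as x_i x_j x_k in one chosen order and its whole coefficient is
  placed there, so the tensor obtained is in general not symmetric.\<close>

lemma forms_3_cubic:
  assumes "finite I" "f \<in> forms I 3"
  shows "\<exists>t. f = cubic I t X"
proof -
  have "\<exists>t. (\<Sum>m\<in>M. Poly_Mapping.single m (Poly_Mapping.lookup f m)) = cubic I t X"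
    if "finite M" "M \<subseteq> Poly_Mapping.keys f" for M
    using that
  proof (induction M)
    case empty
    have "0 = cubic I (\<lambda>_ _ _. 0) X"
      by (simp add: cubic_def)
    then show ?case
      by auto
  next
    case (insert m M)
    then obtain t where t: "(\<Sum>m\<in>M. Poly_Mapping.single m (Poly_Mapping.lookup f m)) = cubic I t X"
      by auto
    have m: "Poly_Mapping.keys m \<subseteq> I" "mdeg m = Suc (Suc (Suc 0))"
      using insert.prems assms(2) by (auto simp: forms_def numeral_3_eq_3)
    obtain i m' where i: "i \<in> I" "m = expo i + m'" "mdeg m' = Suc (Suc 0)" "Poly_Mapping.keys m' \<subseteq> I"
      using mdeg_SucE[OF m(2)] m(1) by (metis subset_trans subsetD)
    obtain j m'' where j: "j \<in> I" "m' = expo j + m''" "mdeg m'' = Suc 0" "Poly_Mapping.keys m'' \<subseteq> I"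
      using mdeg_SucE[OF i(3)] i(4) by (metis subset_trans subsetD)
    obtain k m3 where k: "k \<in> I" "m'' = expo k + m3" "mdeg m3 = 0"
      using mdeg_SucE[OF j(3)] j(4) by (metis subset_trans subsetD)
    define c where "c = Poly_Mapping.lookup f m"
    define s where "s a b d = (if a = i then if b = j then if d = k then c else 0 else 0 else 0)" for a b d
    have "cubic I s X = (\<Sum>a\<in>I. if a = i then \<Sum>b\<in>I. if b = j then \<Sum>d\<in>I. if d = k
        then Const c * (X a * (X b * X d)) else 0 else 0 else 0)"
      unfolding cubic_def by (intro sum.cong refl) (auto simp: s_def intro!: sum.cong sum.neutral)
    also have "\<dots> = Poly_Mapping.single m c"
      using assms(1) i(1,2) j(1,2) k mdeg_0D[OF k(3)] by (simp add: mult_single)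
    finally have "Poly_Mapping.single m c = cubic I s X" ..
    then have "(\<Sum>m\<in>insert m M. Poly_Mapping.single m (Poly_Mapping.lookup f m)) = cubic I (\<lambda>a b d. s a b d + t a b d) X"
      using insert.hyps t by (simp add: cubic_add c_def)
    then show ?case
      by blast
  qed
  then show ?thesis
    using sum_monomials[of f] finite_keys by (metis subset_refl)
qed

lemma forms_1_linear:
  assumes "finite I" "f \<in> forms I 1"
  shows "\<exists>c. f = (\<Sum>i\<in>I. Const (c i) * X i)"
proof -
  have "\<exists>i\<in>I. m = expo i" if "m \<in> Poly_Mapping.keys f" for m
  proof -
    have m: "Poly_Mapping.keys m \<subseteq> I" "mdeg m = Suc 0"
      using that assms(2) by (auto simp: forms_def)
    obtain i m' where "i \<in> Poly_Mapping.keys m" "m = expo i + m'" "mdeg m' = 0"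
      using mdeg_SucE[OF m(2)] by metis
    then show ?thesis
      using m(1) mdeg_0D[of m'] by auto
  qed
  then have keys: "Poly_Mapping.keys f \<subseteq> expo ` I"
    by auto
  have "inj expo"
    by (rule injI) (metis lookup_single_eq lookup_single_not_eq nat.distinct(1))
  have "f = (\<Sum>m\<in>Poly_Mapping.keys f. Poly_Mapping.single m (Poly_Mapping.lookup f m))"
    by (rule sum_monomials)
  also have "\<dots> = (\<Sum>m\<in>expo ` I. Poly_Mapping.single m (Poly_Mapping.lookup f m))"
    using keys assms(1) by (intro sum.mono_neutral_left) (auto simp: in_keys_iff)
  also have "\<dots> = (\<Sum>i\<in>I. Poly_Mapping.single (expo i) (Poly_Mapping.lookup f (expo i)))"
    using \<open>inj expo\<close> by (subst sum.reindex) (auto intro: inj_on_subset)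
  also have "\<dots> = (\<Sum>i\<in>I. Const (Poly_Mapping.lookup f (expo i)) * X i)"
    by (simp add: mult_single)
  finally show ?thesis
    by (rule exI[of _ "\<lambda>i. Poly_Mapping.lookup f (expo i)"])
qed

lemma lookup_linear:
  assumes "finite I" "j \<in> I"
  shows "Poly_Mapping.lookup (\<Sum>i\<in>I. Const (c i) * X i) (expo j) = c j"
proof -
  have "(\<Sum>i\<in>I. Poly_Mapping.lookup (Const (c i) * X i) (expo j)) = (\<Sum>i\<in>I. if i = j then c i else 0)"
  proof (intro sum.cong refl)
    fix i
    have "expo i = expo j \<longleftrightarrow> i = j"
      by (metis lookup_single_eq lookup_single_not_eq nat.distinct(1))
    then show "Poly_Mapping.lookup (Const (c i) * X i) (expo j) = (if i = j then c i else 0)"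
      by (simp add: mult_single lookup_single when_def)
  qed
  then show ?thesis
    using assms by (simp add: lookup_sum)
qed

section \<open>Coordinate vectors as functions\<close>

lemma (in vector_space) independent_family:
  assumes "\<And>c. (\<Sum>i<l. c i *s b i) = 0 \<Longrightarrow> \<forall>i<(l::nat). c i = 0"
  shows "inj_on b {..<l}" "independent (b ` {..<l})"
proof -
  show inj: "inj_on b {..<l}"
  proof (rule inj_onI, rule ccontr)
    fix i j assume ij: "i \<in> {..<l}" "j \<in> {..<l}" "b i = b j" "i \<noteq> j"
    define c where "c k = (if k = i then 1 else if k = j then -1 else 0 :: 'a)" for k
    have "(\<Sum>k<l. c k *s b k) = (\<Sum>k\<in>{i, j}. c k *s b k)"
      by (rule sum.mono_neutral_right) (use ij in \<open>auto simp: c_def\<close>)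
    also have "\<dots> = 0"
      using ij by (auto simp: c_def)
    finally have "c i = 0"
      using assms ij(1) by blast
    then show False
      by (simp add: c_def)
  qed
  show "independent (b ` {..<l})"
  proof
    assume "dependent (b ` {..<l})"
    then obtain u where u: "\<exists>v\<in>b ` {..<l}. u v \<noteq> 0" "(\<Sum>v\<in>b ` {..<l}. u v *s v) = 0"
      using dependent_finite[of "b ` {..<l}"] by auto
    have "(\<Sum>i<l. u (b i) *s b i) = 0"
      using u(2) by (simp add: sum.reindex[OF inj])
    then show False
      using assms[of "\<lambda>i. u (b i)"] u(1) by auto
  qed
qed

text \<open>Extension by zero embeds column vectors linearly into a function space, to which spans,
  independence and dimensions are transported.\<close>

definition coords :: "'a::zero vec \<Rightarrow> nat \<Rightarrow> 'a" where
  "coords v = (\<lambda>i. if i < dim_vec v then v $ i else 0)"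

lemma coords_inj: "inj_on coords (carrier_vec n)"
proof (rule inj_onI)
  fix v w :: "'a vec" assume vw: "v \<in> carrier_vec n" "w \<in> carrier_vec n" "coords v = coords w"
  have "v $ i = w $ i" if "i < n" for i
    using fun_cong[OF vw(3), of i] vw(1,2) that by (auto simp: coords_def)
  then show "v = w"
    using vw by auto
qed

lemma coords_vec: "(\<And>i. i \<ge> n \<Longrightarrow> f i = 0) \<Longrightarrow> coords (vec n f) = f"
  by (auto simp: coords_def)

lemma coords_ops:
  fixes v w :: "'a::field vec"
  assumes "v \<in> carrier_vec n"
  shows "w \<in> carrier_vec n \<Longrightarrow> coords (v + w) = coords v + coords w"
    "coords (c \<cdot>\<^sub>v v) = fscale c (coords v)" "coords (0\<^sub>v n) = 0"
  using assms by (auto simp: coords_def fscale_def fun_eq_iff)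

context vec_space
begin

lemma coords_lincomb:
  assumes "finite S" "S \<subseteq> carrier_vec n"
  shows "coords (lincomb a S) = (\<Sum>v\<in>S. fscale (a v) (coords v))"
proof
  fix i
  have "dim_vec v = n" if "v \<in> S" for v
    using that assms(2) by auto
  then show "coords (lincomb a S) i = (\<Sum>v\<in>S. fscale (a v) (coords v)) i"
    using lincomb_dim[OF assms, of a] lincomb_index[OF _ assms(2), of i a]
    by (auto simp: coords_def sum_fun_apply fscale_apply)
qed

lemma coords_zero_iff: "v \<in> carrier_vec n \<Longrightarrow> coords v = 0 \<longleftrightarrow> v = 0\<^sub>v n"
  using inj_onD[OF coords_inj[of n], of v "0\<^sub>v n"] coords_ops(3)[of "0\<^sub>v n" n] by auto

lemma lin_dep_iff_coords:
  assumes "finite S" "S \<subseteq> carrier_vec n"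
  shows "lin_dep S \<longleftrightarrow> fun_space.dependent (coords ` S)"
proof -
  have inj: "inj_on coords S"
    using coords_inj assms(2) by (rule inj_on_subset)
  note dependent_iff = fun_space.dependent_finite[OF finite_imageI[OF assms(1)], of coords]
  show ?thesis
  proof
    assume "lin_dep S"
    then obtain a v where a: "lincomb a S = 0\<^sub>v n" "v \<in> S" "a v \<noteq> 0"
      using finite_lin_dep[OF assms(1)] assms(2) by auto
    define u where "u f = a (inv_into S coords f)" for f
    have u: "u (coords v) = a v" if "v \<in> S" for v
      using that inj by (simp add: u_def)
    have "(\<Sum>f\<in>coords ` S. fscale (u f) f) = (\<Sum>v\<in>S. fscale (a v) (coords v))"
      by (simp add: sum.reindex[OF inj] u cong: sum.cong)
    also have "\<dots> = coords (lincomb a S)"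
      by (rule coords_lincomb[OF assms, symmetric])
    also have "\<dots> = 0"
      using coords_ops(3)[of "0\<^sub>v n" n] by (simp add: a(1))
    finally show "fun_space.dependent (coords ` S)"
      unfolding dependent_iff using a(2,3) u
      by (intro exI[of _ u] conjI bexI[of _ "coords v"]) auto
  next
    assume "fun_space.dependent (coords ` S)"
    then obtain u where u: "\<exists>f\<in>coords ` S. u f \<noteq> 0" "(\<Sum>f\<in>coords ` S. fscale (u f) f) = 0"
      unfolding dependent_iff by blast
    have "coords (lincomb (\<lambda>v. u (coords v)) S) = 0"
      using u(2) unfolding coords_lincomb[OF assms] by (simp only: sum.reindex[OF inj] o_def)
    moreover have "lincomb (\<lambda>v. u (coords v)) S \<in> carrier_vec n"
      using lincomb_dim[OF assms] by (rule carrier_vecI)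
    ultimately have "lincomb (\<lambda>v. u (coords v)) S = 0\<^sub>v n"
      using coords_zero_iff by blast
    then show "lin_dep S"
      using u(1) lin_dep_crit[OF assms(1) order_refl, where a = "\<lambda>v. u (coords v)"] by auto
  qed
qed

lemma coords_span:
  assumes "finite S" "S \<subseteq> carrier_vec n"
  shows "coords ` span S = fun_space.span (coords ` S)"
proof -
  have inj: "inj_on coords S"
    using coords_inj assms(2) by (rule inj_on_subset)
  have "coords ` span S = range (\<lambda>a. coords (lincomb a S))"
    using finite_span[OF assms(1)] assms(2) by auto
  also have "\<dots> = range (\<lambda>a. \<Sum>v\<in>S. fscale (a v) (coords v))"
    by (simp only: coords_lincomb[OF assms])
  also have "\<dots> = range (\<lambda>u. \<Sum>f\<in>coords ` S. fscale (u f) f)"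
  proof (intro equalityI image_subsetI)
    fix a
    have "(\<Sum>v\<in>S. fscale (a v) (coords v)) = (\<Sum>f\<in>coords ` S. fscale (a (inv_into S coords f)) f)"
      using inj by (simp add: sum.reindex cong: sum.cong)
    then show "(\<Sum>v\<in>S. fscale (a v) (coords v)) \<in> range (\<lambda>u. \<Sum>f\<in>coords ` S. fscale (u f) f)"
      by (intro image_eqI[of _ _ "\<lambda>f. a (inv_into S coords f)"]) auto
  next
    fix u
    have "(\<Sum>f\<in>coords ` S. fscale (u f) f) = (\<Sum>v\<in>S. fscale (u (coords v)) (coords v))"
      using inj by (simp add: sum.reindex)
    then show "(\<Sum>f\<in>coords ` S. fscale (u f) f) \<in> range (\<lambda>a. \<Sum>v\<in>S. fscale (a v) (coords v))"
      by (intro image_eqI[of _ _ "\<lambda>v. u (coords v)"]) auto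
  qed
  also have "\<dots> = fun_space.span (coords ` S)"
    using fun_space.span_finite[of "coords ` S"] assms(1) by simp
  finally show ?thesis .
qed

text \<open>A maximal independent subset of \<open>S\<close> stays independent and spanning under
  \<open>coords\<close>, so it computes both dimensions.\<close>

lemma dim_span_coords:
  assumes "finite S" "S \<subseteq> carrier_vec n"
  shows "vectorspace.dim class_ring (span_vs S) = fun_space.dim (coords ` S)"
proof -
  have "lin_indpt {}"
    using lin_dep_iff_coords[of "{}"] by (simp add: fun_space.independent_empty)
  then obtain U where U: "finite U" "maximal U (\<lambda>T. T \<subseteq> S \<and> lin_indpt T)"
    using maximal_exists_superset[OF assms(1), of "\<lambda>T. T \<subseteq> S \<and> lin_indpt T" "{}"] by auto
  then have US: "U \<subseteq> S" "lin_indpt U"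
    by (auto simp: maximal_def)
  have ind: "fun_space.independent (coords ` U)"
    using US U(1) assms(2) lin_dep_iff_coords[of U] by auto
  have "coords s \<in> fun_space.span (coords ` U)" if "s \<in> S" for s
  proof (rule ccontr)
    assume *: "coords s \<notin> fun_space.span (coords ` U)"
    have "fun_space.independent (coords ` insert s U)"
      using fun_space.independent_insertI[OF * ind] by simp
    then have "lin_indpt (insert s U)"
      using lin_dep_iff_coords[of "insert s U"] U(1) US(1) that assms(2) by auto
    then have "insert s U = U"
      using U(2) US(1) that unfolding maximal_def by blast
    then show False
      using * by (metis fun_space.span_base imageI insertI1)
  qed
  then have "card (coords ` U) = fun_space.dim (coords ` S)"
    using US(1) ind by (intro fun_space.basis_card_eq_dim) auto
  moreover have "card (coords ` U) = card U"
    using coords_inj[of n] US(1) assms(2) by (intro card_image) (auto intro: inj_on_subset)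
  moreover have "vectorspace.dim class_ring (span_vs S) = card U"
    using dim_span[OF _ assms(1) U(2)] assms(2) by simp
  ultimately show ?thesis
    by simp
qed

lemma rank_coords:
  assumes "A \<in> carrier_mat n nc"
  shows "rank A = fun_space.dim (coords ` set (cols A))"
  unfolding rank_def using assms cols_dim[of A] by (intro dim_span_coords) auto

lemma coords_support: "f \<in> coords ` carrier_vec n \<longleftrightarrow> (\<forall>i\<ge>n. f i = 0)"
proof
  assume "\<forall>i\<ge>n. f i = 0"
  then show "f \<in> coords ` carrier_vec n"
    using coords_vec[of n f] by (metis imageI vec_carrier)
qed (auto simp: coords_def)

lemma support_span:
  fixes f :: "nat \<Rightarrow> 'a"
  assumes "\<forall>i\<ge>n. f i = 0"
  shows "f \<in> fun_space.span ((\<lambda>k i. if i = k then 1 else 0) ` {..<n})"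
proof -
  have "f = (\<Sum>k<n. fscale (f k) (\<lambda>i. if i = k then 1 else 0))"
  proof
    fix i
    have "(\<Sum>k<n. f k * (if i = k then 1 else 0)) = (\<Sum>k<n. if k = i then f k else 0)"
      by (intro sum.cong) auto
    then show "f i = (\<Sum>k<n. fscale (f k) (\<lambda>i. if i = k then 1 else 0)) i"
      using assms by (simp add: sum_fun_apply fscale_apply)
  qed
  then show ?thesis
    using fun_space.sum_in_span_image[of f "\<lambda>k i. if i = k then 1 else 0" n] by simp
qed

lemma subspace_coords:
  assumes "VectorSpace.subspace class_ring W V"
  shows "fun_space.subspace (coords ` W)" "W \<subseteq> carrier_vec n"
proof -
  interpret W: submodule class_ring W V
    using assms unfolding VectorSpace.subspace_def by blast
  show W: "W \<subseteq> carrier_vec n"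
    using W.subset by simp
  show "fun_space.subspace (coords ` W)"
  proof (rule fun_space.subspaceI)
    have "0\<^sub>v n \<in> W"
      using W.zero_closed by simp
    then show "0 \<in> coords ` W"
      using coords_ops(3)[of "0\<^sub>v n" n] by (metis imageI zero_carrier_vec)
  next
    fix f g assume "f \<in> coords ` W" "g \<in> coords ` W"
    then obtain v w where vw: "v \<in> W" "w \<in> W" "f = coords v" "g = coords w"
      by auto
    then have "v + w \<in> W"
      using W.m_closed by simp
    then show "f + g \<in> coords ` W"
      using vw W coords_ops(1)[of v n w] by (metis imageI subsetD)
  next
    fix c f assume "f \<in> coords ` W"
    then obtain v where v: "v \<in> W" "f = coords v"
      by auto
    then have "c \<cdot>\<^sub>v v \<in> W"
      using W.smult_closed by simp
    then show "fscale c f \<in> coords ` W"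
      using v W coords_ops(2)[of v n c] by (metis imageI subsetD)
  qed
qed

lemma subspace_dim_basis:
  assumes "VectorSpace.subspace class_ring W V"
  obtains b where "\<forall>c. (\<Sum>i<vectorspace.dim class_ring (vs W). fscale (c i) (b i)) = 0 \<longrightarrow>
      (\<forall>i<vectorspace.dim class_ring (vs W). c i = 0)"
    "coords ` W = range (\<lambda>c. \<Sum>i<vectorspace.dim class_ring (vs W). fscale (c i) (b i))"
proof -
  note W = subspace_coords[OF assms]
  have "coords ` W \<subseteq> fun_space.span ((\<lambda>k i. if i = k then 1 else 0) ` {..<n})"
    using W(2) coords_support support_span by blast
  from fun_space.subspace_finite_basis[OF W(1) this finite_imageI[OF finite_lessThan]] obtain l :: nat and b where
    lb: "(\<forall>c. (\<Sum>i<l. fscale (c i) (b i)) = 0 \<longrightarrow> (\<forall>i<l. c i = 0)) \<and>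
      coords ` W = range (\<lambda>c. \<Sum>i<l. fscale (c i) (b i))"
    by (elim exE) (rule that)
  note ind = lb[THEN conjunct1] and range = lb[THEN conjunct2]
  note family = fun_space.independent_family[where b = b and l = l, OF ind[THEN spec, THEN mp]]
  have span_b: "coords ` W = fun_space.span (b ` {..<l})"
  proof
    show "coords ` W \<subseteq> fun_space.span (b ` {..<l})"
      unfolding range by (auto simp: fun_space.sum_in_span_image)
    have "b i \<in> coords ` W" if "i < l" for i
    proof -
      have "b i = (\<Sum>j<l. fscale (if j = i then 1 else 0) (b j))"
        using that by (simp add: if_distrib[of "\<lambda>c. fscale c _"] cong: if_cong)
      then show ?thesis
        unfolding range by (intro image_eqI[of _ _ "\<lambda>j. if j = i then 1 else 0"]) auto
    qed
    then show "fun_space.span (b ` {..<l}) \<subseteq> coords ` W"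
      using W(1) by (intro fun_space.span_minimal) auto
  qed
  define S where "S = W \<inter> coords -` (b ` {..<l})"
  have "b ` {..<l} \<subseteq> coords ` W"
    unfolding span_b by (rule fun_space.span_superset)
  moreover have "coords ` S = coords ` W \<inter> b ` {..<l}"
    unfolding S_def by (intro equalityI subsetI) auto
  ultimately have S: "coords ` S = b ` {..<l}"
    by (simp only: Int_absorb1)
  have "S \<subseteq> carrier_vec n"
    using W(2) by (auto simp: S_def)
  then have "finite S"
    using S inj_on_subset[OF coords_inj] by (intro finite_imageD[of coords S]) auto
  have "coords ` span S = coords ` W"
    using coords_span[OF \<open>finite S\<close> \<open>S \<subseteq> carrier_vec n\<close>] S span_b by simp
  moreover have "span S \<subseteq> carrier_vec n"
    using span_is_subset2[of S] \<open>S \<subseteq> carrier_vec n\<close> by simp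
  ultimately have "span S = W"
    using inj_on_image_eq_iff[OF coords_inj, of "span S" n W] W(2) by blast
  then have "vectorspace.dim class_ring (vs W) = fun_space.dim (b ` {..<l})"
    using dim_span_coords[OF \<open>finite S\<close> \<open>S \<subseteq> carrier_vec n\<close>] S by simp
  also have "\<dots> = l"
    using fun_space.dim_eq_card_independent[OF family(2)] card_image[OF family(1)] by simp
  finally show ?thesis
    using that[of b] ind range by simp
qed

lemma independent_family_subspace:
  fixes b :: "nat \<Rightarrow> nat \<Rightarrow> 'a"
  assumes "\<And>c. (\<Sum>i<l. fscale (c i) (b i)) = 0 \<Longrightarrow> \<forall>i<l. c i = 0"
    and "\<And>i j. i < l \<Longrightarrow> j \<ge> n \<Longrightarrow> b i j = 0"
  obtains W where "VectorSpace.subspace class_ring W V" "vectorspace.dim class_ring (vs W) = l"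
    "coords ` W = fun_space.span (b ` {..<l})" "W \<subseteq> carrier_vec n"
proof -
  note family = fun_space.independent_family[where b = b and l = l, OF assms(1)]
  define S where "S = (\<lambda>i. vec n (b i)) ` {..<l}"
  have coords_S: "coords ` S = b ` {..<l}"
    unfolding S_def image_image using assms(2) by (intro image_cong) (auto simp: coords_vec)
  have S: "finite S" "S \<subseteq> carrier_vec n"
    by (auto simp: S_def)
  show ?thesis
  proof
    show "VectorSpace.subspace class_ring (span S) V"
      using span_is_subspace[of S] S(2) by simp
    show "coords ` span S = fun_space.span (b ` {..<l})"
      using coords_span[OF S] coords_S by simp
    show "span S \<subseteq> carrier_vec n"
      using span_is_subset2[of S] S(2) by simp
    have "vectorspace.dim class_ring (span_vs S) = fun_space.dim (b ` {..<l})"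
      using dim_span_coords[OF S] coords_S by simp
    then show "vectorspace.dim class_ring (span_vs S) = l"
      using fun_space.dim_eq_card_independent[OF family(2)] card_image[OF family(1)] by simp
  qed
qed

end

section \<open>Linear substitutions, trilinear forms and Hessians\<close>

lemma cubic_substitute:
  "cubic I t (\<lambda>i. \<Sum>p\<in>J. Const (M p i) * l p) =
    cubic J (\<lambda>p q r. \<Sum>i\<in>I. \<Sum>j\<in>I. \<Sum>k\<in>I. t i j k * (M p i * (M q j * M r k))) l"
proof -
  have Const_sum: "Const (\<Sum>i\<in>A. c i) = (\<Sum>i\<in>A. Const (c i))" for c :: "nat \<Rightarrow> 'a" and A
    by (induction A rule: infinite_finite_induct) (auto simp: single_add)
  define E where "E i j k p q r = Const (t i j k * (M p i * (M q j * M r k))) * (l p * (l q * l r))"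
    for i j k p q r
  have "cubic I t (\<lambda>i. \<Sum>p\<in>J. Const (M p i) * l p) =
      (\<Sum>i\<in>I. \<Sum>j\<in>I. \<Sum>k\<in>I. \<Sum>p\<in>J. \<Sum>q\<in>J. \<Sum>r\<in>J. E i j k p q r)"
    unfolding cubic_def
  proof (intro sum.cong refl)
    fix i j k
    have E: "E i j k p q r = Const (t i j k) * ((Const (M p i) * l p) * ((Const (M q j) * l q) * (Const (M r k) * l r)))"
      for p q r
    proof -
      have "E i j k p q r = (Const (t i j k) * (Const (M p i) * (Const (M q j) * Const (M r k)))) * (l p * (l q * l r))"
        by (simp only: E_def mult_single add_0_left)
      then show ?thesis
        by (simp only: ac_simps)
    qed
    show "Const (t i j k) * ((\<Sum>p\<in>J. Const (M p i) * l p) * ((\<Sum>p\<in>J. Const (M p j) * l p) * (\<Sum>p\<in>J. Const (M p k) * l p))) =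
        (\<Sum>p\<in>J. \<Sum>q\<in>J. \<Sum>r\<in>J. E i j k p q r)"
      unfolding E sum_distrib_left[symmetric] sum_distrib_right[symmetric] ..
  qed
  \<comment> \<open>Index triples are bundled into pairs of products, so that a single exchange of
    sums reorders all six summations.\<close>
  also have "\<dots> = (\<Sum>z\<in>I \<times> (I \<times> I). \<Sum>w\<in>J \<times> (J \<times> J).
      E (fst z) (fst (snd z)) (snd (snd z)) (fst w) (fst (snd w)) (snd (snd w)))"
    by (simp add: sum.cartesian_product' split_def)
  also have "\<dots> = (\<Sum>w\<in>J \<times> (J \<times> J). \<Sum>z\<in>I \<times> (I \<times> I).
      E (fst z) (fst (snd z)) (snd (snd z)) (fst w) (fst (snd w)) (snd (snd w)))"
    by (rule sum.swap)
  also have "\<dots> = (\<Sum>p\<in>J. \<Sum>q\<in>J. \<Sum>r\<in>J. \<Sum>i\<in>I. \<Sum>j\<in>I. \<Sum>k\<in>I. E i j k p q r)"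
    by (simp add: sum.cartesian_product' split_def)
  also have "\<dots> = cubic J (\<lambda>p q r. \<Sum>i\<in>I. \<Sum>j\<in>I. \<Sum>k\<in>I. t i j k * (M p i * (M q j * M r k))) l"
    unfolding cubic_def Const_sum E_def sum_distrib_right ..
  finally show ?thesis .
qed

definition trilin :: "nat \<Rightarrow> (nat \<Rightarrow> nat \<Rightarrow> nat \<Rightarrow> 'a::comm_ring_1) \<Rightarrow> (nat \<Rightarrow> 'a) \<Rightarrow> (nat \<Rightarrow> 'a) \<Rightarrow> (nat \<Rightarrow> 'a) \<Rightarrow> 'a" where
  "trilin n t x y z = (\<Sum>i\<le>n. \<Sum>j\<le>n. \<Sum>k\<le>n. t i j k * (x i * (y j * z k)))"

definition unit_fun :: "nat \<Rightarrow> nat \<Rightarrow> 'a::zero_neq_one" where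
  "unit_fun a = (\<lambda>i. if i = a then 1 else 0)"

lemma trilin_symmetric_trilinear_form:
  fixes t :: "nat \<Rightarrow> nat \<Rightarrow> nat \<Rightarrow> 'a::{alg_closed_field, field_char_0}"
  assumes "\<And>i j k. t i j k = t j i k" "\<And>i j k. t i j k = t i k j"
  shows "symmetric_trilinear_form fscale (trilin n t)"
proof unfold_locales
  fix x y z u :: "nat \<Rightarrow> 'a" and c
  show "trilin n t (x + y) z u = trilin n t x z u + trilin n t y z u"
    by (simp add: trilin_def algebra_simps sum.distrib)
  show "trilin n t (fscale c x) z u = c * trilin n t x z u"
    by (simp add: trilin_def fscale_apply sum_distrib_left ac_simps)
  show "trilin n t x z u = trilin n t z x u"
    unfolding trilin_def by (subst sum.swap) (simp add: assms(1)[symmetric] mult.left_commute)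
  show "trilin n t x z u = trilin n t x u z"
    unfolding trilin_def by (rule sum.cong[OF refl], subst sum.swap) (simp add: assms(2)[symmetric] mult.commute)
qed

lemma trilin_unit:
  assumes "a \<le> n"
  shows "trilin n t x y (unit_fun a) = (\<Sum>i\<le>n. \<Sum>j\<le>n. t i j a * (x i * y j))"
proof -
  have "(\<Sum>k\<le>n. t i j k * (x i * (y j * unit_fun a k))) = (\<Sum>k\<le>n. if k = a then t i j k * (x i * y j) else 0)"
    for i j
    by (intro sum.cong) (auto simp: unit_fun_def)
  then show ?thesis
    using assms by (simp add: trilin_def)
qed

lemma trilin_expand: "trilin n t x y z = (\<Sum>a\<le>n. z a * trilin n t x y (unit_fun a))"
proof -
  have "(\<Sum>a\<le>n. z a * trilin n t x y (unit_fun a)) = (\<Sum>a\<le>n. \<Sum>i\<le>n. \<Sum>j\<le>n. t i j a * (x i * (y j * z a)))"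
    by (intro sum.cong) (auto simp: trilin_unit sum_distrib_left ac_simps)
  also have "\<dots> = (\<Sum>i\<le>n. \<Sum>a\<le>n. \<Sum>j\<le>n. t i j a * (x i * (y j * z a)))"
    by (rule sum.swap)
  also have "\<dots> = trilin n t x y z"
    unfolding trilin_def by (intro sum.cong refl sum.swap)
  finally show ?thesis ..
qed

lemma hessian_entry:
  fixes t :: "nat \<Rightarrow> nat \<Rightarrow> nat \<Rightarrow> 'a::field"
  assumes sym: "\<And>i j k. t i j k = t j i k" "\<And>i j k. t i j k = t i k j"
    and f: "f = cubic {..n} t X" and ij: "i \<le> n" "j \<le> n"
  shows "hessian n f x $$ (i, j) = 6 * (\<Sum>k\<le>n. t i j k * x $ k)"
proof -
  have six: "t i j k + t j i k + t i k j + t j k i + t k i j + t k j i = 6 * t i j k" for k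
  proof -
    have "t j i k = t i j k" "t i k j = t i j k" "t j k i = t i j k" "t k i j = t i j k" "t k j i = t i j k"
      using sym by metis+
    then show ?thesis
      by simp
  qed
  then show ?thesis
    using ij unfolding hessian_def f sum_distrib_left
    by (simp add: eval_partial2_cubic del: add.assoc) (simp only: six mult.assoc)
qed

lemma hessian_carrier: "hessian n f x \<in> carrier_mat (n + 1) (n + 1)"
  by (simp add: hessian_def)

lemma hessian_column:
  fixes t :: "nat \<Rightarrow> nat \<Rightarrow> nat \<Rightarrow> 'a::field"
  assumes sym: "\<And>i j k. t i j k = t j i k" "\<And>i j k. t i j k = t i k j"
    and f: "f = cubic {..n} t X" and j: "j \<le> n"
  shows "coords (col (hessian n f x) j) = (\<lambda>i. if i \<le> n then 6 * (\<Sum>k\<le>n. t i j k * x $ k) else 0)"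
  using hessian_entry[OF sym f _ j, of _ x] hessian_carrier[of n f x] j
  by (auto simp: coords_def fun_eq_iff)

lemma cubic_forms_split:
  assumes "k < n" and mixed: "\<And>p q r. p \<le> n \<Longrightarrow> q \<le> n \<Longrightarrow> r \<le> n \<Longrightarrow>
      \<not> (p \<le> k \<and> q \<le> k \<and> r \<le> k) \<Longrightarrow> \<not> (k < p \<and> k < q \<and> k < r) \<Longrightarrow> t p q r = 0"
  shows "cubic {..n} t l = cubic {0..k} t l + cubic {k+1..n} t l"
proof -
  have un: "{..n} = {0..k} \<union> {k+1..n}"
    using assms(1) by auto
  have split: "(\<Sum>i\<le>n. F i) = (\<Sum>i\<in>{0..k}. F i) + (\<Sum>i\<in>{k+1..n}. F i)" for F :: "nat \<Rightarrow> 'a mpoly"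
    unfolding un by (rule sum.union_disjoint) auto
  define F where "F i j r = Const (t i j r) * (l i * (l j * l r))" for i j r
  have F0: "F i j r = 0" if "i \<le> n" "j \<le> n" "r \<le> n" "\<not> (i \<le> k \<and> j \<le> k \<and> r \<le> k)" "\<not> (k < i \<and> k < j \<and> k < r)"
    for i j r
    using mixed[OF that] by (simp add: F_def)
  have "(\<Sum>i\<le>n. \<Sum>j\<le>n. \<Sum>r\<le>n. F i j r) =
      (\<Sum>i\<in>{0..k}. \<Sum>j\<le>n. \<Sum>r\<le>n. F i j r) + (\<Sum>i\<in>{k+1..n}. \<Sum>j\<le>n. \<Sum>r\<le>n. F i j r)"
    by (rule split)
  also have "(\<Sum>i\<in>{0..k}. \<Sum>j\<le>n. \<Sum>r\<le>n. F i j r) = (\<Sum>i\<in>{0..k}. \<Sum>j\<in>{0..k}. \<Sum>r\<in>{0..k}. F i j r)"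
  proof (rule sum.cong[OF refl])
    fix i assume i: "i \<in> {0..k}"
    have "(\<Sum>r\<le>n. F i j r) = (if j \<le> k then \<Sum>r\<in>{0..k}. F i j r else 0)" if "j \<le> n" for j
    proof (cases "j \<le> k")
      case True
      have "(\<Sum>r\<in>{k+1..n}. F i j r) = 0"
        using i that assms(1) True by (intro sum.neutral ballI F0) auto
      then show ?thesis
        using True by (simp add: split)
    next
      case False
      then show ?thesis
        using i that assms(1) by (auto intro!: sum.neutral F0)
    qed
    then have "(\<Sum>j\<le>n. \<Sum>r\<le>n. F i j r) = (\<Sum>j\<le>n. if j \<le> k then \<Sum>r\<in>{0..k}. F i j r else 0)"
      by (intro sum.cong) auto
    also have "\<dots> = (\<Sum>j\<in>{0..k}. \<Sum>r\<in>{0..k}. F i j r)"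
      unfolding sum.inter_filter[symmetric, OF finite_atMost] using assms(1) by (intro sum.cong) auto
    finally show "(\<Sum>j\<le>n. \<Sum>r\<le>n. F i j r) = (\<Sum>j\<in>{0..k}. \<Sum>r\<in>{0..k}. F i j r)" .
  qed
  also have "(\<Sum>i\<in>{k+1..n}. \<Sum>j\<le>n. \<Sum>r\<le>n. F i j r) = (\<Sum>i\<in>{k+1..n}. \<Sum>j\<in>{k+1..n}. \<Sum>r\<in>{k+1..n}. F i j r)"
  proof (rule sum.cong[OF refl])
    fix i assume i: "i \<in> {k+1..n}"
    have "(\<Sum>r\<le>n. F i j r) = (if k < j then \<Sum>r\<in>{k+1..n}. F i j r else 0)" if "j \<le> n" for j
    proof (cases "k < j")
      case True
      have "(\<Sum>r\<in>{0..k}. F i j r) = 0"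
        using i that assms(1) True by (intro sum.neutral ballI F0) auto
      then show ?thesis
        using True by (simp add: split)
    next
      case False
      then show ?thesis
        using i that assms(1) by (auto intro!: sum.neutral F0)
    qed
    then have "(\<Sum>j\<le>n. \<Sum>r\<le>n. F i j r) = (\<Sum>j\<le>n. if k < j then \<Sum>r\<in>{k+1..n}. F i j r else 0)"
      by (intro sum.cong) auto
    also have "\<dots> = (\<Sum>j\<in>{k+1..n}. \<Sum>r\<in>{k+1..n}. F i j r)"
      unfolding sum.inter_filter[symmetric, OF finite_atMost] by (intro sum.cong) auto
    finally show "(\<Sum>j\<le>n. \<Sum>r\<le>n. F i j r) = (\<Sum>j\<in>{k+1..n}. \<Sum>r\<in>{k+1..n}. F i j r)" .
  qed
  finally show ?thesis
    by (simp add: cubic_def F_def)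
qed

lemma linear_combination_of_forms:
  fixes I J :: "nat set"
  shows "(\<Sum>b\<in>J. Const (c b) * (\<Sum>a\<in>I. Const (G a b) * X a)) =
    (\<Sum>a\<in>I. Const (\<Sum>b\<in>J. c b * G a b) * X a)"
proof -
  have Const_sum: "Const (\<Sum>i\<in>A. c i) = (\<Sum>i\<in>A. Const (c i))" for c :: "nat \<Rightarrow> 'a" and A
    by (induction A rule: infinite_finite_induct) (auto simp: single_add)
  have "(\<Sum>b\<in>J. Const (c b) * (\<Sum>a\<in>I. Const (G a b) * X a)) =
      (\<Sum>b\<in>J. \<Sum>a\<in>I. Const (c b * G a b) * X a)"
    by (intro sum.cong refl) (simp add: sum_distrib_left mult_single)
  also have "\<dots> = (\<Sum>a\<in>I. \<Sum>b\<in>J. Const (c b * G a b) * X a)"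
    by (rule sum.swap)
  finally show ?thesis
    by (simp only: Const_sum sum_distrib_right)
qed

text \<open>Points of the locus are classes of vectors, so the representative whose Hessian has
  small rank is known only to be proportional to \<open>w\<close>.\<close>

lemma locus_rank:
  assumes "proj_point w \<in> hessian_locus n m f" "w \<in> carrier_vec (n + 1)"
  obtains c x where "c \<noteq> 0" "w = c \<cdot>\<^sub>v x" "x \<in> carrier_vec (n + 1)"
    "vec_space.rank (n + 1) (hessian n f x) \<le> m"
proof -
  obtain x where x: "proj_point w = proj_point x" "x \<in> carrier_vec (n + 1)"
    "vec_space.rank (n + 1) (hessian n f x) \<le> m"
    using assms(1) unfolding hessian_locus_def by blast
  have "w = 1 \<cdot>\<^sub>v w"
    by simp
  then have "w \<in> proj_point w"
    unfolding proj_point_def by (metis (mono_tags, lifting) mem_Collect_eq zero_neq_one)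
  then have "w \<in> proj_point x"
    by (simp only: x(1))
  then obtain c where "w = c \<cdot>\<^sub>v x" "c \<noteq> 0"
    unfolding proj_point_def by blast
  with x that show ?thesis
    by blast
qed

text \<open>The Hessian of \<open>f\<close> at \<open>x\<close>, as a bilinear form, is \<open>6 T(x, _, _)\<close>.\<close>

locale symmetric_cubic = symmetric_trilinear_form fscale "trilin n t"
  for n :: nat and t :: "nat \<Rightarrow> nat \<Rightarrow> nat \<Rightarrow> 'a::{alg_closed_field, field_char_0}" +
  fixes f :: "'a mpoly"
  assumes t_sym: "t i j k = t j i k" "t i j k = t i k j" and f_cubic: "f = cubic {..n} t X"
begin

abbreviation T :: "(nat \<Rightarrow> 'a) \<Rightarrow> (nat \<Rightarrow> 'a) \<Rightarrow> (nat \<Rightarrow> 'a) \<Rightarrow> 'a" where "T \<equiv> trilin n t"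

text \<open>The functional T(x, z, _) in coordinates, which is one sixth of the Hessian at x applied
  to z; it is zero beyond \<open>n\<close>, in accordance with \<open>coords\<close>.\<close>

definition polar :: "(nat \<Rightarrow> 'a) \<Rightarrow> (nat \<Rightarrow> 'a) \<Rightarrow> nat \<Rightarrow> 'a" where
  "polar x z = (\<lambda>i. if i \<le> n then T x z (unit_fun i) else 0)"

lemma T_polar: "T x z v = (\<Sum>a\<le>n. v a * polar x z a)"
  unfolding polar_def by (subst trilin_expand) simp

lemma polar_linear: "polar x (y + z) = polar x y + polar x z" "polar x (fscale c z) = fscale c (polar x z)"
  "polar (fscale c x) z = fscale c (polar x z)"
  by (auto simp: polar_def fun_eq_iff T_linear fscale_apply)

lemma polar_zero: "polar x 0 = 0"
  unfolding polar_def T_zero if_cancel by (simp only: zero_fun_def)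

lemma polar_sum: "polar x (\<Sum>i\<in>I. g i) = (\<Sum>i\<in>I. polar x (g i))"
  by (induction I rule: infinite_finite_induct)
    (simp_all only: sum.infinite sum.empty sum.insert polar_zero polar_linear(1) not_False_eq_True)

lemma polar_hessian:
  assumes "x \<in> carrier_vec (n + 1)"
  shows "polar (coords x) z = (\<Sum>j\<le>n. fscale (z j / 6) (coords (col (hessian n f x) j)))"
proof
  fix i
  show "polar (coords x) z i = (\<Sum>j\<le>n. fscale (z j / 6) (coords (col (hessian n f x) j))) i"
  proof (cases "i \<le> n")
    case True
    have "t k j i = t i j k" for j k
      using t_sym by metis
    then have "T (coords x) z (unit_fun i) = (\<Sum>k\<le>n. \<Sum>j\<le>n. z j * (t i j k * x $ k))"
      using assms by (auto simp: trilin_unit[OF True] coords_def intro!: sum.cong)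
    also have "\<dots> = (\<Sum>j\<le>n. z j * (\<Sum>k\<le>n. t i j k * x $ k))"
      by (subst sum.swap) (simp add: sum_distrib_left)
    finally show ?thesis
      using True by (simp add: polar_def sum_fun_apply fscale_apply hessian_column[OF t_sym f_cubic])
  next
    case False
    then show ?thesis
      by (simp add: polar_def sum_fun_apply fscale_apply hessian_column[OF t_sym f_cubic])
  qed
qed

lemma polar_span:
  assumes "x \<in> carrier_vec (n + 1)"
  shows "polar (coords x) z \<in> fun_space.span (coords ` set (cols (hessian n f x)))"
  unfolding polar_hessian[OF assms]
proof (intro fun_space.span_sum fun_space.span_scale fun_space.span_base imageI)
  fix j assume "j \<in> {..n}"
  then show "col (hessian n f x) j \<in> set (cols (hessian n f x))"
    using hessian_carrier[of n f x] nth_mem[of j "cols (hessian n f x)"] by simp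
qed

text \<open>The value of \<open>f\<close> at x is T(x, x, x), and its i-th partial derivative is 3
  T(x, x, e_i). If T(x, x, _) were zero, x would be a singular point of the hypersurface.\<close>

lemma smooth_nonzero:
  assumes smooth: "smooth_hypersurface n f" and x: "x \<in> carrier_vec (n + 1)" "x \<noteq> 0\<^sub>v (n + 1)"
  shows "\<exists>v. T (coords x) (coords x) v \<noteq> 0"
proof (rule ccontr)
  assume 0: "\<not> ?thesis"
  have x_coords: "x $ i = coords x i" if "i \<le> n" for i
    using that x(1) by (auto simp: coords_def)
  have "eval_mpoly (\<lambda>i. x $ i) f = T (coords x) (coords x) (coords x)"
    unfolding f_cubic eval_cubic trilin_def by (intro sum.cong refl) (simp add: x_coords)
  then have "eval_mpoly (\<lambda>i. x $ i) f = 0"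
    using 0 by simp
  then obtain i where i: "i \<le> n" "eval_mpoly (\<lambda>i. x $ i) (partial i f) \<noteq> 0"
    using smooth x unfolding smooth_hypersurface_def by blast
  have "t i j k + t j i k + t j k i = 3 * t j k i" for j k
  proof -
    have "t i j k = t j k i" "t j i k = t j k i"
      using t_sym by metis+
    then show ?thesis
      by simp
  qed
  then have "eval_mpoly (\<lambda>i. x $ i) (partial i f) = 3 * T (coords x) (coords x) (unit_fun i)"
    using i(1) unfolding f_cubic trilin_unit[OF i(1)] sum_distrib_left
    by (subst eval_partial_cubic) (auto intro!: sum.cong simp: x_coords mult.assoc)
  then show False
    using 0 i(2) by simp
qed

text \<open>The functionals T(y, b_i, _) and T(y, v, _) are k + 2 vectors in a column space of
  dimension at most k + 1. In a relation the coefficient of \<open>v\<close> is nonzero because T(y,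
  _, _) is injective on the subspace, and solving for \<open>v\<close> gives the required p.\<close>

lemma locus_rank_condition:
  assumes W: "W \<subseteq> carrier_vec (n + 1)" "coords ` W = range (\<lambda>c. \<Sum>i<Suc k. fscale (c i) (b i))"
    and indep: "\<And>c. (\<Sum>i<Suc k. fscale (c i) (b i)) = 0 \<Longrightarrow> \<forall>i<Suc k. c i = 0"
    and locus: "proj_point ` (W - {0\<^sub>v (n + 1)}) \<subseteq> hessian_locus n (k + 1) f"
    and y: "y \<in> coords ` W" "\<And>p. p \<in> coords ` W \<Longrightarrow> (\<And>v. T y p v = 0) \<Longrightarrow> p = 0"
  shows "\<exists>p\<in>coords ` W. \<forall>u. T y (v - p) u = 0"
proof -
  interpret V: vec_space "TYPE('a)" "n + 1" .
  obtain w where w: "w \<in> W" "y = coords w"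
    using y(1) by blast
  have "w \<noteq> 0\<^sub>v (n + 1)"
  proof
    assume "w = 0\<^sub>v (n + 1)"
    then have "y = 0"
      using coords_ops(3)[of "0\<^sub>v (n + 1)" "n + 1"] w by simp
    \<comment> \<open>The sum is b 0. If \<open>y\<close> were 0, the assumption on \<open>y\<close>
      would force b 0 = 0 against independence; a family of length k + 1 always has this
      member.\<close>
    have comb: "(\<Sum>i<Suc k. fscale (if i = 0 then 1 else 0) (b i)) \<in> coords ` W"
      unfolding W(2) by (rule rangeI)
    have "(\<Sum>i<Suc k. fscale (if i = 0 then 1 else 0) (b i)) = 0"
      by (rule y(2)[OF comb]) (simp only: \<open>y = 0\<close> T_zero)
    from indep[OF this] show False
      by auto
  qed
  then have "proj_point w \<in> hessian_locus n (k + 1) f" "w \<in> carrier_vec (n + 1)"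
    using w(1) locus W(1) by auto
  then obtain d x where x: "d \<noteq> 0" "w = d \<cdot>\<^sub>v x" "x \<in> carrier_vec (n + 1)"
    "V.rank (hessian n f x) \<le> k + 1"
    by (rule locus_rank)
  have yx: "y = fscale d (coords x)"
    unfolding w(2) x(2) by (rule coords_ops(2)[OF x(3)])
  let ?C = "coords ` set (cols (hessian n f x))"
  obtain B where B: "B \<subseteq> ?C" "fun_space.independent B" "?C \<subseteq> fun_space.span B" "card B = fun_space.dim ?C"
    by (rule fun_space.basis_exists)
  have "finite B"
    using B(1) by (rule finite_subset) simp
  have "card B \<le> k + 1"
    using x(4) V.rank_coords[OF hessian_carrier] B(4) by simp
  define h where "h i = polar y (if i < Suc k then b i else v)" for i
  have "h i \<in> fun_space.span B" for i
  proof -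
    have "polar (coords x) z \<in> fun_space.span B" for z
      using polar_span[OF x(3)] fun_space.span_minimal[OF B(3) fun_space.subspace_span] by blast
    then show ?thesis
      unfolding h_def yx polar_linear by (intro fun_space.span_scale)
  qed
  then obtain c where c: "\<exists>i\<in>{..Suc k}. c i \<noteq> 0" "(\<Sum>i\<in>{..Suc k}. fscale (c i) (h i)) = 0"
    using fun_space.nontrivial_relation[of "{..Suc k}" B h] \<open>finite B\<close> \<open>card B \<le> k + 1\<close> by auto
  define p where "p = (\<Sum>i<Suc k. fscale (c i) (b i))"
  have "p \<in> coords ` W"
    unfolding W(2) p_def by (intro image_eqI[of _ _ c]) auto
  have "polar y (p + fscale (c (Suc k)) v) = (\<Sum>i<Suc k. fscale (c i) (h i)) + fscale (c (Suc k)) (h (Suc k))"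
    unfolding p_def polar_linear polar_sum by (simp add: h_def)
  also have "\<dots> = (\<Sum>i\<in>{..Suc k}. fscale (c i) (h i))"
    by (simp only: lessThan_Suc_atMost[symmetric] sum.lessThan_Suc)
  also have "\<dots> = 0"
    by (rule c(2))
  finally have rel: "T y (p + fscale (c (Suc k)) v) u = 0" for u
    unfolding T_polar by simp
  have "c (Suc k) \<noteq> 0"
  proof
    assume 0: "c (Suc k) = 0"
    have "T y p u = 0" for u
      using rel[of u] by (simp only: T_linear 0 mult_zero_left add_0_right)
    then have "p = 0"
      using y(2) \<open>p \<in> coords ` W\<close> by blast
    then have "\<forall>i<Suc k. c i = 0"
      unfolding p_def by (rule indep)
    then show False
      using c(1) 0 by (auto simp: le_less less_Suc_eq_le)
  qed
  define q where "q = fscale (- inverse (c (Suc k))) p"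
  have "T y (v - q) u = 0" for u
    using rel[of u] \<open>c (Suc k) \<noteq> 0\<close> by (simp only: T_linear q_def) (simp add: field_simps)
  moreover have "q \<in> coords ` W"
  proof -
    have "q = (\<Sum>i<Suc k. fscale (- inverse (c (Suc k)) * c i) (b i))"
      unfolding q_def p_def fun_space.scale_sum_right fun_space.scale_scale ..
    then show ?thesis
      unfolding W(2) by (intro image_eqI[of _ _ "\<lambda>i. - inverse (c (Suc k)) * c i"]) auto
  qed
  ultimately show ?thesis
    by blast
qed

end

section \<open>Splitting the cubic along W and K\<close>

lemma (in vector_space) sum_append:
  "(\<Sum>i<m + l. c i *s (if i < m then b i else h (i - m))) =
    (\<Sum>i<(m::nat). c i *s b i) + (\<Sum>j<l. c (m + j) *s h j)"
  by (induction l) (simp_all add: add.assoc)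

lemma unit_fun_expand:
  fixes v :: "nat \<Rightarrow> 'a::field"
  shows "(\<And>i. i > n \<Longrightarrow> v i = 0) \<Longrightarrow> v = (\<Sum>a\<le>n. fscale (v a) (unit_fun a))"
proof
  fix i assume v: "\<And>i. i > n \<Longrightarrow> v i = 0"
  have "(\<Sum>a\<le>n. v a * unit_fun a i) = (\<Sum>a\<le>n. if a = i then v a else 0)"
    by (intro sum.cong) (auto simp: unit_fun_def)
  then show "v i = (\<Sum>a\<le>n. fscale (v a) (unit_fun a)) i"
    using v[of i] by (simp add: sum_fun_apply fscale_apply)
qed

lemma unit_fun_independent:
  assumes "(\<Sum>a<N. fscale (c a) (unit_fun a)) = (0 :: nat \<Rightarrow> 'a::field)"
  shows "\<forall>a<N. c a = 0"
proof (intro allI impI)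
  fix i assume "i < N"
  have "(\<Sum>a<N. c a * unit_fun a i) = (\<Sum>a<N. if a = i then c a else 0)"
    by (intro sum.cong) (auto simp: unit_fun_def)
  then show "c i = 0"
    using fun_cong[OF assms, of i] \<open>i < N\<close> by (simp add: sum_fun_apply fscale_apply)
qed

text \<open>\<open>K\<close> may contain functions supported beyond \<open>n\<close>, so the
  complement of the span of \<open>b\<close> is taken as its intersection with \<open>Vn\<close>. A
  basis of that intersection, appended to \<open>b\<close>, gives \<open>g\<close>, and
  \<open>G\<close> is the matrix of coordinates with respect to \<open>g\<close>.\<close>

lemma adapted_basis:
  fixes b :: "nat \<Rightarrow> nat \<Rightarrow> 'a::field" and K :: "(nat \<Rightarrow> 'a) set"
  assumes indep: "\<And>c. (\<Sum>i<m. fscale (c i) (b i)) = 0 \<Longrightarrow> \<forall>i<m. c i = 0"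
    and support: "\<And>i j. i < m \<Longrightarrow> j > n \<Longrightarrow> b i j = 0"
    and K: "fun_space.subspace K"
    and compl: "\<And>v. \<exists>c. v - (\<Sum>i<m. fscale (c i) (b i)) \<in> K"
    and disj: "\<And>c. (\<Sum>i<m. fscale (c i) (b i)) \<in> K \<Longrightarrow> (\<Sum>i<m. fscale (c i) (b i)) = 0"
  shows "\<exists>g G. (\<forall>i<m. g i = b i) \<and> (\<forall>i. m \<le> i \<longrightarrow> i \<le> n \<longrightarrow> g i \<in> K) \<and>
    (\<forall>c. (\<Sum>i\<le>n. fscale (c i) (g i)) = 0 \<longrightarrow> (\<forall>i\<le>n. c i = 0)) \<and>
    (\<forall>i\<le>n. \<forall>j>n. g i j = 0) \<and>
    (\<forall>a\<le>n. unit_fun a = (\<Sum>i\<le>n. fscale (G a i) (g i)))"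
proof -
  define Vn where "Vn = {v :: nat \<Rightarrow> 'a. \<forall>i>n. v i = 0}"
  have Vn: "fun_space.subspace Vn"
    by (rule fun_space.subspaceI) (auto simp: Vn_def fscale_apply)
  have Vn_span: "Vn \<subseteq> fun_space.span (unit_fun ` {..<Suc n})"
  proof
    fix v assume "v \<in> Vn"
    then have "v = (\<Sum>a<Suc n. fscale (v a) (unit_fun a))"
      unfolding lessThan_Suc_atMost by (intro unit_fun_expand) (simp add: Vn_def)
    then show "v \<in> fun_space.span (unit_fun ` {..<Suc n})"
      using fun_space.sum_in_span_image[of v unit_fun "Suc n"] by simp
  qed
  have KV: "fun_space.subspace (K \<inter> Vn)"
    using K Vn by (rule fun_space.subspace_inter)
  have "K \<inter> Vn \<subseteq> fun_space.span (unit_fun ` {..<Suc n})"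
    using Vn_span by blast
  from fun_space.subspace_finite_basis[OF KV this finite_imageI[OF finite_lessThan]]
  obtain l :: nat and h where lh:
    "(\<forall>c. (\<Sum>i<l. fscale (c i) (h i)) = 0 \<longrightarrow> (\<forall>i<l. c i = 0)) \<and>
      K \<inter> Vn = range (\<lambda>c. \<Sum>i<l. fscale (c i) (h i))"
    by (elim exE) (rule that)
  note h_indep = lh[THEN conjunct1, THEN spec, THEN mp] and h_range = lh[THEN conjunct2]
  define g where "g i = (if i < m then b i else h (i - m))" for i
  have sum_g: "(\<Sum>i<m + l. fscale (c i) (g i)) =
      (\<Sum>i<m. fscale (c i) (b i)) + (\<Sum>j<l. fscale (c (m + j)) (h j))" for c
    unfolding g_def by (rule fun_space.sum_append)
  have h_in: "(\<Sum>j<l. fscale (c j) (h j)) \<in> K \<inter> Vn" for c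
    unfolding h_range by (rule rangeI)
  have b_in: "(\<Sum>i<m. fscale (c i) (b i)) \<in> Vn" for c
    using support by (auto simp: Vn_def sum_fun_apply fscale_apply intro!: sum.neutral)
  have g_indep: "\<forall>i<m + l. c i = 0" if "(\<Sum>i<m + l. fscale (c i) (g i)) = 0" for c
  proof -
    define p q where "p = (\<Sum>i<m. fscale (c i) (b i))" and "q = (\<Sum>j<l. fscale (c (m + j)) (h j))"
    have "p + q = 0"
      using that unfolding sum_g p_def q_def .
    then have "p = - q"
      by (rule eq_neg_iff_add_eq_0[THEN iffD2])
    moreover have "q \<in> K"
      unfolding q_def by (rule IntD1[OF h_in])
    ultimately have "p \<in> K"
      using fun_space.subspace_neg[OF K] by simp
    then have "p = 0"
      unfolding p_def by (rule disj)
    then have "q = 0"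
      using \<open>p + q = 0\<close> by (simp only: add_0_left)
    have "\<forall>i<m. c i = 0"
      using \<open>p = 0\<close> unfolding p_def by (rule indep)
    moreover have "\<forall>j<l. c (m + j) = 0"
      using \<open>q = 0\<close> unfolding q_def by (rule h_indep)
    ultimately show ?thesis
      by (metis add_diff_inverse_nat add_less_cancel_left)
  qed
  have g_span: "\<exists>c. v = (\<Sum>i<m + l. fscale (c i) (g i))" if v: "v \<in> Vn" for v
  proof -
    obtain c where c: "v - (\<Sum>i<m. fscale (c i) (b i)) \<in> K"
      using compl by blast
    moreover have "v - (\<Sum>i<m. fscale (c i) (b i)) \<in> Vn"
      using v b_in by (rule fun_space.subspace_diff[OF Vn])
    ultimately obtain d where d: "v - (\<Sum>i<m. fscale (c i) (b i)) = (\<Sum>j<l. fscale (d j) (h j))"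
      using h_range by blast
    have "(\<Sum>i<m + l. fscale (if i < m then c i else d (i - m)) (g i)) =
        (\<Sum>i<m. fscale (c i) (b i)) + (\<Sum>j<l. fscale (d j) (h j))"
      unfolding sum_g by (intro arg_cong2[of _ _ _ _ "(+)"] sum.cong) auto
    also have "\<dots> = v"
      unfolding d[symmetric] by simp
    finally show ?thesis
      by (intro exI[of _ "\<lambda>i. if i < m then c i else d (i - m)"]) (rule sym)
  qed
  have h_Vn: "h j \<in> K \<inter> Vn" if "j < l" for j
  proof -
    have "h j = (\<Sum>i<l. fscale (if i = j then 1 else 0) (h i))"
      using that by (simp add: if_distrib[of "\<lambda>c. fscale c _"] cong: if_cong)
    then show ?thesis
      using h_in[of "\<lambda>i. if i = j then 1 else 0"] by (simp only:)
  qed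
  have g_Vn: "g i \<in> Vn" if "i < m + l" for i
    using that h_Vn[of "i - m"] support by (auto simp: g_def Vn_def)
  \<comment> \<open>Both \<open>g\<close> and the unit vectors are independent and span
    \<open>Vn\<close>, so each family is at most as long as the other.\<close>
  have "m + l = Suc n"
  proof (rule antisym)
    note family = fun_space.independent_family[where b = g and l = "m + l", OF g_indep]
    have "g ` {..<m + l} \<subseteq> fun_space.span (unit_fun ` {..<Suc n})"
      using g_Vn Vn_span by blast
    then have "card (g ` {..<m + l}) \<le> card (unit_fun ` {..<Suc n} :: (nat \<Rightarrow> 'a) set)"
      using fun_space.independent_span_bound[OF _ family(2)] by blast
    then show "m + l \<le> Suc n"
      using card_image[OF family(1)] card_image_le[of "{..<Suc n}" "unit_fun :: nat \<Rightarrow> nat \<Rightarrow> 'a"] by simp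
  next
    note family = fun_space.independent_family[where b = "unit_fun :: nat \<Rightarrow> nat \<Rightarrow> 'a" and l = "Suc n",
        OF unit_fun_independent]
    have "unit_fun a \<in> fun_space.span (g ` {..<m + l})" if "a < Suc n" for a
    proof -
      have "unit_fun a \<in> Vn"
        using that by (auto simp: Vn_def unit_fun_def)
      then obtain c where "unit_fun a = (\<Sum>i<m + l. fscale (c i) (g i))"
        using g_span by blast
      then show ?thesis
        using fun_space.sum_in_span_image[of c g "m + l"] by simp
    qed
    then have "(unit_fun :: nat \<Rightarrow> nat \<Rightarrow> 'a) ` {..<Suc n} \<subseteq> fun_space.span (g ` {..<m + l})"
      by blast
    then have "card ((unit_fun :: nat \<Rightarrow> nat \<Rightarrow> 'a) ` {..<Suc n}) \<le> card (g ` {..<m + l})"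
      using fun_space.independent_span_bound[OF _ family(2)] by blast
    then show "Suc n \<le> m + l"
      using card_image[OF family(1)] card_image_le[of "{..<m + l}" g] by simp
  qed
  then have dim: "{..<m + l} = {..n}"
    by (simp only: lessThan_Suc_atMost)
  have "\<exists>c. unit_fun a = (\<Sum>i\<le>n. fscale (c i) (g i))" if "a \<le> n" for a
    using g_span[of "unit_fun a"] that unfolding dim by (auto simp: Vn_def unit_fun_def)
  then obtain G where G: "\<And>a. a \<le> n \<Longrightarrow> unit_fun a = (\<Sum>i\<le>n. fscale (G a i) (g i))"
    by metis
  show ?thesis
  proof (rule exI[of _ g], rule exI[of _ G], intro conjI allI impI)
    show "g i \<in> K" if "m \<le> i" "i \<le> n" for i
      using h_Vn[of "i - m"] that \<open>m + l = Suc n\<close> by (auto simp: g_def)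
    show "c i = 0" if "(\<Sum>i\<le>n. fscale (c i) (g i)) = 0" "i \<le> n" for c i
      using g_indep[of c] that unfolding dim using \<open>m + l = Suc n\<close> by simp
    show "g i j = 0" if "i \<le> n" "n < j" for i j
      using g_Vn[of i] that \<open>m + l = Suc n\<close> by (simp add: Vn_def)
    show "g i = b i" if "i < m" for i
      using that by (simp add: g_def)
    show "unit_fun a = (\<Sum>i\<le>n. fscale (G a i) (g i))" if "a \<le> n" for a
      using that by (rule G)
  qed
qed

lemma (in symmetric_cubic) locus_imp_thom_sebastiani:
  assumes smooth: "smooth_hypersurface n f" and "k < n"
    and W: "VectorSpace.subspace class_ring W (module_vec TYPE('a) (n + 1))"
    and dim: "vectorspace.dim class_ring ((module_vec TYPE('a) (n + 1))\<lparr>carrier := W\<rparr>) = k + 1"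
    and locus: "proj_point ` (W - {0\<^sub>v (n + 1)}) \<subseteq> hessian_locus n (k + 1) f"
  shows "thom_sebastiani_cubic n k f"
proof -
  interpret V: vec_space "TYPE('a)" "n + 1" .
  obtain b where b: "\<forall>c. (\<Sum>i<Suc k. fscale (c i) (b i)) = 0 \<longrightarrow> (\<forall>i<Suc k. c i = 0)"
    "coords ` W = range (\<lambda>c. \<Sum>i<Suc k. fscale (c i) (b i))"
    using V.subspace_dim_basis[OF W] unfolding dim Suc_eq_plus1 by blast
  have W_carrier: "W \<subseteq> carrier_vec (n + 1)"
    by (rule V.subspace_coords(2)[OF W])
  note indep = b(1)[THEN spec, THEN mp]
  have nonzero: "\<exists>v. T y y v \<noteq> 0" if y: "y \<in> range (\<lambda>c. \<Sum>i<Suc k. fscale (c i) (b i))" "y \<noteq> 0" for y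
  proof -
    obtain w where w: "w \<in> W" "y = coords w"
      using y(1) unfolding b(2)[symmetric] by blast
    have "w \<in> carrier_vec (n + 1)"
      using w(1) W_carrier by blast
    moreover have "w \<noteq> 0\<^sub>v (n + 1)"
      using V.coords_zero_iff[OF calculation] y(2) w(2) by blast
    ultimately show ?thesis
      unfolding w(2) by (rule smooth_nonzero[OF smooth])
  qed
  obtain x where x: "x \<in> range (\<lambda>c. \<Sum>i<Suc k. fscale (c i) (b i))"
    "\<forall>y\<in>range (\<lambda>c. \<Sum>i<Suc k. fscale (c i) (b i)). y \<noteq> 0 \<longrightarrow> (\<exists>v. T x y v \<noteq> 0)"
    using nondegenerate_square[where m = "Suc k" and b = b, OF indep nonzero] by blast
  interpret D: degenerate_polars fscale "trilin n t" "Suc k" b "range (\<lambda>c. \<Sum>i<Suc k. fscale (c i) (b i))" x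
  proof (unfold_locales, goal_cases)
    case (1 c)
    then show ?case by (rule indep)
  next
    case (2 y)
    then show ?case by (rule nonzero)
  next
    case (3 y v)
    then show ?case
      using locus_rank_condition[OF W_carrier b(2) indep locus, of y v] unfolding b(2) by blast
  next
    case 4
    show ?case by (rule x(1))
  next
    case (5 y)
    then show ?case
      using x(2) by blast
  qed
  have b_support: "b i j = 0" if "i < Suc k" "j > n" for i j
  proof -
    have "b i \<in> coords ` W"
      unfolding b(2) by (rule D.b_in_W[OF that(1)])
    then show ?thesis
      using W_carrier that(2) by (auto simp: coords_def)
  qed
  have K: "fun_space.subspace D.K"
    by (rule fun_space.subspaceI) (auto simp: D.K_def T_linear T_zero)
  have compl: "\<exists>c. v - (\<Sum>i<Suc k. fscale (c i) (b i)) \<in> D.K" for v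
    using D.complement[of v] by blast
  have disj: "(\<Sum>i<Suc k. fscale (c i) (b i)) = 0" if "(\<Sum>i<Suc k. fscale (c i) (b i)) \<in> D.K" for c
    using that D.x(2)[OF D.combI] by (simp only: D.K_iff)
  have "\<exists>g G. (\<forall>i<Suc k. g i = b i) \<and> (\<forall>i. Suc k \<le> i \<longrightarrow> i \<le> n \<longrightarrow> g i \<in> D.K) \<and>
    (\<forall>c. (\<Sum>i\<le>n. fscale (c i) (g i)) = 0 \<longrightarrow> (\<forall>i\<le>n. c i = 0)) \<and>
    (\<forall>i\<le>n. \<forall>j>n. g i j = 0) \<and>
    (\<forall>a\<le>n. unit_fun a = (\<Sum>i\<le>n. fscale (G a i) (g i)))"
    by (rule adapted_basis) (erule indep, erule (1) b_support, rule K, rule compl, erule disj)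
  then obtain g G where gG: "(\<forall>i<Suc k. g i = b i) \<and> (\<forall>i. Suc k \<le> i \<longrightarrow> i \<le> n \<longrightarrow> g i \<in> D.K) \<and>
    (\<forall>c. (\<Sum>i\<le>n. fscale (c i) (g i)) = 0 \<longrightarrow> (\<forall>i\<le>n. c i = 0)) \<and>
    (\<forall>i\<le>n. \<forall>j>n. g i j = 0) \<and>
    (\<forall>a\<le>n. unit_fun a = (\<Sum>i\<le>n. fscale (G a i) (g i)))"
    by (elim exE) (rule that)
  note g = gG[THEN conjunct1, rule_format] gG[THEN conjunct2, THEN conjunct1, rule_format]
    gG[THEN conjunct2, THEN conjunct2, THEN conjunct1, rule_format]
    gG[THEN conjunct2, THEN conjunct2, THEN conjunct2, THEN conjunct1, rule_format]
    gG[THEN conjunct2, THEN conjunct2, THEN conjunct2, THEN conjunct2, rule_format]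
  \<comment> \<open>These are the coordinate forms dual to the basis \<open>g\<close>. Expressing
    the variables through them turns the coefficients of \<open>f\<close> into the values of
    \<open>T\<close> on triples of basis vectors.\<close>
  define l where "l i = (\<Sum>a\<le>n. Const (G a i) * X a)" for i
  have expand: "X a = (\<Sum>i\<le>n. Const (g i a) * l i)" if "a \<le> n" for a
  proof -
    have "(\<Sum>i\<le>n. g i a * G c i) = unit_fun c a" if "c \<le> n" for c
      using fun_cong[OF g(5)[OF that], of a] by (simp add: sum_fun_apply fscale_apply mult.commute)
    then have "(\<Sum>i\<le>n. Const (g i a) * l i) = (\<Sum>c\<le>n. Const (unit_fun c a) * X c)"
      unfolding l_def linear_combination_of_forms by (intro sum.cong) auto
    also have "\<dots> = (\<Sum>c\<le>n. if c = a then X c else 0)"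
      by (intro sum.cong) (auto simp: unit_fun_def)
    finally show ?thesis
      using that by simp
  qed
  define s where "s p q r = T (g p) (g q) (g r)" for p q r
  have "f = cubic {..n} t (\<lambda>a. \<Sum>i\<le>n. Const (g i a) * l i)"
    unfolding f_cubic cubic_def by (intro sum.cong refl) (simp only: expand atMost_iff)
  also have "\<dots> = cubic {..n} s l"
    unfolding cubic_substitute s_def trilin_def ..
  also have "\<dots> = cubic {0..k} s l + cubic {k+1..n} s l"
  proof (rule cubic_forms_split[OF \<open>k < n\<close>])
    fix p q r assume le: "p \<le> n" "q \<le> n" "r \<le> n" and mixed: "\<not> (p \<le> k \<and> q \<le> k \<and> r \<le> k)"
      "\<not> (k < p \<and> k < q \<and> k < r)"
    have van: "T u w v = 0" if "u \<in> g ` {Suc k..n}" "w \<in> g ` {..k}" for u w v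
      using that D.K_vanishes_on_W[of u w v] g(1,2) D.b_in_W by auto
    have mem: "i \<le> n \<Longrightarrow> i \<le> k \<Longrightarrow> g i \<in> g ` {..k}" "i \<le> n \<Longrightarrow> \<not> i \<le> k \<Longrightarrow> g i \<in> g ` {Suc k..n}" for i
      by auto
    have perm: "T u w v = T w u v" "T u w v = T u v w" for u w v
      by (rule T_sym12, rule T_sym23)
    show "s p q r = 0"
    proof (cases "p \<le> k")
      case p: True
      show ?thesis
      proof (cases "q \<le> k")
        case True
        then have "\<not> r \<le> k"
          using p mixed by simp
        have "T (g p) (g q) (g r) = T (g r) (g p) (g q)"
          by (metis perm)
        then show ?thesis
          using van[OF mem(2)[OF le(3) \<open>\<not> r \<le> k\<close>] mem(1)[OF le(1) p]] by (simp add: s_def)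
      next
        case False
        then show ?thesis
          using van[OF mem(2)[OF le(2) False] mem(1)[OF le(1) p]] perm(1)[of "g p"] by (simp add: s_def)
      qed
    next
      case p: False
      show ?thesis
      proof (cases "q \<le> k")
        case True
        then show ?thesis
          using van[OF mem(2)[OF le(1) p] mem(1)[OF le(2) True]] by (simp add: s_def)
      next
        case False
        then have "r \<le> k"
          using p mixed by simp
        then show ?thesis
          using van[OF mem(2)[OF le(1) p] mem(1)[OF le(3) \<open>r \<le> k\<close>]] perm(2)[of "g p" "g q"] by (simp add: s_def)
      qed
    qed
  qed
  finally have split: "f = subst_mpoly l (cubic {0..k} s X) + subst_mpoly l (cubic {k+1..n} s X)"
    by (simp only: subst_cubic)
  have "lin_indep_forms n l"
    unfolding lin_indep_forms_def
  proof (intro allI impI)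
    fix c i assume c: "(\<Sum>i\<le>n. Const (c i) * l i) = 0" and i: "i \<le> n"
    have cG: "(\<Sum>j\<le>n. c j * G a j) = 0" if "a \<le> n" for a
      using lookup_linear[of "{..n}" a "\<lambda>a. \<Sum>j\<le>n. c j * G a j"] that c
      unfolding l_def linear_combination_of_forms by simp
    have "g i = (\<Sum>a\<le>n. fscale (g i a) (unit_fun a))"
      using g(4)[OF i] by (rule unit_fun_expand)
    also have "\<dots> = (\<Sum>a\<le>n. fscale (g i a) (\<Sum>j\<le>n. fscale (G a j) (g j)))"
      by (intro sum.cong refl) (simp only: g(5) atMost_iff)
    also have "\<dots> = (\<Sum>a\<le>n. \<Sum>j\<le>n. fscale (g i a * G a j) (g j))"
      by (simp only: fun_space.scale_sum_right fun_space.scale_scale)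
    also have "\<dots> = (\<Sum>j\<le>n. fscale (\<Sum>a\<le>n. g i a * G a j) (g j))"
      by (subst sum.swap) (simp only: fun_space.scale_sum_left)
    finally have gi: "g i = (\<Sum>j\<le>n. fscale (\<Sum>a\<le>n. g i a * G a j) (g j))" .
    have "(\<Sum>j\<le>n. fscale ((\<Sum>a\<le>n. g i a * G a j) - (if j = i then 1 else 0)) (g j)) =
        (\<Sum>j\<le>n. fscale (\<Sum>a\<le>n. g i a * G a j) (g j)) - (\<Sum>j\<le>n. fscale (if j = i then 1 else 0) (g j))"
      by (simp only: fun_space.scale_left_diff_distrib sum_subtractf)
    also have "(\<Sum>j\<le>n. fscale (if j = i then 1 else 0) (g j)) = g i"
      using i by (simp add: if_distrib[of "\<lambda>c. fscale c _"] cong: if_cong)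
    finally have "(\<Sum>j\<le>n. fscale ((\<Sum>a\<le>n. g i a * G a j) - (if j = i then 1 else 0)) (g j)) = 0"
      unfolding gi[symmetric] by (simp only: diff_self)
    \<comment> \<open>\<open>G\<close> and \<open>g\<close> were inverse in one order; independence
      of \<open>g\<close> gives the other order, which recovers the coefficients \<open>c\<close>
      from the vanishing sums \<open>cG\<close>.\<close>
    then have delta: "(\<Sum>a\<le>n. g i a * G a j) = (if j = i then 1 else 0)" if "j \<le> n" for j
      using g(3)[where i = j, of "\<lambda>j. (\<Sum>a\<le>n. g i a * G a j) - (if j = i then 1 else 0)"] that by simp
    have "c i = (\<Sum>j\<le>n. if j = i then c j else 0)"
      using i by simp
    also have "\<dots> = (\<Sum>j\<le>n. \<Sum>a\<le>n. g i a * (c j * G a j))"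
      by (intro sum.cong refl) (simp add: sum_distrib_left[symmetric] mult.left_commute[of "g i _"] delta)
    also have "\<dots> = (\<Sum>a\<le>n. g i a * (\<Sum>j\<le>n. c j * G a j))"
      by (subst sum.swap) (simp only: sum_distrib_left)
    also have "\<dots> = 0"
      by (simp add: cG)
    finally show "c i = 0" .
  qed
  moreover have "l i \<in> forms {0..n} 1" for i
    using linear_in_forms[of "\<lambda>a. G a i" "{..n}"] by (simp add: l_def atLeast0AtMost)
  ultimately show ?thesis
    unfolding thom_sebastiani_cubic_def using split cubic_in_forms by blast
qed

section \<open>A linear subspace of the locus from a splitting\<close>

lemma thom_sebastiani_imp_locus:
  fixes f :: "'a::field_char_0 mpoly"
  assumes TS: "thom_sebastiani_cubic n k f" and "k < n"
  shows "\<exists>L. proj_linear_subspace n k L \<and> L \<subseteq> hessian_locus n (k + 1) f"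
proof -
  interpret V: vec_space "TYPE('a)" "n + 1" .
  obtain l f1 f2 where l: "\<And>i. i \<le> n \<Longrightarrow> l i \<in> forms {0..n} 1" "lin_indep_forms n l"
    and f12: "f1 \<in> forms {0..k} 3" "f2 \<in> forms {k+1..n} 3" "f = subst_mpoly l f1 + subst_mpoly l f2"
    using TS unfolding thom_sebastiani_cubic_def by blast
  have "\<forall>i. \<exists>c. i \<le> n \<longrightarrow> l i = (\<Sum>a\<le>n. Const (c a) * X a)"
    using forms_1_linear[OF finite_atLeastAtMost l(1)] unfolding atLeast0AtMost by blast
  from choice[OF this] obtain \<Lambda> where "\<forall>i. i \<le> n \<longrightarrow> l i = (\<Sum>a\<le>n. Const (\<Lambda> i a) * X a)" ..
  then have \<Lambda>: "l i = (\<Sum>a\<le>n. Const (\<Lambda> i a) * X a)" if "i \<le> n" for i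
    using that by blast
  obtain s1' s2' where s': "f1 = cubic {0..k} s1' X" "f2 = cubic {k+1..n} s2' X"
    using forms_3_cubic[OF finite_atLeastAtMost f12(1)] forms_3_cubic[OF finite_atLeastAtMost f12(2)] by blast
  \<comment> \<open>The two blocks are symmetrized separately, so the tensor of \<open>f\<close> is
    symmetric and still separates into a part from each block.\<close>
  obtain s1 where s1: "cubic {0..k} s1 l = cubic {0..k} s1' l"
    "\<And>i j r. s1 i j r = s1 j i r" "\<And>i j r. s1 i j r = s1 i r j"
    using cubic_symmetric[of "{0..k}" l s1'] by metis
  obtain s2 where s2: "cubic {k+1..n} s2 l = cubic {k+1..n} s2' l"
    "\<And>i j r. s2 i j r = s2 j i r" "\<And>i j r. s2 i j r = s2 i r j"
    using cubic_symmetric[of "{k+1..n}" l s2'] by metis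
  define t1 where "t1 i j r = (\<Sum>p\<in>{0..k}. \<Sum>q\<in>{0..k}. \<Sum>u\<in>{0..k}. s1 p q u * (\<Lambda> p i * (\<Lambda> q j * \<Lambda> u r)))"
    for i j r
  define t2 where "t2 i j r = (\<Sum>p\<in>{k+1..n}. \<Sum>q\<in>{k+1..n}. \<Sum>u\<in>{k+1..n}. s2 p q u * (\<Lambda> p i * (\<Lambda> q j * \<Lambda> u r)))"
    for i j r
  have "cubic {0..k} s1 l = cubic {0..k} s1 (\<lambda>p. \<Sum>a\<le>n. Const (\<Lambda> p a) * X a)"
    unfolding cubic_def using \<Lambda> \<open>k < n\<close> by (intro sum.cong refl) simp
  also have "\<dots> = cubic {..n} t1 X"
    unfolding t1_def by (rule cubic_substitute[of _ _ "\<lambda>a p. \<Lambda> p a"])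
  finally have c1: "subst_mpoly l f1 = cubic {..n} t1 X"
    unfolding s' subst_cubic s1(1) .
  have "cubic {k+1..n} s2 l = cubic {k+1..n} s2 (\<lambda>p. \<Sum>a\<le>n. Const (\<Lambda> p a) * X a)"
    unfolding cubic_def using \<Lambda> by (intro sum.cong refl) simp
  also have "\<dots> = cubic {..n} t2 X"
    unfolding t2_def by (rule cubic_substitute[of _ _ "\<lambda>a p. \<Lambda> p a"])
  finally have c2: "subst_mpoly l f2 = cubic {..n} t2 X"
    unfolding s' subst_cubic s2(1) .
  define t where "t i j r = t1 i j r + t2 i j r" for i j r
  have f: "f = cubic {..n} t X"
    unfolding f12(3) c1 c2 t_def cubic_add ..
  have sym: "t i j r = t j i r" "t i j r = t i r j" for i j r
  proof -
    have "t1 i j r = t1 j i r"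
      unfolding t1_def by (subst sum.swap) (simp add: s1(2)[symmetric] mult.left_commute)
    moreover have "t2 i j r = t2 j i r"
      unfolding t2_def by (subst sum.swap) (simp add: s2(2)[symmetric] mult.left_commute)
    moreover have "t1 i j r = t1 i r j"
      unfolding t1_def by (rule sum.cong[OF refl], subst sum.swap) (simp add: s1(3)[symmetric] mult.commute)
    moreover have "t2 i j r = t2 i r j"
      unfolding t2_def by (rule sum.cong[OF refl], subst sum.swap) (simp add: s2(3)[symmetric] mult.commute)
    ultimately show "t i j r = t j i r" "t i j r = t i r j"
      by (simp_all add: t_def)
  qed
  \<comment> \<open>Independence of the forms says that the transpose of the coefficient matrix has
    trivial kernel. Passing through the determinant gives the same for the matrix itself, which
    makes the systems for dual vectors solvable.\<close>
  have transposed: "\<not> (\<exists>c. (\<exists>j<Suc n. c j \<noteq> 0) \<and> (\<forall>i<Suc n. (\<Sum>j<Suc n. \<Lambda> j i * c j) = 0))"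
  proof clarify
    fix c j assume c: "\<forall>i<Suc n. (\<Sum>j<Suc n. \<Lambda> j i * c j) = 0" "j < Suc n" "c j \<noteq> 0"
    have "(\<Sum>i\<le>n. Const (c i) * l i) = (\<Sum>i\<le>n. Const (c i) * (\<Sum>a\<le>n. Const (\<Lambda> i a) * X a))"
      by (intro sum.cong refl) (simp add: \<Lambda>)
    also have "\<dots> = (\<Sum>a\<le>n. Const (\<Sum>i\<le>n. c i * \<Lambda> i a) * X a)"
      by (rule linear_combination_of_forms[where G = "\<lambda>a i. \<Lambda> i a"])
    also have "\<dots> = 0"
      using c(1) by (intro sum.neutral) (simp add: lessThan_Suc_atMost mult.commute)
    finally show False
      using l(2) c(2,3) unfolding lin_indep_forms_def by auto
  qed
  have "det (mat (Suc n) (Suc n) (\<lambda>(i, j). \<Lambda> j i)) \<noteq> 0"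
    using transposed unfolding det_zero_iff_kernel .
  moreover have "mat (Suc n) (Suc n) (\<lambda>(i, j). \<Lambda> j i) = transpose_mat (mat (Suc n) (Suc n) (\<lambda>(i, j). \<Lambda> i j))"
    by (rule eq_matI) auto
  ultimately have "det (mat (Suc n) (Suc n) (\<lambda>(i, j). \<Lambda> i j)) \<noteq> 0"
    using det_transpose[of "mat (Suc n) (Suc n) (\<lambda>(i, j). \<Lambda> i j)" "Suc n"] by simp
  then have nonsing: "\<forall>j<Suc n. x j = 0" if "\<forall>i<Suc n. (\<Sum>j<Suc n. \<Lambda> i j * x j) = 0" for x
    using that unfolding det_zero_iff_kernel by blast
  have "\<exists>x. \<forall>i<Suc n. (\<Sum>j<Suc n. \<Lambda> i j * x j) = (if i = q then 1 else 0)" for q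
    by (rule nonsingular_system_solvable) (rule nonsing)
  then obtain g' where g': "\<And>q i. i < Suc n \<Longrightarrow> (\<Sum>j<Suc n. \<Lambda> i j * g' q j) = (if i = q then 1 else 0)"
    by metis
  \<comment> \<open>The vectors are dual to the forms: the form with index i takes the value 1 on
    \<open>g i\<close> and 0 on the others. Hence the forms with index above \<open>k\<close> vanish
    on the span of \<open>g 0\<close>, ..., \<open>g k\<close>.\<close>
  define g where "g q = (\<lambda>j. if j < Suc n then g' q j else 0)" for q
  have g: "(\<Sum>j<Suc n. \<Lambda> i j * g q j) = (if i = q then 1 else 0)" if "i < Suc n" for i q
    unfolding g'[OF that, of q, symmetric] by (intro sum.cong) (auto simp: g_def)
  have g_comb: "(\<Sum>j<Suc n. \<Lambda> i j * (\<Sum>q<k + 1. fscale (c q) (g q)) j) = (\<Sum>q<k + 1. c q * (if i = q then 1 else 0))"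
    if "i < Suc n" for i c
  proof -
    have "(\<Sum>j<Suc n. \<Lambda> i j * (\<Sum>q<k + 1. fscale (c q) (g q)) j) = (\<Sum>j<Suc n. \<Sum>q<k + 1. c q * (\<Lambda> i j * g q j))"
      by (intro sum.cong refl) (simp only: sum_fun_apply fscale_apply sum_distrib_left ac_simps)
    also have "\<dots> = (\<Sum>q<k + 1. c q * (\<Sum>j<Suc n. \<Lambda> i j * g q j))"
      by (subst sum.swap) (simp only: sum_distrib_left)
    finally show ?thesis
      by (simp only: g[OF that])
  qed
  have indep: "\<forall>i<k + 1. c i = 0" if "(\<Sum>q<k + 1. fscale (c q) (g q)) = 0" for c
  proof (intro allI impI)
    fix i assume i: "i < k + 1"
    have "(\<Sum>q<k + 1. c q * (if i = q then 1 else 0)) = 0"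
      using g_comb[of i c] i \<open>k < n\<close> unfolding that by simp
    then show "c i = 0"
      using i by (simp add: if_distrib[of "\<lambda>x. c _ * x"] del: sum.lessThan_Suc cong: if_cong)
  qed
  obtain W where W: "VectorSpace.subspace class_ring W V.V" "vectorspace.dim class_ring (V.vs W) = k + 1"
    "coords ` W = fun_space.span (g ` {..<k + 1})" "W \<subseteq> carrier_vec (n + 1)"
    by (rule V.independent_family_subspace[where b = g and l = "k + 1"], erule indep, simp add: g_def, rule that)
  have vanish: "(\<Sum>j\<le>n. \<Lambda> i j * x $ j) = 0" if x: "x \<in> W" and i: "k < i" "i \<le> n" for x i
  proof -
    have "coords x \<in> fun_space.span (g ` {..<k + 1})"
      using x W(3) by blast
    moreover have "fun_space.subspace {y. (\<Sum>j<Suc n. \<Lambda> i j * y j) = 0}"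
      by (rule fun_space.subspaceI)
        (auto simp: fscale_apply distrib_left sum.distrib mult.left_commute sum_distrib_left[symmetric]
          simp del: sum.lessThan_Suc)
    moreover have "g ` {..<k + 1} \<subseteq> {y. (\<Sum>j<Suc n. \<Lambda> i j * y j) = 0}"
      using g i by (auto simp del: sum.lessThan_Suc)
    ultimately have "(\<Sum>j<Suc n. \<Lambda> i j * coords x j) = 0"
      using fun_space.span_minimal by blast
    moreover have "coords x j = x $ j" if "j < Suc n" for j
      using x W(4) that by (auto simp: coords_def)
    ultimately show ?thesis
      unfolding lessThan_Suc_atMost[symmetric] by simp
  qed
  have rank: "V.rank (hessian n f x) \<le> k + 1" if x: "x \<in> W" for x
  proof -
    \<comment> \<open>\<open>\<beta>\<close> gives the coefficients of the Hessian columns in terms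
      of the k + 1 vectors \<open>row p\<close>. The second block contributes nothing, since each of
      its terms contains a form of index above \<open>k\<close> evaluated at
      \<open>x\<close>.\<close>
    define \<beta> where "\<beta> p j = 6 * (\<Sum>q\<in>{0..k}. \<Sum>u\<in>{0..k}. s1 p q u * (\<Lambda> q j * (\<Sum>r\<le>n. \<Lambda> u r * x $ r)))" for p j
    define row where "row p = (\<lambda>i. if i \<le> n then \<Lambda> p i else 0)" for p
    have contract: "(\<Sum>r\<le>n. (\<Sum>p\<in>J. \<Sum>q\<in>J. \<Sum>u\<in>J. s p q u * (\<Lambda> p i * (\<Lambda> q j * \<Lambda> u r))) * x $ r) =
        (\<Sum>p\<in>J. \<Lambda> p i * (\<Sum>q\<in>J. \<Sum>u\<in>J. s p q u * (\<Lambda> q j * (\<Sum>r\<le>n. \<Lambda> u r * x $ r))))" for J s i j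
    proof -
      have "(\<Sum>r\<le>n. (\<Sum>p\<in>J. \<Sum>q\<in>J. \<Sum>u\<in>J. s p q u * (\<Lambda> p i * (\<Lambda> q j * \<Lambda> u r))) * x $ r) =
          (\<Sum>r\<le>n. \<Sum>p\<in>J. \<Sum>q\<in>J. \<Sum>u\<in>J. \<Lambda> p i * (s p q u * (\<Lambda> q j * (\<Lambda> u r * x $ r))))"
        unfolding sum_distrib_right by (simp only: mult_ac)
      also have "\<dots> = (\<Sum>p\<in>J. \<Sum>r\<le>n. \<Sum>q\<in>J. \<Sum>u\<in>J. \<Lambda> p i * (s p q u * (\<Lambda> q j * (\<Lambda> u r * x $ r))))"
        by (rule sum.swap)
      also have "\<dots> = (\<Sum>p\<in>J. \<Sum>q\<in>J. \<Sum>r\<le>n. \<Sum>u\<in>J. \<Lambda> p i * (s p q u * (\<Lambda> q j * (\<Lambda> u r * x $ r))))"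
        by (rule sum.cong[OF refl]) (rule sum.swap)
      also have "\<dots> = (\<Sum>p\<in>J. \<Sum>q\<in>J. \<Sum>u\<in>J. \<Sum>r\<le>n. \<Lambda> p i * (s p q u * (\<Lambda> q j * (\<Lambda> u r * x $ r))))"
        by (rule sum.cong[OF refl], rule sum.cong[OF refl]) (rule sum.swap)
      finally show ?thesis
        by (simp only: sum_distrib_left)
    qed
    have "(\<Sum>r\<le>n. t2 i j r * x $ r) = 0" for i j
      unfolding t2_def contract by (intro sum.neutral ballI) (simp add: vanish[OF x])
    then have entry: "6 * (\<Sum>r\<le>n. t i j r * x $ r) = (\<Sum>p\<in>{0..k}. \<beta> p j * \<Lambda> p i)" for i j
      unfolding t_def distrib_right sum.distrib t1_def contract \<beta>_def
      by (simp add: sum_distrib_left mult.commute mult.left_commute)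
    have "coords (col (hessian n f x) j) \<in> fun_space.span (row ` {..<Suc k})" if "j \<le> n" for j
    proof -
      have "coords (col (hessian n f x) j) = (\<Sum>p<Suc k. fscale (\<beta> p j) (row p))"
        unfolding hessian_column[OF sym f that] entry
        by (auto simp: fun_eq_iff sum_fun_apply fscale_apply row_def lessThan_Suc_atMost atLeast0AtMost)
      then show ?thesis
        using fun_space.sum_in_span_image[of "\<lambda>p. \<beta> p j" row "Suc k"] by simp
    qed
    then have "coords ` set (cols (hessian n f x)) \<subseteq> fun_space.span (row ` {..<Suc k})"
      using hessian_carrier[of n f x] by (auto simp: cols_def less_Suc_eq_le)
    then have "fun_space.dim (coords ` set (cols (hessian n f x))) \<le> card (row ` {..<Suc k})"
      by (rule fun_space.dim_le_card) simp
    also have "\<dots> \<le> k + 1"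
      using card_image_le[of "{..<Suc k}" row] by simp
    finally show ?thesis
      using V.rank_coords[OF hessian_carrier] by simp
  qed
  show ?thesis
  proof (intro exI conjI)
    show "proj_linear_subspace n k (proj_point ` (W - {0\<^sub>v (n + 1)}))"
      unfolding proj_linear_subspace_def using W(1,2) by blast
    show "proj_point ` (W - {0\<^sub>v (n + 1)}) \<subseteq> hessian_locus n (k + 1) f"
      unfolding hessian_locus_def using W(4) rank by blast
  qed
qed

theorem theoremB:
  fixes f :: "'a::{alg_closed_field, field_char_0} mpoly" and n k :: nat
  assumes "n \<ge> 2" and "k \<le> n - 1"
    and "f \<in> forms {0..n} 3"
    and "smooth_hypersurface n f"
  shows "thom_sebastiani_cubic n k f \<longleftrightarrow>
    (\<exists>L. proj_linear_subspace n k L \<and> L \<subseteq> hessian_locus n (k + 1) f)"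
proof
  have "k < n"
    using assms(1,2) by simp
  then show "\<exists>L. proj_linear_subspace n k L \<and> L \<subseteq> hessian_locus n (k + 1) f"
    if "thom_sebastiani_cubic n k f"
    using that by (rule thom_sebastiani_imp_locus[rotated])
  obtain t where "f = cubic {0..n} t X"
    using forms_3_cubic[OF finite_atLeastAtMost assms(3)] by blast
  moreover obtain s where s: "cubic {0..n} s X = cubic {0..n} t X \<and>
      (\<forall>i j r. s i j r = s j i r) \<and> (\<forall>i j r. s i j r = s i r j)"
    using cubic_symmetric ..
  ultimately have f: "f = cubic {..n} s X"
    by (simp add: atLeast0AtMost)
  interpret symmetric_cubic n s f
    by (intro symmetric_cubic.intro symmetric_cubic_axioms.intro trilin_symmetric_trilinear_form)
      (use s f in blast)+
  show "thom_sebastiani_cubic n k f"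
    if "\<exists>L. proj_linear_subspace n k L \<and> L \<subseteq> hessian_locus n (k + 1) f"
    using that locus_imp_thom_sebastiani[OF assms(4) \<open>k < n\<close>]
    unfolding proj_linear_subspace_def by blast
qed

end
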